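(* If the distance to block of a graph $G$ with $n$ vertices is $k$, then POHPP and POHCP can be solved on $G$ in $n^{O(k)}$ time.
   Context: All graphs are finite and simple. A graph is 2-connected if it is connected and has no cut vertex; a block is an inclusion-maximal 2-connected induced subgraph; a block graph is a graph all of whose blocks are cliques. The distance to block of $G$ is the minimum number of vertices whose deletion leaves a block graph. A partial order $\pi$ on $V(G)$ is a reflexive, antisymmetric, transitive relation. An ordered Hamiltonian path $(v_1,\dots,v_n)$ of $G$ (each vertex exactly once, consecutive vertices adjacent) is $\pi$-extending if $(v_i,v_j)\in\pi$ implies $i\le j$. POHPP: given $G$ and $\pi$, decide whether $G$ has a $\pi$-extending ordered Hamiltonian path. POHCP: given $G$ and $\pi$, decide whether $G$ has a $\pi$-extending ordered Hamiltonian path $(v_1,\dots,v_n)$ with $v_1v_n\in E(G)$. *)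

theory Defs
  imports "Graph_Theory.Graph_Theory"
begin

section \<open>Block graphs\<close>

text \<open>
  Finite simple graphs are represented as in the theory of Noschinski: irreflexive symmetric finite
  digraphs without parallel arcs (locale \<open>graph\<close>, or \<open>pair_graph\<close> for arcs that are
  pairs of vertices). The definitions below are meant for such graphs only; in particular, by
  symmetry the strongly connected components counted in \<open>cut_vertex\<close> are the usual
  connected components.
\<close>

definition cut_vertex :: "('a,'b) pre_digraph \<Rightarrow> 'a \<Rightarrow> bool" where
  "cut_vertex G v \<longleftrightarrow> v \<in> verts G \<and>
     card (pre_digraph.sccs_verts G) < card (pre_digraph.sccs_verts (pre_digraph.del_vert G v))"

definition two_connected :: "('a,'b) pre_digraph \<Rightarrow> bool" where
  "two_connected G \<longleftrightarrow> connected G \<and> (\<nexists>v. cut_vertex G v)"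

definition block_of :: "('a,'b) pre_digraph \<Rightarrow> ('a,'b) pre_digraph \<Rightarrow> bool" where
  "block_of B G \<longleftrightarrow> induced_subgraph B G \<and> two_connected B \<and>
     \<not> (\<exists>B'. induced_subgraph B' G \<and> two_connected B' \<and> verts B \<subset> verts B')"

definition clique :: "('a,'b) pre_digraph \<Rightarrow> bool" where
  "clique G \<longleftrightarrow> (\<forall>u \<in> verts G. \<forall>v \<in> verts G. u \<noteq> v \<longrightarrow> u \<rightarrow>\<^bsub>G\<^esub> v)"

definition block_graph :: "('a,'b) pre_digraph \<Rightarrow> bool" where
  "block_graph G \<longleftrightarrow> (\<forall>B. block_of B G \<longrightarrow> clique B)"

definition distance_to_block :: "('a,'b) pre_digraph \<Rightarrow> nat" where
  "distance_to_block G =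
     (LEAST k. \<exists>S \<subseteq> verts G. card S = k \<and> block_graph (G \<restriction> (verts G - S)))"


section \<open>Partially ordered Hamiltonian paths and cycles\<close>

definition hamiltonian_path :: "('a,'b) pre_digraph \<Rightarrow> 'a list \<Rightarrow> bool" where
  "hamiltonian_path G p \<longleftrightarrow> vpath p G \<and> set p = verts G"

definition extending :: "('a \<times> 'a) set \<Rightarrow> 'a list \<Rightarrow> bool" where
  "extending \<pi> p \<longleftrightarrow>
     (\<forall>i < length p. \<forall>j < length p. (p ! i, p ! j) \<in> \<pi> \<longrightarrow> i \<le> j)"

definition POHPP :: "('a,'b) pre_digraph \<Rightarrow> ('a \<times> 'a) set \<Rightarrow> bool" where
  "POHPP G \<pi> \<longleftrightarrow> (\<exists>p. hamiltonian_path G p \<and> extending \<pi> p)"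

definition POHCP :: "('a,'b) pre_digraph \<Rightarrow> ('a \<times> 'a) set \<Rightarrow> bool" where
  "POHCP G \<pi> \<longleftrightarrow>
     (\<exists>p. hamiltonian_path G p \<and> extending \<pi> p \<and> hd p \<rightarrow>\<^bsub>G\<^esub> last p)"


section \<open>Model of computation\<close>

text \<open>
  Algorithms are programs of a first-order call-by-value functional language over binary trees
  (the language F of Jones, \<^emph>\<open>Computability and Complexity from a Programming Perspective\<close>,
  with functions of several arguments and local bindings). A program is a list of function bodies;
  in a body, \<open>Var i\<close> is the \<open>i\<close>-th entry of the environment, which initially
  consists of the arguments and to which \<open>Bind\<close> adds an entry at the front. There is no
  primitive arithmetic and no primitive test for equality of trees. Every evaluated subexpression
  costs one unit of time. With trees implemented as shared pointer structures, a computation of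
  \<open>t\<close> steps allocates at most \<open>t\<close> cells; so running times agree with those of
  Turing machines up to polynomials.
\<close>

datatype tree = Leaf | Node tree tree

fun left :: "tree \<Rightarrow> tree" where
  "left Leaf = Leaf"
| "left (Node x y) = x"

fun right :: "tree \<Rightarrow> tree" where
  "right Leaf = Leaf"
| "right (Node x y) = y"

datatype expr =
    Var nat
  | LeafE
  | NodeE expr expr
  | LeftE expr
  | RightE expr
  | Cond expr expr expr
  | Bind expr expr
  | Call nat "expr list"

type_synonym program = "expr list"

text \<open>
  \<open>evaluates P env e t x\<close>: in environment \<open>env\<close>, the expression \<open>e\<close>
  evaluates to \<open>x\<close> in exactly \<open>t\<close> steps. An unbound variable or function has no
  value.
\<close>

inductive evaluates :: "program \<Rightarrow> tree list \<Rightarrow> expr \<Rightarrow> nat \<Rightarrow> tree \<Rightarrow> bool"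
  and evaluates_list :: "program \<Rightarrow> tree list \<Rightarrow> expr list \<Rightarrow> nat \<Rightarrow> tree list \<Rightarrow> bool"
  for P :: program
where
  Var: "i < length env \<Longrightarrow> evaluates P env (Var i) 1 (env ! i)"
| LeafE: "evaluates P env LeafE 1 Leaf"
| NodeE: "evaluates P env a s x \<Longrightarrow> evaluates P env b t y \<Longrightarrow>
    evaluates P env (NodeE a b) (Suc (s + t)) (Node x y)"
| LeftE: "evaluates P env a s x \<Longrightarrow> evaluates P env (LeftE a) (Suc s) (left x)"
| RightE: "evaluates P env a s x \<Longrightarrow> evaluates P env (RightE a) (Suc s) (right x)"
| Cond_true: "evaluates P env a s x \<Longrightarrow> x \<noteq> Leaf \<Longrightarrow> evaluates P env b t y \<Longrightarrow>
    evaluates P env (Cond a b c) (Suc (s + t)) y"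
| Cond_false: "evaluates P env a s Leaf \<Longrightarrow> evaluates P env c t y \<Longrightarrow>
    evaluates P env (Cond a b c) (Suc (s + t)) y"
| Bind: "evaluates P env a s x \<Longrightarrow> evaluates P (x # env) b t y \<Longrightarrow>
    evaluates P env (Bind a b) (Suc (s + t)) y"
| Call: "evaluates_list P env as s xs \<Longrightarrow> f < length P \<Longrightarrow> evaluates P xs (P ! f) t y \<Longrightarrow>
    evaluates P env (Call f as) (Suc (s + t)) y"
| Nil: "evaluates_list P env [] 0 []"
| Cons: "evaluates P env a s x \<Longrightarrow> evaluates_list P env as t xs \<Longrightarrow>
    evaluates_list P env (a # as) (s + t) (x # xs)"

inductive_cases evaluates_cases:
  "evaluates P env (Var i) t x" "evaluates P env LeafE t x" "evaluates P env (NodeE a b) t x"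
  "evaluates P env (LeftE a) t x" "evaluates P env (RightE a) t x"
  "evaluates P env (Cond a b c) t x" "evaluates P env (Bind a b) t x"
  "evaluates P env (Call f as) t x"
  "evaluates_list P env [] t xs" "evaluates_list P env (a # as) t xs"

lemma evaluates_deterministic:
  "evaluates P env e t x \<Longrightarrow> evaluates P env e t' x' \<Longrightarrow> t' = t \<and> x' = x"
  "evaluates_list P env es t xs \<Longrightarrow> evaluates_list P env es t' xs' \<Longrightarrow> t' = t \<and> xs' = xs"
  by (induction arbitrary: t' x' and t' xs' rule: evaluates_evaluates_list.inducts)
    (erule evaluates_cases; (blast | simp))+

text \<open>The main function of a program is its first one.\<close>

definition runs :: "program \<Rightarrow> tree \<Rightarrow> nat \<Rightarrow> tree \<Rightarrow> bool" where
  "runs P x t y \<longleftrightarrow> evaluates P [x] (Call 0 [Var 0]) t y"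


section \<open>Encoding of instances\<close>

definition bool_tree :: "bool \<Rightarrow> tree" where
  "bool_tree b = (if b then Node Leaf Leaf else Leaf)"

definition list_tree :: "tree list \<Rightarrow> tree" where
  "list_tree xs = foldr Node xs Leaf"

text \<open>The \<open>n \<times> n\<close> Boolean matrix of a relation on \<open>{..<n}\<close>, as a list of rows\<close>

definition matrix_tree :: "nat \<Rightarrow> (nat \<times> nat) set \<Rightarrow> tree" where
  "matrix_tree n R =
     list_tree (map (\<lambda>i. list_tree (map (\<lambda>j. bool_tree ((i, j) \<in> R)) [0..<n])) [0..<n])"

text \<open>An instance whose graph has vertex set \<open>{..<n}\<close>\<close>

definition instance_tree :: "(nat,'b) pre_digraph \<Rightarrow> (nat \<times> nat) set \<Rightarrow> tree" where
  "instance_tree G \<pi> =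
     Node (matrix_tree (card (verts G)) (arcs_ends G)) (matrix_tree (card (verts G)) \<pi>)"

text \<open>
  \<open>decides_in_n_to_O_k P Q \<kappa>\<close>: on every instance with \<open>n\<close> vertices and
  parameter \<open>k\<close>, the program \<open>P\<close> answers \<open>Q\<close> within \<open>n\<^bsup>O(k)\<^esup>\<close>
  steps. The parameter is not part of the input. The bound has the form
  \<open>n\<^bsup>c k\<^esup>\<close>, except that the exponent \<open>0\<close> is replaced by \<open>c\<close>
  (polynomial time when \<open>k = 0\<close>) and that a constant is added to cover \<open>n \<le> 1\<close>;
  for \<open>n \<ge> 2\<close> this constant is subsumed by increasing \<open>c\<close> in the exponent.
\<close>

definition decides_in_n_to_O_k ::
  "program \<Rightarrow> ((nat, nat \<times> nat) pre_digraph \<Rightarrow> (nat \<times> nat) set \<Rightarrow> bool) \<Rightarrow>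
   ((nat, nat \<times> nat) pre_digraph \<Rightarrow> nat) \<Rightarrow> bool" where
  "decides_in_n_to_O_k P Q \<kappa> \<longleftrightarrow>
     (\<exists>c. \<forall>(G :: nat pair_pre_digraph) \<pi> n k.
        pair_graph G \<longrightarrow> pverts G = {..<n} \<longrightarrow> partial_order_on {..<n} \<pi> \<longrightarrow>
        \<kappa> (with_proj G) = k \<longrightarrow>
        (\<exists>t \<le> n ^ (c * max 1 k) + c.
           runs P (instance_tree (with_proj G) \<pi>) t (bool_tree (Q (with_proj G) \<pi>))))"

end

theory Submission
  imports Defs
begin

text \<open>
  Delete a set \<open>S\<close> of \<open>k\<close> vertices such that a block graph remains, and guess the vertices of a
  Hamiltonian path that lie in \<open>S\<close>, are adjacent on the path to a vertex of \<open>S\<close>, or are its ends, in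
  the order of the path. There are at most \<open>3 k + 2\<close> of these anchors. Between two
  consecutive anchors \<open>a\<close>, \<open>b\<close> outside \<open>S\<close>, the path has to visit all vertices separating \<open>a\<close> from
  \<open>b\<close> in \<open>G - S\<close>, and between two of those it stays in one block, hence in a clique. So only the
  distribution of the remaining vertices over these visits to blocks is open, and it can be made
  greedily: if all vertices that are needed for anchors or separators are reserved, then visiting
  every other vertex as soon as its predecessors and its block allow it only enlarges the set of
  visited vertices compared with the given path at each separator.
  Since \<open>k\<close> is not given, all sets of size \<open>0, 1, \<dots>\<close> are tried until the rest is a block graph.

  The running time comes from expressing the algorithm in a language whose only loops are folds over
  lists: if all these lists have length at most \<open>B\<close>, then the time is at most \<open>C (B + 1)\<^sup>d\<close>, where
  \<open>C\<close> and \<open>d\<close> depend only on the expression. Here \<open>B = (n + 2)\<^bsup>3 k + 3\<^esup>\<close>, because the longest list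
  contains all possible sequences of anchors.
\<close>

section \<open>Compiling bounded loops\<close>

text \<open>Each vertex of \<open>S\<close> accounts for three anchors, namely itself and its two
  neighbours on the path; the other two are the ends. A wrong guess cannot cause a wrong answer:
  whatever \<open>S\<close> and the anchors are, the greedy rule builds only paths that respect the
  order. So it suffices that some guess succeeds if a solution exists. For this, the block graph
  enters only through \<open>block_closed\<close>, and the search may stop at the first size at
  which some list passes that test, which is at most \<open>k\<close>.

  The obstacle in comparing the greedy path with the given one is that they may run through a block
  in different orders and leave different vertices for later. So they are compared only at
  separators; in between, all that is known is that the current vertex lies in the block by which
  the given path leaves the last separator. No block is ever computed: an unvisited neighbour of the
  current vertex \<open>u\<close> belongs to that block iff it is still connected to the target
  after deleting \<open>u\<close>.\<close>

datatype loop_expr =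
    LVar nat
  | LLeaf
  | LNode loop_expr loop_expr
  | LLeft loop_expr
  | LRight loop_expr
  | LIf loop_expr loop_expr loop_expr
  | LLet loop_expr loop_expr
  | LFold loop_expr loop_expr loop_expr

text \<open>The default value makes \<open>loop_val\<close> total. The target language gives unbound
  variables no value, so an index out of range is compiled to \<open>LeafE\<close>.\<close>

fun entry :: "tree list \<Rightarrow> nat \<Rightarrow> tree" where
  "entry [] i = Leaf"
| "entry (x # xs) 0 = x"
| "entry (x # xs) (Suc i) = entry xs i"

lemma entry_eq: "entry xs i = (if i < length xs then xs ! i else Leaf)"
  by (induction xs i rule: entry.induct) auto

fun items :: "tree \<Rightarrow> tree list" where
  "items Leaf = []"
| "items (Node x y) = x # items y"

lemma items_list_tree [simp]: "items (list_tree xs) = xs"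
  by (induction xs) (auto simp: list_tree_def)

primrec loop_val :: "loop_expr \<Rightarrow> tree list \<Rightarrow> tree" where
  "loop_val (LVar i) env = entry env i"
| "loop_val LLeaf env = Leaf"
| "loop_val (LNode a b) env = Node (loop_val a env) (loop_val b env)"
| "loop_val (LLeft a) env = left (loop_val a env)"
| "loop_val (LRight a) env = right (loop_val a env)"
| "loop_val (LIf a b c) env = (if loop_val a env \<noteq> Leaf then loop_val b env else loop_val c env)"
| "loop_val (LLet a b) env = loop_val b (loop_val a env # env)"
| "loop_val (LFold l i b) env =
     fold (\<lambda>x acc. loop_val b (x # acc # env)) (items (loop_val l env)) (loop_val i env)"

text \<open>The loops inside a loop body may depend on the accumulator, so their bounds are required
  only for the accumulators that actually occur during the fold.\<close>

fun fold_all :: "('a \<Rightarrow> 'b \<Rightarrow> bool) \<Rightarrow> ('a \<Rightarrow> 'b \<Rightarrow> 'b) \<Rightarrow> 'a list \<Rightarrow> 'b \<Rightarrow> bool" where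
  "fold_all Q f [] s \<longleftrightarrow> True"
| "fold_all Q f (x # xs) s \<longleftrightarrow> Q x s \<and> fold_all Q f xs (f x s)"

primrec loops_bounded :: "nat \<Rightarrow> loop_expr \<Rightarrow> tree list \<Rightarrow> bool" where
  "loops_bounded B (LVar i) env \<longleftrightarrow> True"
| "loops_bounded B LLeaf env \<longleftrightarrow> True"
| "loops_bounded B (LNode a b) env \<longleftrightarrow> loops_bounded B a env \<and> loops_bounded B b env"
| "loops_bounded B (LLeft a) env \<longleftrightarrow> loops_bounded B a env"
| "loops_bounded B (LRight a) env \<longleftrightarrow> loops_bounded B a env"
| "loops_bounded B (LIf a b c) env \<longleftrightarrow> loops_bounded B a env \<and>
     (if loop_val a env \<noteq> Leaf then loops_bounded B b env else loops_bounded B c env)"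
| "loops_bounded B (LLet a b) env \<longleftrightarrow>
     loops_bounded B a env \<and> loops_bounded B b (loop_val a env # env)"
| "loops_bounded B (LFold l i b) env \<longleftrightarrow> loops_bounded B l env \<and> loops_bounded B i env \<and>
     length (items (loop_val l env)) \<le> B \<and>
     fold_all (\<lambda>x acc. loops_bounded B b (x # acc # env)) (\<lambda>x acc. loop_val b (x # acc # env))
       (items (loop_val l env)) (loop_val i env)"

section \<open>Evaluation within a time bound\<close>

lemma evaluates_list_Vars:
  assumes "\<forall>i\<in>set is. i < length env"
  shows "evaluates_list P env (map Var is) (length is) (map ((!) env) is)"
  using assms
proof (induction "is")
  case (Cons i "is")
  then show ?case
    using evaluates_evaluates_list.Cons[OF evaluates_evaluates_list.Var, of i env P "map Var is"]
    by simp
qed (simp add: evaluates_evaluates_list.Nil)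

text \<open>The semantics counts steps exactly, which depends on the branches taken. Upper bounds
  compose without that knowledge.\<close>

definition eval_within :: "program \<Rightarrow> tree list \<Rightarrow> expr \<Rightarrow> nat \<Rightarrow> tree \<Rightarrow> bool" where
  "eval_within P env e T x \<longleftrightarrow> (\<exists>t \<le> T. evaluates P env e t x)"

lemma eval_withinI: "evaluates P env e t x \<Longrightarrow> t \<le> T \<Longrightarrow> eval_within P env e T x"
  unfolding eval_within_def by blast

lemma eval_within_mono: "eval_within P env e T x \<Longrightarrow> T \<le> T' \<Longrightarrow> eval_within P env e T' x"
  unfolding eval_within_def using order_trans by blast

lemma eval_within_Node: "eval_within P env a s x \<Longrightarrow> eval_within P env b t y \<Longrightarrow>
    eval_within P env (NodeE a b) (Suc (s + t)) (Node x y)"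
  unfolding eval_within_def by (meson evaluates_evaluates_list.NodeE Suc_le_mono add_le_mono)

lemma eval_within_Left: "eval_within P env a s x \<Longrightarrow> eval_within P env (LeftE a) (Suc s) (left x)"
  unfolding eval_within_def by (meson evaluates_evaluates_list.LeftE Suc_le_mono)

lemma eval_within_Right: "eval_within P env a s x \<Longrightarrow> eval_within P env (RightE a) (Suc s) (right x)"
  unfolding eval_within_def by (meson evaluates_evaluates_list.RightE Suc_le_mono)

lemma eval_within_Cond: "eval_within P env a s x \<Longrightarrow> (x \<noteq> Leaf \<Longrightarrow> eval_within P env b t y) \<Longrightarrow>
    (x = Leaf \<Longrightarrow> eval_within P env c t y) \<Longrightarrow> eval_within P env (Cond a b c) (Suc (s + t)) y"
  unfolding eval_within_def
  by (cases "x = Leaf")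
    (metis evaluates_evaluates_list.Cond_false Suc_le_mono add_le_mono,
     metis evaluates_evaluates_list.Cond_true Suc_le_mono add_le_mono)

lemma eval_within_Bind: "eval_within P env a s x \<Longrightarrow> eval_within P (x # env) b t y \<Longrightarrow>
    eval_within P env (Bind a b) (Suc (s + t)) y"
  unfolding eval_within_def by (meson evaluates_evaluates_list.Bind Suc_le_mono add_le_mono)

lemma upt_entries: "map ((!) (xs @ env)) [length xs..<length xs + length env] = env"
  by (rule nth_equalityI) (auto simp: nth_append)

text \<open>A called function sees only its arguments. The environment is therefore passed on
  variable by variable, at a cost of \<open>length env\<close>; \<open>xs\<close> are the temporary
  entries in front of it, which are dropped.\<close>

lemma eval_within_Call1:
  assumes "eval_within P (xs @ env) a s x" "f < length P" "eval_within P (x # env) (P ! f) t y"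
  shows "eval_within P (xs @ env) (Call f (a # map Var [length xs..<length xs + length env]))
    (Suc (s + length env + t)) y"
proof -
  from assms obtain s' t' where *: "s' \<le> s" "evaluates P (xs @ env) a s' x"
    "t' \<le> t" "evaluates P (x # env) (P ! f) t' y"
    unfolding eval_within_def by blast
  have "evaluates_list P (xs @ env) (a # map Var [length xs..<length xs + length env])
      (s' + length [length xs..<length xs + length env]) (x # env)"
    using evaluates_evaluates_list.Cons[OF *(2)
        evaluates_list_Vars[of "[length xs..<length xs + length env]" "xs @ env"]]
    unfolding upt_entries by simp
  from evaluates_evaluates_list.Call[OF this assms(2) *(4)]
  show ?thesis by (rule eval_withinI) (use * in simp)
qed

lemma eval_within_Call2:
  assumes "eval_within P (xs @ env) a s x" "eval_within P (xs @ env) a' s' x'" "f < length P"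
    "eval_within P (x # x' # env) (P ! f) t y"
  shows "eval_within P (xs @ env) (Call f (a # a' # map Var [length xs..<length xs + length env]))
    (Suc (s + s' + length env + t)) y"
proof -
  from assms obtain r r' t' where *: "r \<le> s" "evaluates P (xs @ env) a r x"
    "r' \<le> s'" "evaluates P (xs @ env) a' r' x'"
    "t' \<le> t" "evaluates P (x # x' # env) (P ! f) t' y"
    unfolding eval_within_def by blast
  have "evaluates_list P (xs @ env) (a # a' # map Var [length xs..<length xs + length env])
      (r + (r' + length [length xs..<length xs + length env])) (x # x' # env)"
    using evaluates_evaluates_list.Cons[OF *(2) evaluates_evaluates_list.Cons[OF *(4)
        evaluates_list_Vars[of "[length xs..<length xs + length env]" "xs @ env"]]]
    unfolding upt_entries by simp
  from evaluates_evaluates_list.Call[OF this assms(3) *(6)]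
  show ?thesis by (rule eval_withinI) (use * in simp)
qed

lemma eval_within_Var: "i < length env \<Longrightarrow> eval_within P env (Var i) 1 (env ! i)"
  by (rule eval_withinI[OF evaluates_evaluates_list.Var]) auto

text \<open>A fold becomes a recursive function \<open>f\<close> whose arguments are the remaining
  list, the accumulator and the \<open>m\<close> entries of the surrounding environment;
  \<open>g\<close> is the index of the compiled body. A leaf ends the recursion.\<close>

definition loop_body :: "nat \<Rightarrow> nat \<Rightarrow> nat \<Rightarrow> expr" where
  "loop_body m f g = Cond (Var 0)
     (Call f (RightE (Var 0) # Call g (LeftE (Var 0) # Var 1 # map Var [Suc (Suc 0)..<Suc (Suc m)]) #
       map Var [Suc (Suc 0)..<Suc (Suc m)]))
     (Var 1)"

text \<open>Each round passes the environment twice, to \<open>g\<close> and to \<open>f\<close>,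
  hence \<open>2 * length env\<close>; the constant 20 generously covers the remaining overhead of a
  round. The additional round is the final call on the leaf.\<close>

lemma eval_within_loop:
  assumes P: "f < length P" "g < length P" "P ! f = loop_body (length env) f g"
    and step: "fold_all (\<lambda>x s. eval_within P (x # s # env) (P ! g) T (h x s)) h (items l) s"
  shows "eval_within P (l # s # env) (P ! f)
    (Suc (length (items l)) * (T + 2 * length env + 20)) (fold h (items l) s)"
  using step
proof (induction l arbitrary: s rule: items.induct)
  case 1
  have "eval_within P (Leaf # s # env) (loop_body (length env) f g) (Suc (1 + 1)) s"
    unfolding loop_body_def
    using eval_within_Var[of 0 "Leaf # s # env" P] eval_within_Var[of 1 "Leaf # s # env" P]
    by (intro eval_within_Cond) auto
  then show ?case using P by (auto elim!: eval_within_mono)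
next
  case (2 x y)
  let ?env = "[Node x y, s] @ env"
  have v: "eval_within P ?env (Var 0) 1 (Node x y)" "eval_within P ?env (Var 1) 1 s"
    using eval_within_Var[of 0 ?env P] eval_within_Var[of 1 ?env P] by auto
  have g: "eval_within P ?env (Call g (LeftE (Var 0) # Var 1 # map Var [Suc (Suc 0)..<Suc (Suc (length env))]))
      (Suc (Suc 1 + 1 + length env + T)) (h x s)"
  proof -
    have "eval_within P (left (Node x y) # s # env) (P ! g) T (h x s)"
      using 2(2) by simp
    from eval_within_Call2[OF eval_within_Left[OF v(1)] v(2) P(2) this]
    show ?thesis by (simp only: length_Cons list.size(3) add_Suc add_0)
  qed
  have "eval_within P (y # h x s # env) (P ! f)
      (Suc (length (items y)) * (T + 2 * length env + 20)) (fold h (items y) (h x s))"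
    using 2 by auto
  then have "eval_within P (right (Node x y) # h x s # env) (P ! f)
      (Suc (length (items y)) * (T + 2 * length env + 20)) (fold h (items y) (h x s))" by simp
  note c = eval_within_Call2[OF eval_within_Right[OF v(1)] g P(1) this,
      simplified length_Cons list.size(3) add_Suc add_0]
  have "eval_within P ?env (loop_body (length env) f g)
     (Suc (1 + Suc (Suc 1 + Suc (Suc 1 + 1 + length env + T) + length env +
        Suc (length (items y)) * (T + 2 * length env + 20)))) (fold h (items (Node x y)) s)"
    unfolding loop_body_def
  proof (rule eval_within_Cond[OF v(1)])
    show "eval_within P ?env (Call f (RightE (Var 0) #
        Call g (LeftE (Var 0) # Var 1 # map Var [Suc (Suc 0)..<Suc (Suc (length env))]) #
        map Var [Suc (Suc 0)..<Suc (Suc (length env))]))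
      (Suc (Suc 1 + Suc (Suc 1 + 1 + length env + T) + length env +
        Suc (length (items y)) * (T + 2 * length env + 20))) (fold h (items (Node x y)) s)"
      using c by (simp only: fold_Cons items.simps o_apply add_Suc)
  qed simp
  then have "eval_within P ?env (loop_body (length env) f g)
     (Suc (length (items (Node x y))) * (T + 2 * length env + 20)) (fold h (items (Node x y)) s)"
    by (rule eval_within_mono) simp
  then show ?case using P by simp
qed

lemma fold_all_mono: "fold_all Q f xs s \<Longrightarrow> (\<And>x s. Q x s \<Longrightarrow> Q' x s) \<Longrightarrow> fold_all Q' f xs s"
  by (induction xs arbitrary: s) auto

lemma poly_bound_le: "(C::nat) \<le> C' \<Longrightarrow> d \<le> d' \<Longrightarrow> C * Suc B ^ d \<le> C' * Suc B ^ d'"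
  by (intro mult_le_mono power_increasing) auto

text \<open>Adding the exponents instead of taking their maximum keeps bounds of the form
  \<open>C * Suc B ^ d\<close> closed under all constructors without a loop.\<close>

lemma poly_bound_sum:
  "Suc (Ca * Suc B ^ da + (Cb * Suc B ^ db + Cc * Suc B ^ dc)) \<le>
    Suc (Ca + Cb + Cc) * Suc B ^ (da + db + dc)"
proof -
  let ?K = "Suc B ^ (da + db + dc)"
  have "Ca * Suc B ^ da \<le> Ca * ?K" "Cb * Suc B ^ db \<le> Cb * ?K" "Cc * Suc B ^ dc \<le> Cc * ?K"
    by (intro poly_bound_le; simp)+
  moreover have "1 \<le> ?K" by (rule one_le_power) simp
  moreover have "Suc (Ca + Cb + Cc) * ?K = ?K + Ca * ?K + Cb * ?K + Cc * ?K"
    by (simp add: algebra_simps)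
  ultimately show ?thesis by linarith
qed

text \<open>The offset \<open>p\<close> is the index of the first function generated for \<open>e\<close>, so that code for
  subexpressions can be placed anywhere in a larger program.\<close>

lemma loop_expr_compiles:
  "\<exists>C d code e'. \<forall>P0 Q env B. length P0 = p \<longrightarrow> length env = m \<longrightarrow> loops_bounded B e env \<longrightarrow>
     eval_within (P0 @ code @ Q) env e' (C * Suc B ^ d) (loop_val e env)"
proof (induction e arbitrary: p m)
  case (LVar i)
  show ?case
  proof (cases "i < m")
    case True
    then show ?thesis
      by (intro exI[of _ 1] exI[of _ 0] exI[of _ "[]"] exI[of _ "Var i"])
        (auto simp: entry_eq eval_within_Var[simplified])
  next
    case False
    then show ?thesis
      by (intro exI[of _ 1] exI[of _ 0] exI[of _ "[]"] exI[of _ "LeafE"])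
        (auto simp: entry_eq intro!: eval_withinI evaluates_evaluates_list.LeafE)
  qed
next
  case LLeaf
  show ?case
    by (intro exI[of _ 1] exI[of _ 0] exI[of _ "[]"] exI[of _ "LeafE"])
      (auto simp: intro!: eval_withinI evaluates_evaluates_list.LeafE)
next
  case (LNode a b)
  from LNode(1)[of p m] obtain Ca da ca a'
    where a: "\<And>P0 Q env B. length P0 = p \<Longrightarrow>
     length env = m \<Longrightarrow> loops_bounded B a env \<Longrightarrow>
     eval_within (P0 @ ca @ Q) env a' (Ca * Suc B ^ da) (loop_val a env)" by metis
  from LNode(2)[of "p + length ca" m] obtain Cb db cb b'
    where b: "\<And>P0 Q env B. length P0 = p + length ca \<Longrightarrow>
     length env = m \<Longrightarrow> loops_bounded B b env \<Longrightarrow>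
     eval_within (P0 @ cb @ Q) env b' (Cb * Suc B ^ db) (loop_val b env)" by metis
  have "eval_within (P0 @ (ca @ cb) @ Q) env (NodeE a' b') ((Suc (Ca + Cb)) * Suc B ^ (da + db))
      (loop_val (LNode a b) env)"
    if "length P0 = p" "length env = m" "loops_bounded B (LNode a b) env" for P0 Q env B
  proof -
    have "eval_within (P0 @ (ca @ cb) @ Q) env (NodeE a' b') (Suc (Ca * Suc B ^ da + Cb * Suc B ^ db))
       (loop_val (LNode a b) env)"
      using a[of P0 env B "cb @ Q"] b[of "P0 @ ca" env B Q] that by (auto intro!: eval_within_Node)
    moreover have "Suc (Ca * Suc B ^ da + Cb * Suc B ^ db) \<le> (Suc (Ca + Cb)) * Suc B ^ (da + db)"
      using poly_bound_sum[of Ca B da Cb db 0 0] by simp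
    ultimately show ?thesis by (rule eval_within_mono)
  qed
  then show ?case by blast
next
  case (LLeft a)
  from LLeft[of p m] obtain Ca da ca a'
    where a: "\<And>P0 Q env B. length P0 = p \<Longrightarrow>
     length env = m \<Longrightarrow> loops_bounded B a env \<Longrightarrow>
     eval_within (P0 @ ca @ Q) env a' (Ca * Suc B ^ da) (loop_val a env)" by metis
  have "eval_within (P0 @ ca @ Q) env (LeftE a') (Suc Ca * Suc B ^ da) (loop_val (LLeft a) env)"
    if "length P0 = p" "length env = m" "loops_bounded B (LLeft a) env" for P0 Q env B
    using eval_within_mono[OF eval_within_Left[OF a[of P0 env B Q]]] that by simp
  then show ?case by blast
next
  case (LRight a)
  from LRight[of p m] obtain Ca da ca a'
    where a: "\<And>P0 Q env B. length P0 = p \<Longrightarrow>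
     length env = m \<Longrightarrow> loops_bounded B a env \<Longrightarrow>
     eval_within (P0 @ ca @ Q) env a' (Ca * Suc B ^ da) (loop_val a env)" by metis
  have "eval_within (P0 @ ca @ Q) env (RightE a') (Suc Ca * Suc B ^ da) (loop_val (LRight a) env)"
    if "length P0 = p" "length env = m" "loops_bounded B (LRight a) env" for P0 Q env B
    using eval_within_mono[OF eval_within_Right[OF a[of P0 env B Q]]] that by simp
  then show ?case by blast
next
  case (LIf a b c)
  from LIf(1)[of p m] obtain Ca da ca a'
    where a: "\<And>P0 Q env B. length P0 = p \<Longrightarrow>
     length env = m \<Longrightarrow> loops_bounded B a env \<Longrightarrow>
     eval_within (P0 @ ca @ Q) env a' (Ca * Suc B ^ da) (loop_val a env)" by metis
  from LIf(2)[of "p + length ca" m] obtain Cb db cb b'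
    where b: "\<And>P0 Q env B. length P0 = p + length ca \<Longrightarrow>
     length env = m \<Longrightarrow> loops_bounded B b env \<Longrightarrow>
     eval_within (P0 @ cb @ Q) env b' (Cb * Suc B ^ db) (loop_val b env)" by metis
  from LIf(3)[of "p + length ca + length cb" m] obtain Cc dc cc c'
    where c: "\<And>P0 Q env B. length P0 = p + length ca + length cb \<Longrightarrow>
     length env = m \<Longrightarrow> loops_bounded B c env \<Longrightarrow>
     eval_within (P0 @ cc @ Q) env c' (Cc * Suc B ^ dc) (loop_val c env)" by metis
  have "eval_within (P0 @ (ca @ cb @ cc) @ Q) env (Cond a' b' c') ((Suc (Ca + Cb + Cc)) * Suc B ^ (da + db + dc))
      (loop_val (LIf a b c) env)"
    if "length P0 = p" "length env = m" "loops_bounded B (LIf a b c) env" for P0 Q env B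
  proof -
    have "eval_within (P0 @ (ca @ cb @ cc) @ Q) env (Cond a' b' c')
       (Suc (Ca * Suc B ^ da + (Cb * Suc B ^ db + Cc * Suc B ^ dc))) (loop_val (LIf a b c) env)"
    proof (rule eval_within_Cond)
      show "eval_within (P0 @ (ca @ cb @ cc) @ Q) env a' (Ca * Suc B ^ da) (loop_val a env)"
        using a[of P0 env B "cb @ cc @ Q"] that by simp
    next
      assume "loop_val a env \<noteq> Leaf"
      then show "eval_within (P0 @ (ca @ cb @ cc) @ Q) env b' (Cb * Suc B ^ db + Cc * Suc B ^ dc) (loop_val (LIf a b c) env)"
        using eval_within_mono[OF b[of "P0 @ ca" env B "cc @ Q"]] that by simp
    next
      assume "loop_val a env = Leaf"
      then show "eval_within (P0 @ (ca @ cb @ cc) @ Q) env c' (Cb * Suc B ^ db + Cc * Suc B ^ dc) (loop_val (LIf a b c) env)"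
        using eval_within_mono[OF c[of "P0 @ ca @ cb" env B Q]] that by simp
    qed
    moreover have "Suc (Ca * Suc B ^ da + (Cb * Suc B ^ db + Cc * Suc B ^ dc)) \<le>
        (Suc (Ca + Cb + Cc)) * Suc B ^ (da + db + dc)"
      by (rule poly_bound_sum)
    ultimately show ?thesis by (rule eval_within_mono)
  qed
  then show ?case by blast
next
  case (LLet a b)
  from LLet(1)[of p m] obtain Ca da ca a'
    where a: "\<And>P0 Q env B. length P0 = p \<Longrightarrow>
     length env = m \<Longrightarrow> loops_bounded B a env \<Longrightarrow>
     eval_within (P0 @ ca @ Q) env a' (Ca * Suc B ^ da) (loop_val a env)" by metis
  from LLet(2)[of "p + length ca" "Suc m"] obtain Cb db cb b'
    where b: "\<And>P0 Q env B. length P0 = p + length ca \<Longrightarrow>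
     length env = Suc m \<Longrightarrow> loops_bounded B b env \<Longrightarrow>
     eval_within (P0 @ cb @ Q) env b' (Cb * Suc B ^ db) (loop_val b env)" by metis
  have "eval_within (P0 @ (ca @ cb) @ Q) env (Bind a' b') ((Suc (Ca + Cb)) * Suc B ^ (da + db))
      (loop_val (LLet a b) env)"
    if "length P0 = p" "length env = m" "loops_bounded B (LLet a b) env" for P0 Q env B
  proof -
    have "eval_within (P0 @ (ca @ cb) @ Q) env (Bind a' b') (Suc (Ca * Suc B ^ da + Cb * Suc B ^ db))
       (loop_val (LLet a b) env)"
      using a[of P0 env B "cb @ Q"] b[of "P0 @ ca" "loop_val a env # env" B Q] that
      by (auto intro!: eval_within_Bind)
    moreover have "Suc (Ca * Suc B ^ da + Cb * Suc B ^ db) \<le> (Suc (Ca + Cb)) * Suc B ^ (da + db)"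
      using poly_bound_sum[of Ca B da Cb db 0 0] by simp
    ultimately show ?thesis by (rule eval_within_mono)
  qed
  then show ?case by blast
next
  case (LFold l i b)
  from LFold(1)[of p m] obtain Cl dl cl l'
    where l: "\<And>P0 Q env B. length P0 = p \<Longrightarrow>
     length env = m \<Longrightarrow> loops_bounded B l env \<Longrightarrow>
     eval_within (P0 @ cl @ Q) env l' (Cl * Suc B ^ dl) (loop_val l env)" by metis
  from LFold(2)[of "p + length cl" m] obtain Ci di ci i'
    where i: "\<And>P0 Q env B. length P0 = p + length cl \<Longrightarrow>
     length env = m \<Longrightarrow> loops_bounded B i env \<Longrightarrow>
     eval_within (P0 @ ci @ Q) env i' (Ci * Suc B ^ di) (loop_val i env)" by metis
  from LFold(3)[of "p + length cl + length ci" "Suc (Suc m)"] obtain Cb db cb b'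
    where b: "\<And>P0 Q env B. length P0 = p + length cl + length ci \<Longrightarrow>
     length env = Suc (Suc m) \<Longrightarrow> loops_bounded B b env \<Longrightarrow>
     eval_within (P0 @ cb @ Q) env b' (Cb * Suc B ^ db) (loop_val b env)" by metis
  \<comment> \<open>The two functions of the loop are placed behind the code of the three
    subexpressions: the body at \<open>g\<close>, the recursion over the list at
    \<open>Suc g\<close>.\<close>
  define g where "g = p + length cl + length ci + length cb"
  define code where "code = cl @ ci @ cb @ [b', loop_body m (Suc g) g]"
  \<comment> \<open>The summands are \<open>Cl\<close> and \<open>Ci\<close> for list and start
    value, \<open>Suc m\<close> for the initial call, and \<open>Cb + 2 * m + 20\<close> for a
    round. At most \<open>Suc B\<close> rounds raise the exponent from \<open>D\<close> to
    \<open>Suc D\<close>.\<close>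
  define C where "C = Cl + Ci + Cb + 3 * m + 21"
  define D where "D = dl + di + db"
  have "eval_within (P0 @ code @ Q) env (Call (Suc g) (l' # i' # map Var [0..<0 + m]))
      (C * Suc B ^ Suc D) (loop_val (LFold l i b) env)"
    if *: "length P0 = p" "length env = m" "loops_bounded B (LFold l i b) env" for P0 Q env B
  proof -
    let ?P = "P0 @ code @ Q" and ?K = "Suc B ^ D"
    let ?L = "items (loop_val l env)" and ?h = "\<lambda>x acc. loop_val b (x # acc # env)"
    have g: "?P ! g = b'" "?P ! Suc g = loop_body (length env) (Suc g) g"
        "g < length ?P" "Suc g < length ?P"
      using * by (auto simp: code_def g_def nth_append)
    have wl: "eval_within ?P ([] @ env) l' (Cl * Suc B ^ dl) (loop_val l env)"
      using l[of P0 env B "ci @ cb @ [b', loop_body m (Suc g) g] @ Q"] * by (simp add: code_def)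
    have wi: "eval_within ?P ([] @ env) i' (Ci * Suc B ^ di) (loop_val i env)"
      using i[of "P0 @ cl" env B "cb @ [b', loop_body m (Suc g) g] @ Q"] * by (simp add: code_def)
    have "fold_all (\<lambda>x s. eval_within ?P (x # s # env) (?P ! g) (Cb * Suc B ^ db) (?h x s)) ?h ?L (loop_val i env)"
    proof (rule fold_all_mono)
      show "fold_all (\<lambda>x acc. loops_bounded B b (x # acc # env)) ?h ?L (loop_val i env)"
        using * by simp
      show "eval_within ?P (x # s # env) (?P ! g) (Cb * Suc B ^ db) (?h x s)"
        if "loops_bounded B b (x # s # env)" for x s
        using b[of "P0 @ cl @ ci" "x # s # env" B "[b', loop_body m (Suc g) g] @ Q"] that * g
        by (simp add: code_def)
    qed
    from eval_within_loop[OF g(4) g(3) g(2) this]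
    have "eval_within ?P (loop_val l env # loop_val i env # env) (?P ! Suc g)
        (Suc (length ?L) * (Cb * Suc B ^ db + 2 * length env + 20)) (loop_val (LFold l i b) env)"
      by simp
    from eval_within_Call2[OF wl wi g(4) this] *
    have "eval_within ?P env (Call (Suc g) (l' # i' # map Var [0..<0 + m]))
      (Suc (Cl * Suc B ^ dl + Ci * Suc B ^ di + m + Suc (length ?L) * (Cb * Suc B ^ db + 2 * m + 20)))
      (loop_val (LFold l i b) env)" by simp
    moreover have "Suc (Cl * Suc B ^ dl + Ci * Suc B ^ di + m +
        Suc (length ?L) * (Cb * Suc B ^ db + 2 * m + 20)) \<le> C * Suc B ^ Suc D"
    proof -
      have K: "1 \<le> ?K" using one_le_power[of "Suc B" D] by simp
      have "Cb * Suc B ^ db + 2 * m + 20 \<le> (Cb + 2 * m + 20) * ?K"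
      proof -
        have "Cb * Suc B ^ db \<le> Cb * ?K" by (rule poly_bound_le) (auto simp: D_def)
        moreover have "2 * m + 20 \<le> (2 * m + 20) * ?K"
          using mult_le_mono2[OF K, of "2 * m + 20"] by (simp only: mult_1_right)
        moreover have "(Cb + 2 * m + 20) * ?K = Cb * ?K + (2 * m + 20) * ?K"
          by (simp add: add_mult_distrib)
        ultimately show ?thesis by linarith
      qed
      moreover have "Suc (length ?L) \<le> Suc B" using * by simp
      ultimately have 1: "Suc (length ?L) * (Cb * Suc B ^ db + 2 * m + 20) \<le>
          Suc B * ((Cb + 2 * m + 20) * ?K)" by (rule mult_le_mono[rotated])
      have 2: "Cl * Suc B ^ dl \<le> Cl * Suc B ^ Suc D" "Ci * Suc B ^ di \<le> Ci * Suc B ^ Suc D"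
        by (intro poly_bound_le; simp add: D_def)+
      have 3: "Suc m \<le> Suc m * Suc B ^ Suc D"
        using mult_le_mono2[OF one_le_power[of "Suc B" "Suc D"], of "Suc m"] by simp
      have "C * Suc B ^ Suc D = Cl * Suc B ^ Suc D + Ci * Suc B ^ Suc D +
          Suc m * Suc B ^ Suc D + Suc B * ((Cb + 2 * m + 20) * ?K)"
        by (simp add: C_def algebra_simps)
      then show ?thesis using 1 2 3 by linarith
    qed
    ultimately show ?thesis by (rule eval_within_mono)
  qed
  then show ?case by (intro exI allI impI)
qed

text \<open>The program and both constants are fixed before \<open>B\<close> and the input, so one
  program serves all instances. The code of \<open>e\<close> itself is function 0 and its auxiliary
  functions start at index 1.\<close>

theorem loop_expr_program:
  "\<exists>C d P. \<forall>B x. loops_bounded B e [x] \<longrightarrow> (\<exists>t \<le> C * Suc B ^ d. runs P x t (loop_val e [x]))"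
proof -
  from loop_expr_compiles[of "Suc 0" "Suc 0" e] obtain C d code e' where *:
    "\<forall>P0 Q env B. length P0 = Suc 0 \<longrightarrow> length env = Suc 0 \<longrightarrow> loops_bounded B e env \<longrightarrow>
     eval_within (P0 @ code @ Q) env e' (C * Suc B ^ d) (loop_val e env)"
    by (elim exE)
  show ?thesis
  proof (rule exI, rule exI, rule exI, intro allI impI)
    fix B x assume B: "loops_bounded B e [x]"
    have 1: "eval_within (e' # code) ([x] @ []) (Var 0) 1 x"
      using eval_within_Var[of 0 "[x]"] by simp
    have "eval_within ([e'] @ code @ []) [x] e' (C * Suc B ^ d) (loop_val e [x])"
      using B by (intro *[rule_format]) auto
    then have "eval_within (e' # code) [x] ((e' # code) ! 0) (C * Suc B ^ d) (loop_val e [x])"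
      by simp
    from eval_within_Call1[OF 1 _ this]
    have "eval_within (e' # code) [x] (Call 0 [Var 0]) (Suc (1 + C * Suc B ^ d)) (loop_val e [x])"
      by simp
    moreover have "Suc (1 + C * Suc B ^ d) \<le> (C + 2) * Suc B ^ d"
    proof -
      have "1 \<le> Suc B ^ d" by simp
      moreover have "(C + 2) * Suc B ^ d = C * Suc B ^ d + 2 * Suc B ^ d"
        by (rule add_mult_distrib)
      ultimately show ?thesis by linarith
    qed
    ultimately have "eval_within (e' # code) [x] (Call 0 [Var 0]) ((C + 2) * Suc B ^ d)
        (loop_val e [x])"
      by (rule eval_within_mono)
    then show "\<exists>t \<le> (C + 2) * Suc B ^ d. runs (e' # code) x t (loop_val e [x])"
      unfolding eval_within_def runs_def .
  qed
qed

section \<open>Greedy completion of an anchored path\<close>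

text \<open>The conjunct \<open>u \<notin> X\<close> excludes the trivial path at a deleted vertex,
  which the reflexive closure would admit.\<close>

definition reach :: "nat rel \<Rightarrow> nat set \<Rightarrow> nat \<Rightarrow> nat \<Rightarrow> bool" where
  "reach A X u v \<longleftrightarrow> u \<notin> X \<and> (u, v) \<in> {(x, y) \<in> A. x \<notin> X \<and> y \<notin> X}\<^sup>*"

lemma reach_refl: "u \<notin> X \<Longrightarrow> reach A X u u"
  unfolding reach_def by simp

lemma reach_step: "(u, v) \<in> A \<Longrightarrow> u \<notin> X \<Longrightarrow> v \<notin> X \<Longrightarrow> reach A X u v"
  unfolding reach_def by blast

lemma reach_trans: "reach A X u v \<Longrightarrow> reach A X v w \<Longrightarrow> reach A X u w"
  unfolding reach_def by auto

lemma reach_notin: "reach A X u v \<Longrightarrow> u \<notin> X \<and> v \<notin> X"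
  unfolding reach_def by (auto elim: rtranclE)

lemma reach_sym:
  assumes "sym A" "reach A X u v"
  shows "reach A X v u"
proof -
  have "sym {(x, y) \<in> A. x \<notin> X \<and> y \<notin> X}" using assms(1) by (auto simp: sym_def)
  then have "sym ({(x, y) \<in> A. x \<notin> X \<and> y \<notin> X}\<^sup>*)" by (rule sym_rtrancl)
  then show ?thesis using assms(2) reach_notin[OF assms(2)] unfolding reach_def by (auto dest: symD)
qed

abbreviation walk_in :: "nat rel \<Rightarrow> nat list \<Rightarrow> bool" where
  "walk_in A \<equiv> successively (\<lambda>u v. (u, v) \<in> A)"

lemma reach_walk_last: "walk_in A (u # p) \<Longrightarrow> set (u # p) \<inter> X = {} \<Longrightarrow> reach A X u (last (u # p))"
proof (induction p arbitrary: u)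
  case (Cons v p)
  then have "reach A X u v" by (intro reach_step) auto
  moreover have "reach A X v (last (v # p))" using Cons by auto
  ultimately show ?case by (simp add: reach_trans[of A X u v])
qed (auto intro: reach_refl)

lemma reach_walk:
  assumes "sym A" "walk_in A p" "set p \<inter> X = {}" "u \<in> set p" "v \<in> set p"
  shows "reach A X u v"
proof -
  have *: "reach A X w (last p)" if "w \<in> set p" for w
  proof -
    from that obtain p1 p2 where p: "p = p1 @ w # p2" by (auto dest: split_list)
    then have "walk_in A (w # p2)" "set (w # p2) \<inter> X = {}"
      using assms by (auto simp: successively_append_iff)
    from reach_walk_last[OF this] p show ?thesis by simp
  qed
  show ?thesis by (rule reach_trans[OF *[OF assms(4)] reach_sym[OF assms(1) *[OF assms(5)]]])
qed

text \<open>The property of block graphs that the algorithm relies on and tests: two neighbours of a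
  vertex \<open>u\<close> that are connected without \<open>u\<close> lie in a common block with \<open>u\<close>, hence are adjacent.\<close>

definition block_closed :: "nat rel \<Rightarrow> nat set \<Rightarrow> bool" where
  "block_closed A S \<longleftrightarrow> (\<forall>u x y. u \<notin> S \<longrightarrow> (u, x) \<in> A \<longrightarrow> (u, y) \<in> A \<longrightarrow> x \<noteq> y \<longrightarrow>
     reach A (insert u S) x y \<longrightarrow> (x, y) \<in> A)"

text \<open>The ends count as separators. The conjunct \<open>reach A S a b\<close> prevents all
  vertices from separating vacuously; in particular, if an end lies in \<open>S\<close>, only the
  two ends qualify.\<close>

definition separates :: "nat rel \<Rightarrow> nat set \<Rightarrow> nat \<Rightarrow> nat \<Rightarrow> nat \<Rightarrow> bool" where
  "separates A S a b w \<longleftrightarrow> w = a \<or> w = b \<or> reach A S a b \<and> \<not> reach A (insert w S) a b"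

text \<open>The second alternative keeps the path in the block leading towards \<open>b\<close>. It
  fails if \<open>u\<close> or \<open>b\<close> lies in \<open>S\<close>, so that a segment touching
  \<open>S\<close> can only be the edge to \<open>b\<close>.\<close>

definition allowed :: "nat rel \<Rightarrow> nat set \<Rightarrow> nat \<Rightarrow> nat \<Rightarrow> nat \<Rightarrow> bool" where
  "allowed A S b u w \<longleftrightarrow> (u, w) \<in> A \<and> (w = b \<or> u \<notin> S \<and> reach A (insert u S) w b)"

definition available :: "nat \<Rightarrow> nat rel \<Rightarrow> nat set \<Rightarrow> nat \<Rightarrow> bool" where
  "available n \<pi> Q w \<longleftrightarrow> (\<forall>z<n. (z, w) \<in> \<pi> \<longrightarrow> z \<noteq> w \<longrightarrow> z \<in> Q)"

fun reserved :: "nat rel \<Rightarrow> nat set \<Rightarrow> nat list \<Rightarrow> nat \<Rightarrow> bool" where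
  "reserved A S [] w \<longleftrightarrow> False"
| "reserved A S [a] w \<longleftrightarrow> w = a"
| "reserved A S (a # b # L) w \<longleftrightarrow> separates A S a b w \<or> reserved A S (b # L) w"

definition candidate :: "nat \<Rightarrow> nat rel \<Rightarrow> nat rel \<Rightarrow> nat set \<Rightarrow> nat \<Rightarrow> nat list \<Rightarrow> nat \<Rightarrow> bool" where
  "candidate n A \<pi> S b q w \<longleftrightarrow> w \<notin> set q \<and> available n \<pi> (set q) w \<and> allowed A S b (hd q) w"

text \<open>The smallest suitable vertex is added, as later elements of the reversed range override
  earlier ones; \<open>r\<close> is the fallback. The fold is literally the loop that the program
  executes.\<close>

definition extend_by :: "nat \<Rightarrow> (nat \<Rightarrow> bool) \<Rightarrow> nat list \<Rightarrow> nat list \<Rightarrow> nat list" where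
  "extend_by n Q q r = fold (\<lambda>w r. if Q w then w # q else r) (rev [0..<n]) r"

lemma extend_by_cases:
  obtains "extend_by n Q q r = r" "\<forall>w<n. \<not> Q w" | w where "extend_by n Q q r = w # q" "w < n" "Q w"
proof -
  have "fold (\<lambda>w r. if Q w then w # q else r) xs r = r \<and> (\<forall>w\<in>set xs. \<not> Q w) \<or>
    (\<exists>w\<in>set xs. fold (\<lambda>w r. if Q w then w # q else r) xs r = w # q \<and> Q w)" for xs
    by (induction xs rule: rev_induct) auto
  from this[of "rev [0..<n]", folded extend_by_def]
  consider "extend_by n Q q r = r" "\<forall>w\<in>set (rev [0..<n]). \<not> Q w"
    | w where "w \<in> set (rev [0..<n])" "extend_by n Q q r = w # q" "Q w"
    by blast
  then show thesis by cases (use that in simp_all)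
qed

text \<open>Partial paths are stored in reverse, so \<open>hd q\<close> is the current vertex.\<close>

definition greedy_step ::
  "nat \<Rightarrow> nat rel \<Rightarrow> nat rel \<Rightarrow> nat set \<Rightarrow> nat list \<Rightarrow> nat \<Rightarrow> nat \<Rightarrow> nat list \<Rightarrow> nat list" where
  "greedy_step n A \<pi> S L a b q =
     extend_by n (\<lambda>w. candidate n A \<pi> S b q w \<and> \<not> reserved A S L w) q
       (extend_by n (\<lambda>w. candidate n A \<pi> S b q w \<and> separates A S a b w) q q)"

text \<open>The inner search is the fallback of the outer one. So a separator is entered only when
  no unreserved candidate is left.\<close>

lemma greedy_step_cases:
  obtains w where "greedy_step n A \<pi> S L a b q = w # q" "w < n" "candidate n A \<pi> S b q w"
      "\<not> reserved A S L w"
  | w where "greedy_step n A \<pi> S L a b q = w # q" "w < n" "candidate n A \<pi> S b q w"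
      "separates A S a b w" "\<forall>v<n. candidate n A \<pi> S b q v \<longrightarrow> reserved A S L v"
  | "greedy_step n A \<pi> S L a b q = q" "\<forall>v<n. candidate n A \<pi> S b q v \<longrightarrow> reserved A S L v"
      "\<forall>v<n. candidate n A \<pi> S b q v \<longrightarrow> \<not> separates A S a b v"
proof (cases rule: extend_by_cases[of n "\<lambda>w. candidate n A \<pi> S b q w \<and> \<not> reserved A S L w" q
      "extend_by n (\<lambda>w. candidate n A \<pi> S b q w \<and> separates A S a b w) q q"])
  case 1
  note 1 = 1[folded greedy_step_def]
  show thesis
  proof (cases rule: extend_by_cases[of n "\<lambda>w. candidate n A \<pi> S b q w \<and> separates A S a b w" q q])
    assume *: "extend_by n (\<lambda>w. candidate n A \<pi> S b q w \<and> separates A S a b w) q q = q"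
      "\<forall>w<n. \<not> (candidate n A \<pi> S b q w \<and> separates A S a b w)"
    show thesis by (rule that(3)) (use 1 * in auto)
  next
    fix w
    assume *: "extend_by n (\<lambda>w. candidate n A \<pi> S b q w \<and> separates A S a b w) q q = w # q"
      "w < n" "candidate n A \<pi> S b q w \<and> separates A S a b w"
    show thesis by (rule that(2)[of w]) (use 1 * in auto)
  qed
next
  case (2 w)
  note 2 = 2[folded greedy_step_def]
  show thesis by (rule that(1)[of w]) (use 2 in auto)
qed

text \<open>The vertex list serves as a counter only. Every step before the target lengthens a path
  with at most \<open>n\<close> vertices, and at the target nothing changes, so \<open>n\<close>
  rounds are enough.\<close>

definition greedy_segment ::
  "nat \<Rightarrow> nat rel \<Rightarrow> nat rel \<Rightarrow> nat set \<Rightarrow> nat list \<Rightarrow> nat \<Rightarrow> nat list \<Rightarrow> nat list" where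
  "greedy_segment n A \<pi> S L b q = fold (\<lambda>_. greedy_step n A \<pi> S L (hd q) b) (rev [0..<n]) q"

definition greedy_path :: "nat \<Rightarrow> nat rel \<Rightarrow> nat rel \<Rightarrow> nat set \<Rightarrow> nat list \<Rightarrow> nat list" where
  "greedy_path n A \<pi> S L = fold (greedy_segment n A \<pi> S L) (tl L) [hd L]"

text \<open>The flag \<open>cyc\<close> selects between the two problems. Paths are stored in
  reverse, so the head of the greedy path is the end of the Hamiltonian path. Whether the segments
  met their targets is not tested; covering all vertices decides.\<close>

definition accepts :: "nat \<Rightarrow> nat rel \<Rightarrow> nat rel \<Rightarrow> bool \<Rightarrow> nat set \<Rightarrow> nat list \<Rightarrow> bool" where
  "accepts n A \<pi> cyc S L \<longleftrightarrow> L \<noteq> [] \<and> available n \<pi> {} (hd L) \<and>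
     {..<n} \<subseteq> set (greedy_path n A \<pi> S L) \<and>
     (cyc \<longrightarrow> (hd L, hd (greedy_path n A \<pi> S L)) \<in> A)"

section \<open>Properties of the greedy path that hold for every guess\<close>

fun partial_path :: "nat \<Rightarrow> nat rel \<Rightarrow> nat rel \<Rightarrow> nat list \<Rightarrow> bool" where
  "partial_path n A \<pi> [] \<longleftrightarrow> False"
| "partial_path n A \<pi> [u] \<longleftrightarrow> u < n \<and> available n \<pi> {} u"
| "partial_path n A \<pi> (w # u # q) \<longleftrightarrow> w < n \<and> w \<notin> set (u # q) \<and> (u, w) \<in> A \<and>
     available n \<pi> (set (u # q)) w \<and> partial_path n A \<pi> (u # q)"

lemma partial_path_ne: "partial_path n A \<pi> q \<Longrightarrow> q \<noteq> []"
  by auto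

lemma partial_path_subset: "partial_path n A \<pi> q \<Longrightarrow> distinct q \<and> set q \<subseteq> {..<n}"
  by (induction n A \<pi> q rule: partial_path.induct) auto

lemma partial_path_length: "partial_path n A \<pi> q \<Longrightarrow> length q \<le> n"
  using partial_path_subset[of n A \<pi> q] card_mono[of "{..<n}" "set q"] distinct_card[of q] by auto

lemma partial_path_extend:
  "partial_path n A \<pi> q \<Longrightarrow> candidate n A \<pi> S b q w \<Longrightarrow> w < n \<Longrightarrow> partial_path n A \<pi> (w # q)"
  by (cases q) (auto simp: candidate_def allowed_def)

lemma partial_path_greedy_step:
  assumes "partial_path n A \<pi> q"
  shows "partial_path n A \<pi> (greedy_step n A \<pi> S L a b q) \<and>
    last (greedy_step n A \<pi> S L a b q) = last q"
  using partial_path_ne[OF assms] assms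
  by (cases rule: greedy_step_cases[of n A \<pi> S L a b q]) (auto intro: partial_path_extend)

lemma partial_path_greedy_segment:
  assumes "partial_path n A \<pi> q"
  shows "partial_path n A \<pi> (greedy_segment n A \<pi> S L b q) \<and>
    last (greedy_segment n A \<pi> S L b q) = last q"
proof -
  have "partial_path n A \<pi> (fold (\<lambda>_. greedy_step n A \<pi> S L a b) xs q) \<and>
    last (fold (\<lambda>_. greedy_step n A \<pi> S L a b) xs q) = last q" for xs :: "nat list" and a
    by (induction xs rule: rev_induct) (use assms partial_path_greedy_step in auto)
  then show ?thesis unfolding greedy_segment_def by blast
qed

lemma partial_path_greedy_path:
  assumes "hd L < n" "available n \<pi> {} (hd L)"
  shows "partial_path n A \<pi> (greedy_path n A \<pi> S L) \<and> last (greedy_path n A \<pi> S L) = hd L"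
proof -
  have "partial_path n A \<pi> (fold (greedy_segment n A \<pi> S L) xs [hd L]) \<and>
    last (fold (greedy_segment n A \<pi> S L) xs [hd L]) = hd L" for xs
    by (induction xs rule: rev_induct) (use assms partial_path_greedy_segment in auto)
  then show ?thesis unfolding greedy_path_def by blast
qed

lemma partial_path_walk: "partial_path n A \<pi> q \<Longrightarrow> walk_in A (rev q)"
  by (induction n A \<pi> q rule: partial_path.induct) (auto simp: successively_append_iff)

lemma partial_path_precedes:
  "partial_path n A \<pi> q \<Longrightarrow> q = q1 @ y # q2 \<Longrightarrow> z < n \<Longrightarrow> (z, y) \<in> \<pi> \<Longrightarrow> z = y \<or> z \<in> set q2"
proof (induction n A \<pi> q arbitrary: q1 rule: partial_path.induct)
  case (3 n A \<pi> w u q)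
  show ?case
  proof (cases q1)
    case Nil
    then show ?thesis using 3 by (auto simp: available_def)
  next
    case (Cons x q1')
    then have "u # q = q1' @ y # q2" using "3.prems"(2) by simp
    moreover have "partial_path n A \<pi> (u # q)" using "3.prems"(1) by simp
    ultimately show ?thesis using "3.IH" "3.prems"(3,4) by blast
  qed
next
  case (2 n A \<pi> u)
  then show ?case by (cases q1) (auto simp: available_def)
qed simp

lemma partial_path_extending:
  assumes "partial_path n A \<pi> q"
  shows "extending \<pi> (rev q)"
  unfolding extending_def
proof (intro allI impI, rule ccontr)
  fix i j assume ij: "i < length (rev q)" "j < length (rev q)" "(rev q ! i, rev q ! j) \<in> \<pi>" "\<not> i \<le> j"
  let ?p = "rev q"
  have p: "?p = take j ?p @ ?p ! j # drop (Suc j) ?p" using ij by (simp add: id_take_nth_drop)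
  then have q: "q = rev (drop (Suc j) ?p) @ ?p ! j # rev (take j ?p)"
    by (metis append.assoc append_Cons append_Nil rev.simps(2) rev_append rev_rev_ident)
  have d: "distinct ?p" "set ?p \<subseteq> {..<n}" using partial_path_subset[OF assms] by auto
  then have "?p ! i < n" using ij by (meson lessThan_iff nth_mem subsetD)
  then have "?p ! i = ?p ! j \<or> ?p ! i \<in> set (take j ?p)"
    using partial_path_precedes[OF assms q _ ij(3)] by simp
  then obtain k where "k \<le> j" "?p ! i = ?p ! k"
  proof
    assume "?p ! i \<in> set (take j ?p)"
    then obtain k where "k < length (take j ?p)" "take j ?p ! k = ?p ! i"
      unfolding in_set_conv_nth by blast
    then show thesis using that[of k] by simp
  qed (use that[of j] in simp)
  then show False
    using d(1) ij nth_eq_iff_index_eq[of ?p i k] by simp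
qed

text \<open>The list \<open>ys\<close> is the part of the given Hamiltonian path between two
  consecutive anchors \<open>a\<close> and \<open>b\<close>, avoiding \<open>S\<close>.\<close>

locale block_segment =
  fixes A :: "nat rel" and S :: "nat set" and a b :: nat and ys :: "nat list"
  assumes sym: "sym A" and closed: "block_closed A S"
    and walk: "walk_in A ys" and dist: "distinct ys" and disj: "set ys \<inter> S = {}"
    and ne: "ys \<noteq> []" and hd: "hd ys = a" and last: "last ys = b"
begin

text \<open>The vertices other than \<open>c\<close> of the block through which the walk leaves the separator \<open>c\<close>\<close>

definition slot :: "nat \<Rightarrow> nat \<Rightarrow> bool" where
  "slot c w \<longleftrightarrow> (c, w) \<in> A \<and> reach A (insert c S) w b"

lemma ends: "a \<in> set ys" "b \<in> set ys"
  using ne hd last by auto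

lemma reach_ends: "reach A S a b"
  using reach_walk[OF sym walk disj] ends by blast

lemma separates_in: "separates A S a b w \<Longrightarrow> w \<in> set ys"
  using reach_walk[OF sym walk, of "insert w S" a b] ends disj unfolding separates_def by auto

lemma sub_reach:
  "ys = us @ vs @ ws \<Longrightarrow> set vs \<inter> X = {} \<Longrightarrow> x \<in> set vs \<Longrightarrow> y \<in> set vs \<Longrightarrow> reach A X x y"
  using reach_walk[OF sym, of vs X x y] walk by (auto simp: successively_append_iff)

lemma first_in: "ys = us @ c # vs \<Longrightarrow> a \<in> set (us @ [c])"
  using hd by (cases us) auto

lemma last_in: "ys = us @ c # vs \<Longrightarrow> b \<in> set (c # vs)"
  using last by auto

text \<open>If \<open>u\<close> does not come after \<open>c\<close>, the rest of the walk leads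
  from \<open>c\<close> to \<open>b\<close> without \<open>u\<close>. Otherwise the walk back from
  \<open>c\<close> to \<open>a\<close> avoids \<open>u\<close>, and \<open>a\<close> is still
  connected to \<open>b\<close> because \<open>u\<close> is no separator.\<close>

lemma reach_around:
  assumes ys: "ys = W1 @ c # W2" and "u \<noteq> c" "u \<notin> S" "\<not> separates A S a b u"
  shows "reach A (insert u S) c b"
proof (cases "u \<in> set W2")
  case False
  then show ?thesis
    using sub_reach[of W1 "c # W2" "[]" "insert u S" c b] ys assms(2) disj last_in[OF ys] by auto
next
  case True
  then have "u \<notin> set W1" using dist ys by auto
  then have "reach A (insert u S) c a"
    using sub_reach[of "[]" "W1 @ [c]" W2 "insert u S" c a] ys assms(2) disj first_in[OF ys] by auto
  moreover have "reach A (insert u S) a b"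
    using assms(4) reach_ends unfolding separates_def by blast
  ultimately show ?thesis by (rule reach_trans)
qed

lemma slot_notin: "slot c u \<Longrightarrow> u \<noteq> c \<and> u \<notin> S"
  using reach_notin unfolding slot_def by auto

text \<open>Both \<open>u\<close> and \<open>w\<close> are neighbours of \<open>c\<close> that reach
  \<open>b\<close> without \<open>c\<close>, so \<open>block_closed\<close> at \<open>c\<close>
  makes them adjacent. Without \<open>u\<close>, the way from \<open>w\<close> to \<open>b\<close>
  goes through \<open>c\<close> and then around \<open>u\<close>.\<close>

lemma allowed_if_slot:
  assumes ys: "ys = W1 @ c # W2" and u: "slot c u" "\<not> separates A S a b u"
    and w: "slot c w" "w \<noteq> u"
  shows "allowed A S b u w"
proof -
  have nin: "c \<notin> S" "u \<noteq> c" "u \<notin> S" "w \<notin> S"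
    using ys disj slot_notin u w by auto
  have "reach A (insert c S) u w"
    using u(1) w(1) reach_trans reach_sym[OF sym] unfolding slot_def by meson
  then have "(u, w) \<in> A"
    using closed nin u(1) w unfolding block_closed_def slot_def by metis
  moreover have "reach A (insert u S) w c"
    using w nin sym by (intro reach_step) (auto simp: slot_def sym_def)
  then have "reach A (insert u S) w b"
    by (rule reach_trans) (rule reach_around[OF ys nin(2,3) u(2)])
  ultimately show ?thesis using nin unfolding allowed_def by blast
qed

text \<open>The same argument with the roles of \<open>c\<close> and \<open>u\<close> exchanged:
  \<open>c\<close> and \<open>w\<close> are neighbours of \<open>u\<close> that reach
  \<open>b\<close> without \<open>u\<close>, so \<open>block_closed\<close> at \<open>u\<close>
  makes them adjacent. Without \<open>c\<close>, the way from \<open>w\<close> to \<open>b\<close>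
  goes through \<open>u\<close>.\<close>

lemma slot_if_allowed:
  assumes ys: "ys = W1 @ c # W2" and u: "slot c u" "\<not> separates A S a b u"
    and w: "allowed A S b u w" "w \<noteq> c"
  shows "slot c w"
proof -
  have nin: "c \<notin> S" "u \<noteq> c" "u \<notin> S" "b \<notin> S"
    using ys disj slot_notin u w last_in[OF ys] by auto
  have "u \<noteq> b" using u(2) unfolding separates_def by blast
  then have wb: "reach A (insert u S) w b"
    using w nin reach_refl[of b "insert u S" A] unfolding allowed_def by auto
  have uw: "(u, w) \<in> A" using w unfolding allowed_def by blast
  have uc: "(u, c) \<in> A" "(c, u) \<in> A" using u(1) sym unfolding slot_def sym_def by auto
  have "reach A (insert u S) c w"
    using reach_around[OF ys nin(2,3) u(2)] reach_sym[OF sym wb] by (rule reach_trans)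
  then have "(c, w) \<in> A"
    using closed nin uc(1) uw w(2) unfolding block_closed_def by metis
  moreover have "reach A (insert c S) w u"
    using reach_notin[OF wb] uw sym w(2) nin by (intro reach_step) (auto simp: sym_def)
  then have "reach A (insert c S) w b"
    using u(1) unfolding slot_def by (blast intro: reach_trans)
  ultimately show ?thesis unfolding slot_def by blast
qed

text \<open>The program tests steps by the current vertex \<open>u\<close> alone, whereas the
  comparison with the given path is in terms of the last separator \<open>c\<close>, which the
  program does not store. On new vertices the two agree.\<close>

lemma slot_iff_allowed:
  assumes "ys = W1 @ c # W2" "c \<noteq> b" "u = c \<or> slot c u \<and> \<not> separates A S a b u" "w \<noteq> u" "w \<noteq> c"
  shows "slot c w \<longleftrightarrow> allowed A S b u w"
proof (cases "u = c")
  case True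
  have "c \<notin> S" "b \<notin> S" using assms(1) disj last_in[OF assms(1)] by auto
  then show ?thesis using True assms(2) reach_refl[of b "insert c S" A]
    unfolding slot_def allowed_def by auto
next
  case False
  then show ?thesis
    using allowed_if_slot[OF assms(1)] slot_if_allowed[OF assms(1)] assms(3-) by blast
qed

text \<open>The given path itself cannot leave the block before the next separator: the rest of the
  walk shows that each of its steps is allowed, and an allowed step from a slot vertex that is no
  separator stays in the slot.\<close>

lemma slot_prefix:
  "ys = W1 @ c # W3 @ d # W4 \<Longrightarrow> \<forall>y\<in>set W3. \<not> separates A S a b y \<Longrightarrow>
   y \<in> set (W3 @ [d]) \<Longrightarrow> slot c y"
proof (induction W3 arbitrary: d W4 y rule: rev_induct)
  case Nil
  then have "(c, d) \<in> A" using walk by (auto simp: successively_append_iff)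
  moreover have "b \<in> set (d # W4)" using last_in[of "W1 @ [c]" d W4] Nil by simp
  then have "reach A (insert c S) d b"
    using sub_reach[of "W1 @ [c]" "d # W4" "[]" "insert c S" d b] Nil dist disj by auto
  ultimately show ?case using Nil unfolding slot_def by simp
next
  case (snoc x W3)
  have IH: "slot c z" if "z \<in> set (W3 @ [x])" for z
    using snoc.IH[of x "d # W4" z] snoc.prems that by simp
  show ?case
  proof (cases "y = d")
    case True
    have "walk_in A ((W1 @ c # W3) @ x # d # W4)" using walk snoc.prems(1) by simp
    then have xd: "(x, d) \<in> A" by (simp only: successively_append_iff) simp
    have "b \<in> set (d # W4)" using last_in[of "W1 @ c # W3 @ [x]" d W4] snoc.prems(1) by simp
    then have "reach A (insert x S) d b"
      using sub_reach[of "W1 @ c # W3 @ [x]" "d # W4" "[]" "insert x S" d b] snoc.prems(1) dist disj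
      by auto
    then have "allowed A S b x d"
      using xd snoc.prems(1) disj unfolding allowed_def by auto
    moreover have "d \<noteq> c" using dist snoc.prems(1) by auto
    ultimately have "slot c d"
      using slot_if_allowed[OF snoc.prems(1), of x d] IH[of x] snoc.prems(2) by simp
    then show ?thesis using True by simp
  next
    case False
    then show ?thesis using IH snoc.prems(3) by simp
  qed
qed

text \<open>Otherwise the edge from \<open>c\<close> to \<open>w\<close> would bypass
  \<open>d\<close>: walk from \<open>a\<close> to \<open>c\<close>, jump to \<open>w\<close>, and
  walk on to \<open>b\<close>.\<close>

lemma no_slot_beyond_separator:
  assumes ys: "ys = W1 @ c # W3 @ d # W4" and d: "separates A S a b d"
    and w: "slot c w" "w \<in> set W4"
  shows False
proof -
  have b: "b \<in> set W4" using last ys w by (cases W4) auto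
  have a: "a \<in> set (W1 @ [c])" using first_in ys by blast
  have "a \<noteq> d" "b \<noteq> d" using a b dist ys by auto
  have "reach A (insert d S) a c"
    using sub_reach[of "[]" "W1 @ [c]" "W3 @ d # W4" "insert d S" a c] ys a dist disj by auto
  moreover have "reach A (insert d S) c w"
    using w ys dist disj by (intro reach_step) (auto simp: slot_def)
  moreover have "reach A (insert d S) w b"
    using sub_reach[of "W1 @ c # W3 @ [d]" W4 "[]" "insert d S" w b] ys w b dist disj by auto
  ultimately have "reach A (insert d S) a b" using reach_trans by meson
  then show False using d \<open>a \<noteq> d\<close> \<open>b \<noteq> d\<close> unfolding separates_def by blast
qed

end

text \<open>As long as \<open>F\<close> fails, the length after \<open>m\<close> rounds is at least
  \<open>Suc m\<close>, because the list starts nonempty. At \<open>m = n\<close> this contradicts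
  the length bound.\<close>

lemma last_funpow_progress:
  assumes "I q" "\<And>q. I q \<Longrightarrow> \<not> F q \<Longrightarrow> I (f q) \<and> length (f q) = Suc (length q)"
    "\<And>q. I q \<Longrightarrow> F q \<Longrightarrow> f q = q" "\<And>q. I q \<Longrightarrow> q \<noteq> [] \<and> length q \<le> n"
  shows "I ((f ^^ n) q) \<and> F ((f ^^ n) q)"
proof -
  have *: "I ((f ^^ m) q) \<and> (F ((f ^^ m) q) \<or> length ((f ^^ m) q) \<ge> Suc m)" for m
  proof (induction m)
    case 0
    then show ?case using assms(1) assms(4)[OF assms(1)] by (cases q) auto
  next
    case (Suc m)
    then show ?case using assms(2,3)[of "(f ^^ m) q"] by (cases "F ((f ^^ m) q)") auto
  qed
  then show ?thesis using assms(4)[of "(f ^^ n) q"] *[of n] by fastforce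
qed

lemma fold_const: "fold (\<lambda>_. f) xs = f ^^ length xs"
  by (induction xs) (auto simp: funpow_swap1 fun_eq_iff)

text \<open>Here \<open>pre\<close> is what the given path visits before the segment. The assumption
  \<open>order\<close> holds because that path respects \<pi>. The second part of
  \<open>reserved\<close> says that other pairs of anchors do not reserve vertices of this segment
  beyond its own separators.\<close>

locale greedy_block_segment = block_segment +
  fixes n :: nat and \<pi> :: "nat rel" and L :: "nat list" and pre :: "nat set"
  assumes bound: "A \<subseteq> {..<n} \<times> {..<n}"
    and order: "\<And>us y vs. ys = us @ y # vs \<Longrightarrow> available n \<pi> (pre \<union> set us) y"
    and reserved: "\<And>w. separates A S a b w \<Longrightarrow> reserved A S L w"
      "\<And>w. w \<in> set ys \<Longrightarrow> reserved A S L w \<Longrightarrow> separates A S a b w"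
    and pre: "pre \<inter> set ys = {}"
begin

text \<open>The given Hamiltonian path runs through \<open>ys\<close>. When the greedy path is in the slot of the separator
  \<open>c\<close>, it has visited everything that the given path visits up to \<open>c\<close>, and no reserved vertex
  besides.\<close>

definition invar :: "nat list \<Rightarrow> nat list \<Rightarrow> nat \<Rightarrow> nat list \<Rightarrow> bool" where
  "invar q W1 c W2 \<longleftrightarrow> partial_path n A \<pi> q \<and> ys = W1 @ c # W2 \<and> separates A S a b c \<and>
     pre \<union> set W1 \<union> {c} \<subseteq> set q \<and>
     (\<forall>w\<in>set q. reserved A S L w \<longrightarrow> w \<in> pre \<union> set W1 \<union> {c}) \<and>
     (List.hd q = c \<or> slot c (List.hd q) \<and> \<not> separates A S a b (List.hd q))"

lemma available_mono: "available n \<pi> Q w \<Longrightarrow> Q \<subseteq> Q' \<Longrightarrow> available n \<pi> Q' w"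
  unfolding available_def by blast

text \<open>An unreserved candidate keeps the greedy path in the slot. If there is none, everything
  that the given path visits between \<open>c\<close> and the next separator \<open>d\<close> has
  been visited already, so \<open>d\<close> is available, and it is the only separator that can be
  entered.\<close>

lemma invar_step:
  assumes inv: "invar q W1 c W2" and W2: "W2 \<noteq> []"
  shows "\<exists>W1' c' W2'. invar (greedy_step n A \<pi> S L a b q) W1' c' W2'"
    and "length (greedy_step n A \<pi> S L a b q) = Suc (length q)"
proof -
  let ?u = "List.hd q" and ?R = "reserved A S L" and ?Sep = "separates A S a b"
  have q: "partial_path n A \<pi> q" "q \<noteq> []" "?u \<in> set q"
    and ys: "ys = W1 @ c # W2" and c: "?Sep c" and sub: "pre \<union> set W1 \<union> {c} \<subseteq> set q"
    and res: "\<And>w. w \<in> set q \<Longrightarrow> ?R w \<Longrightarrow> w \<in> pre \<union> set W1 \<union> {c}"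
    and u: "?u = c \<or> slot c ?u \<and> \<not> ?Sep ?u"
    using inv partial_path_ne unfolding invar_def by auto
  have "b \<in> set W2" using last ys W2 by auto
  then have "c \<noteq> b" using dist ys by auto
  have iff: "slot c w \<longleftrightarrow> allowed A S b ?u w" if "w \<notin> set q" for w
    using slot_iff_allowed[OF ys \<open>c \<noteq> b\<close> u, of w] that q(3) sub by blast
  have lt: "w < n" if "slot c w" for w
    using that bound unfolding slot_def by auto
  have "\<exists>W1' c' W2'. invar (greedy_step n A \<pi> S L a b q) W1' c' W2' \<and>
    length (greedy_step n A \<pi> S L a b q) = Suc (length q)"
  proof (cases "\<forall>v<n. candidate n A \<pi> S b q v \<longrightarrow> ?R v")
    case False
    then obtain w where w: "greedy_step n A \<pi> S L a b q = w # q" "w < n" "candidate n A \<pi> S b q w" "\<not> ?R w"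
      by (cases rule: greedy_step_cases[of n A \<pi> S L a b q]) (use False in blast)+
    then have "slot c w" using iff unfolding candidate_def by blast
    moreover have "\<not> ?Sep w" using w(4) reserved(1) by blast
    ultimately have "invar (w # q) W1 c W2"
      using partial_path_extend[OF q(1) w(3,2)] ys c sub res w(4) unfolding invar_def by auto
    then show ?thesis using w(1) by auto
  next
    case True
    have "\<exists>x\<in>set W2. ?Sep x" using \<open>b \<in> set W2\<close> unfolding separates_def by blast
    from split_list_first_prop[OF this] obtain W3 d W4 where
      W: "W2 = W3 @ d # W4" "?Sep d" "\<forall>y\<in>set W3. \<not> ?Sep y" by blast
    have ys': "ys = W1 @ c # W3 @ d # W4" using ys W(1) by simp
    have slot: "slot c y" if "y \<in> set (W3 @ [d])" for y
      using slot_prefix[OF ys' W(3) that] .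
    \<comment> \<open>Going along \<open>W3\<close>, the predecessors of \<open>y\<close> have been
      visited by the given path before \<open>y\<close>, hence by the greedy path. So
      \<open>y\<close> would be an unreserved candidate if it were unvisited.\<close>
    have "W3 = V @ V' \<Longrightarrow> set V \<subseteq> set q" for V V'
    proof (induction V arbitrary: V' rule: rev_induct)
      case (snoc y V)
      have V: "set V \<subseteq> set q" using snoc.IH[of "y # V'"] snoc.prems by simp
      have "available n \<pi> (pre \<union> set (W1 @ c # V)) y"
        using order[of "W1 @ c # V" y "V' @ d # W4"] ys' snoc.prems by simp
      then have "available n \<pi> (set q) y"
        by (rule available_mono) (use sub V in auto)
      moreover have "slot c y" using slot snoc.prems by simp
      moreover have "\<not> ?R y" using reserved(2)[of y] W(3) ys' snoc.prems by auto
      ultimately have "y \<in> set q" using True iff lt unfolding candidate_def by blast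
      then show ?case using V by simp
    qed simp
    from this[of W3 "[]"] have W3: "set W3 \<subseteq> set q" by simp
    \<comment> \<open>Reservation matters here: a greedy visit to \<open>d\<close> ahead of time
      would block the way to \<open>b\<close>.\<close>
    have "d \<notin> set q" using res[of d] reserved(1)[OF W(2)] dist ys' pre by auto
    have "available n \<pi> (pre \<union> set (W1 @ c # W3)) d"
      using order[of "W1 @ c # W3" d W4] ys' by simp
    then have "available n \<pi> (set q) d"
      by (rule available_mono) (use sub W3 in auto)
    then have d: "candidate n A \<pi> S b q d" "d < n"
      using \<open>d \<notin> set q\<close> slot[of d] iff lt unfolding candidate_def by auto
    obtain w where w: "greedy_step n A \<pi> S L a b q = w # q" "candidate n A \<pi> S b q w" "?Sep w"
      by (cases rule: greedy_step_cases[of n A \<pi> S L a b q]) (use True d W(2) in blast)+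
    have "w \<notin> set q" "slot c w" using w(2) iff unfolding candidate_def by auto
    then have "w \<in> set (d # W4)" using separates_in[OF w(3)] ys' sub W3 by auto
    moreover have "w \<notin> set W4"
      using no_slot_beyond_separator[OF ys' W(2) \<open>slot c w\<close>] by blast
    ultimately have "w = d" by simp
    then have "invar (w # q) (W1 @ c # W3) d W4"
      using partial_path_extend[OF q(1) d] ys' W(2) sub W3 res unfolding invar_def by auto
    then show ?thesis using w(1) by auto
  qed
  then show "\<exists>W1' c' W2'. invar (greedy_step n A \<pi> S L a b q) W1' c' W2'"
    and "length (greedy_step n A \<pi> S L a b q) = Suc (length q)" by auto
qed

text \<open>The slot of \<open>b\<close> is empty, since nothing reaches \<open>b\<close> after
  \<open>b\<close> is deleted; and before the last separator the target cannot be the current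
  vertex.\<close>

lemma invar_done:
  assumes inv: "invar q W1 c W2"
  shows "List.hd q = b \<longleftrightarrow> W2 = []"
proof -
  have ys: "ys = W1 @ c # W2" using inv unfolding invar_def by blast
  show ?thesis
  proof (cases "W2 = []")
    case True
    then have "c = b" using ys last by simp
    moreover have "\<not> slot b (List.hd q)" using reach_notin unfolding slot_def by blast
    ultimately show ?thesis using True inv unfolding invar_def by blast
  next
    case False
    then have "b \<in> set W2" using last ys by auto
    then have "c \<noteq> b" using dist ys by auto
    moreover have "separates A S a b b" unfolding separates_def by blast
    ultimately show ?thesis using False inv unfolding invar_def by blast
  qed
qed

end

text \<open>The vertex \<open>b\<close> is visited already, and any other candidate would have to
  reach \<open>b\<close> with \<open>b\<close> deleted.\<close>

lemma greedy_step_at_target: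
  assumes "hd q = b" "q \<noteq> []"
  shows "greedy_step n A \<pi> S L a b q = q"
proof -
  have "\<not> candidate n A \<pi> S b q w" for w
    using assms reach_notin[of A "insert b S" w b] hd_in_set[of q]
    unfolding candidate_def allowed_def by auto
  then show ?thesis by (cases rule: greedy_step_cases[of n A \<pi> S L a b q]) blast+
qed

context greedy_block_segment
begin

lemma greedy_segment_covers:
  assumes q: "partial_path n A \<pi> q" "List.hd q = a" "insert a pre \<subseteq> set q"
    "\<forall>w\<in>set q. reserved A S L w \<longrightarrow> w \<in> insert a pre"
  shows "let q' = greedy_segment n A \<pi> S L b q in partial_path n A \<pi> q' \<and> List.hd q' = b \<and>
    pre \<union> set ys \<subseteq> set q' \<and> (\<forall>w\<in>set q'. reserved A S L w \<longrightarrow> w \<in> pre \<union> set ys)"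
proof -
  let ?f = "greedy_step n A \<pi> S L a b"
  let ?I = "\<lambda>q. \<exists>W1 c W2. invar q W1 c W2"
  obtain W where W: "ys = a # W" using ne hd by (cases ys) auto
  have "invar q [] a W" using q W unfolding invar_def by (auto simp: separates_def)
  then have "?I q" by blast
  then have "?I ((?f ^^ n) q) \<and> List.hd ((?f ^^ n) q) = b"
  proof (rule last_funpow_progress)
    fix q assume "?I q" "List.hd q \<noteq> b"
    then show "?I (?f q) \<and> length (?f q) = Suc (length q)" using invar_done invar_step by blast
  next
    fix q assume I: "?I q"
    then have "partial_path n A \<pi> q" unfolding invar_def by blast
    then show "q \<noteq> [] \<and> length q \<le> n" using partial_path_ne partial_path_length by blast
    then show "?f q = q" if "List.hd q = b" using greedy_step_at_target that by blast
  qed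
  moreover have "(?f ^^ n) q = greedy_segment n A \<pi> S L b q"
    unfolding greedy_segment_def fold_const using q(2) by simp
  ultimately obtain W1 c W2 where I: "invar (greedy_segment n A \<pi> S L b q) W1 c W2"
      "List.hd (greedy_segment n A \<pi> S L b q) = b" by auto
  then have "W2 = []" using invar_done by blast
  then have "pre \<union> set W1 \<union> {c} = pre \<union> set ys" using I(1) unfolding invar_def by auto
  then show ?thesis using I unfolding invar_def Let_def by metis
qed

end

section \<open>From single segments to the whole path\<close>

lemma greedy_segment_direct:
  assumes "a \<in> S \<or> b \<in> S" "(a, b) \<in> A" "b < n"
    and q: "partial_path n A \<pi> q" "hd q = a" "b \<notin> set q" "available n \<pi> (set q) b"
    and res: "reserved A S L b"
  shows "greedy_segment n A \<pi> S L b q = b # q"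
proof -
  let ?f = "greedy_step n A \<pi> S L a b"
  \<comment> \<open>Any \<open>w\<close> other than \<open>b\<close> would require \<open>a\<close>
    and \<open>b\<close> to lie outside \<open>S\<close>.\<close>
  have cand: "candidate n A \<pi> S b q w \<longleftrightarrow> w = b" for w
    using assms reach_notin[of A "insert a S" w b] unfolding candidate_def allowed_def by auto
  have sep: "separates A S a b b" unfolding separates_def by blast
  have 1: "?f q = b # q"
    by (cases rule: greedy_step_cases[of n A \<pi> S L a b q]) (use cand res sep assms(3) in auto)
  have 2: "?f (b # q) = b # q" by (rule greedy_step_at_target) auto
  have "(?f ^^ Suc m) q = b # q" for m by (induction m) (auto simp: 1 2)
  from this[of "n - 1"] have "(?f ^^ n) q = b # q" using assms(3) by (cases n) auto
  then show ?thesis unfolding greedy_segment_def fold_const using q(2) by simp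
qed

text \<open>This fixes only what the gaps between anchors must look like; the number of anchors is
  bounded separately. Adjacent anchors outside \<open>S\<close> fall under the second alternative
  with \<open>W = []\<close>, so a vertex can always be made an anchor provisionally.\<close>

inductive anchored :: "nat set \<Rightarrow> nat list \<Rightarrow> nat list \<Rightarrow> bool" for S where
  single: "anchored S [a] [a]"
| segment: "anchored S (b # p) (b # L) \<Longrightarrow>
    W = [] \<and> (a \<in> S \<or> b \<in> S) \<or> set (a # W @ [b]) \<inter> S = {} \<Longrightarrow>
    anchored S (a # W @ b # p) (a # b # L)"

lemma block_segment_anchored:
  assumes "sym A" "block_closed A S" "walk_in A (a # W @ b # p)" "distinct (a # W @ b # p)"
    "set (a # W @ [b]) \<inter> S = {}"
  shows "block_segment A S a b (a # W @ [b])"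
proof -
  have "walk_in A ((a # W @ [b]) @ p)" "distinct ((a # W @ [b]) @ p)" using assms(3,4) by auto
  then have "walk_in A (a # W @ [b])" "distinct (a # W @ [b])"
    unfolding successively_append_iff distinct_append by blast+
  then show ?thesis using assms by unfold_locales auto
qed

lemma separates_anchored:
  assumes "sym A" "block_closed A S" "walk_in A (a # W @ b # p)" "distinct (a # W @ b # p)"
    "W = [] \<and> (a \<in> S \<or> b \<in> S) \<or> set (a # W @ [b]) \<inter> S = {}" "separates A S a b w"
  shows "w \<in> set (a # W @ [b])"
  using assms(5)
proof
  assume "W = [] \<and> (a \<in> S \<or> b \<in> S)"
  then show ?thesis using assms(6) reach_notin[of A S a b] unfolding separates_def by auto
next
  assume "set (a # W @ [b]) \<inter> S = {}"
  from block_segment.separates_in[OF block_segment_anchored[OF assms(1-4) this] assms(6)]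
  show ?thesis .
qed

lemma walk_in_suffix: "walk_in A (xs @ ys) \<Longrightarrow> walk_in A ys"
  by (simp add: successively_append_iff)

text \<open>Applied to a suffix of the path, this shows that later anchors never reserve vertices
  that the given path visits earlier. So the segments can be treated one after another.\<close>

lemma reserved_anchored:
  assumes "anchored S p L" "sym A" "block_closed A S" "walk_in A p" "distinct p" "reserved A S L w"
  shows "w \<in> set p"
  using assms(1,4-)
proof (induction rule: anchored.induct)
  case (segment b p L W a)
  from segment.prems(3) consider "separates A S a b w" | "reserved A S (b # L) w" by auto
  then show ?case
  proof cases
    case 1
    from separates_anchored[OF assms(2,3) segment.prems(1,2) segment.hyps(2) 1] show ?thesis by auto
  next
    case 2
    have "walk_in A (b # p)" using walk_in_suffix[of A "a # W"] segment.prems(1) by simp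
    then show ?thesis using segment.IH segment.prems(2) 2 by auto
  qed
qed auto

lemma reserved_hd: "reserved A S (b # L) b"
  by (cases L) (auto simp: separates_def)

text \<open>The generalisation for the induction: \<open>L\<close> stays the full list of anchors,
  which determines the reserved vertices, while \<open>L'\<close> and \<open>p\<close> are the
  anchors and the part of the path still to come and \<open>pre\<close> is the part behind. On
  \<open>p\<close>, both lists reserve the same vertices.\<close>

lemma greedy_path_covers:
  assumes "anchored S p L'" "sym A" "A \<subseteq> {..<n} \<times> {..<n}" "block_closed A S"
    "walk_in A p" "distinct p" "pre \<inter> set p = {}"
    "\<And>us y vs. p = us @ y # vs \<Longrightarrow> available n \<pi> (pre \<union> set us) y"
    "\<And>w. reserved A S L' w \<Longrightarrow> reserved A S L w"
    "\<And>w. w \<in> set p \<Longrightarrow> reserved A S L w \<Longrightarrow> reserved A S L' w"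
    "partial_path n A \<pi> q" "hd q = hd p" "insert (hd p) pre \<subseteq> set q"
    "\<forall>w\<in>set q. reserved A S L w \<longrightarrow> w \<in> insert (hd p) pre"
  shows "set p \<union> pre \<subseteq> set (fold (greedy_segment n A \<pi> S L) (tl L') q) \<and>
    hd (fold (greedy_segment n A \<pi> S L) (tl L') q) = last p"
  using assms(1,5-)
proof (induction arbitrary: pre q rule: anchored.induct)
  case (single a)
  then show ?case by auto
next
  case (segment b p L' W a)
  let ?R = "reserved A S L"
  note walk = segment.prems(1) and path_distinct = segment.prems(2) and pre = segment.prems(3)
    and order = segment.prems(4) and q = segment.prems(7-10)
  note sep_in = separates_anchored[OF assms(2,4) walk path_distinct segment.hyps(2)]
  have walk_b: "walk_in A (b # p)" using walk_in_suffix[of A "a # W"] walk by simp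
  define q' where "q' = greedy_segment n A \<pi> S L b q"
  have q': "partial_path n A \<pi> q' \<and> hd q' = b \<and> insert b (pre \<union> set (a # W)) \<subseteq> set q' \<and>
    (\<forall>w\<in>set q'. ?R w \<longrightarrow> w \<in> insert b (pre \<union> set (a # W)))"
  proof (cases "set (a # W @ [b]) \<inter> S = {}")
    case True
    interpret block_segment A S a b "a # W @ [b]"
      by (rule block_segment_anchored[OF assms(2,4) walk path_distinct True])
    interpret greedy_block_segment A S a b "a # W @ [b]" n \<pi> L pre
    proof
      show "available n \<pi> (pre \<union> set us) y" if "a # W @ [b] = us @ y # vs" for us y vs
      proof -
        have "a # W @ b # p = (a # W @ [b]) @ p" by simp
        also have "\<dots> = us @ y # vs @ p" unfolding that by simp
        finally show ?thesis using order by blast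
      qed
      show "?R w" if "separates A S a b w" for w
        using segment.prems(5)[of w] that by simp
      show "separates A S a b w" if w: "w \<in> set (a # W @ [b])" "?R w" for w
      proof -
        have "separates A S a b w \<or> reserved A S (b # L') w"
          using segment.prems(6)[of w] w by auto
        \<comment> \<open>What later anchors reserve lies on \<open>b # p\<close>, which meets the
          segment in \<open>b\<close> only.\<close>
        moreover have "w = b" if "reserved A S (b # L') w"
        proof -
          have "distinct (b # p)" using path_distinct by simp
          from reserved_anchored[OF segment.hyps(1) assms(2,4) walk_b this that]
          show ?thesis using path_distinct w by auto
        qed
        ultimately show ?thesis unfolding separates_def by blast
      qed
    qed (use assms(3) pre in auto)
    show ?thesis
      using greedy_segment_covers[of q] q unfolding q'_def Let_def by auto
  next
    case False
    then have W: "W = []" "a \<in> S \<or> b \<in> S" using segment.hyps(2) by auto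
    have ab: "(a, b) \<in> A" using walk W by simp
    have res: "?R b" using segment.prems(5)[of b] by (simp add: separates_def)
    \<comment> \<open>Since \<open>b\<close> is reserved, a visit to it would place it in
      \<open>insert a pre\<close>, which is disjoint from the rest of the path.\<close>
    have b: "b \<notin> set q" using q(4) res path_distinct pre W by auto
    have "available n \<pi> (pre \<union> {a}) b" using order[of "[a]" b p] W by simp
    then have av: "available n \<pi> (set q) b" using q(3) unfolding available_def by auto
    have "b < n" using ab assms(3) by auto
    from greedy_segment_direct[OF W(2) ab this q(1) _ b av res] q(2)
    have "q' = b # q" unfolding q'_def by simp
    moreover have "partial_path n A \<pi> (b # q)"
      using q(1,2) ab b av \<open>b < n\<close> by (cases q) auto
    ultimately show ?thesis using q(3,4) W by auto
  qed
  have "set (b # p) \<union> (pre \<union> set (a # W)) \<subseteq> set (fold (greedy_segment n A \<pi> S L) (tl (b # L')) q') \<and>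
    hd (fold (greedy_segment n A \<pi> S L) (tl (b # L')) q') = last (b # p)"
  proof (rule segment.IH[OF walk_b])
    show "distinct (b # p)" "(pre \<union> set (a # W)) \<inter> set (b # p) = {}" using path_distinct pre by auto
    show "available n \<pi> (pre \<union> set (a # W) \<union> set us) y" if "b # p = us @ y # vs" for us y vs
      using order[of "a # W @ us" y vs] that by (simp add: Un_assoc)
    show "?R w" if "reserved A S (b # L') w" for w using segment.prems(5)[of w] that by simp
    show "reserved A S (b # L') w" if w: "w \<in> set (b # p)" "?R w" for w
    proof -
      have "separates A S a b w \<or> reserved A S (b # L') w" using segment.prems(6)[of w] w by auto
      then show ?thesis
      proof
        assume "separates A S a b w"
        from sep_in[OF this] have "w = b" using w(1) path_distinct by auto
        then show ?thesis using reserved_hd by simp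
      qed
    qed
  qed (use q' in auto)
  then show ?case unfolding q'_def by auto
qed

text \<open>Anchors are chosen from the end of the path. A head in \<open>S\<close> fits into the
  three anchors for that vertex. With a head outside \<open>S\<close>, the list grows to length
  \<open>3 * card (S \<inter> set p) + 2\<close> only when its second anchor lies outside
  \<open>S\<close> too; then the head can be replaced by the next vertex and becomes interior to the
  first segment. The final clause keeps this replacement possible.\<close>

lemma anchored_exists:
  assumes "p \<noteq> []" "distinct p"
  shows "\<exists>L. anchored S p L \<and> hd L = hd p \<and> set L \<subseteq> set p \<and>
    (if hd p \<in> S then length L \<le> 3 * card (S \<inter> set p)
     else length L \<le> 3 * card (S \<inter> set p) + 2 \<and>
       (length L \<le> 3 * card (S \<inter> set p) + 1 \<or> (\<exists>b L'. L = hd p # b # L' \<and> b \<notin> S)))"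
  using assms
proof (induction p rule: list_nonempty_induct)
  case (single x)
  show ?case by (rule exI[of _ "[x]"]) (auto intro: anchored.single)
next
  case (cons x p)
  then obtain L where L: "anchored S p L" "hd L = hd p" "set L \<subseteq> set p"
    "if hd p \<in> S then length L \<le> 3 * card (S \<inter> set p)
     else length L \<le> 3 * card (S \<inter> set p) + 2 \<and>
       (length L \<le> 3 * card (S \<inter> set p) + 1 \<or> (\<exists>b L'. L = hd p # b # L' \<and> b \<notin> S))"
    by auto
  obtain y p' where p: "p = y # p'" using cons.hyps by (cases p) auto
  obtain L' where L': "L = y # L'" using L(1,2) p by cases auto
  have card: "card (S \<inter> set (x # p)) = (if x \<in> S then Suc (card (S \<inter> set p)) else card (S \<inter> set p))"
    using cons.prems by auto
  have add: "anchored S (x # p) (x # L)"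
    using anchored.segment[of S y p' L' "[]" x] L(1) p L' by auto
  show ?case
  proof (cases "x \<in> S \<or> y \<in> S \<or> length L \<le> 3 * card (S \<inter> set p) + 1")
    case True
    show ?thesis
      by (rule exI[of _ "x # L"]) (use True add L(3,4) p L' card in \<open>auto split: if_splits\<close>)
  next
    case False
    then obtain b L'' where b: "L = y # b # L''" "b \<notin> S" using L(4) p by auto
    from L(1) b(1) p obtain W p'' where W: "p = y # W @ b # p''" "anchored S (b # p'') (b # L'')"
        "W = [] \<and> (y \<in> S \<or> b \<in> S) \<or> set (y # W @ [b]) \<inter> S = {}"
      by cases auto
    \<comment> \<open>The old head \<open>y\<close> is dropped as an anchor: \<open>x\<close>,
      \<open>y\<close> and \<open>b\<close> lie outside \<open>S\<close>, and therefore so does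
      \<open>W\<close>.\<close>
    have "anchored S (x # (y # W) @ b # p'') (x # b # L'')"
      by (rule anchored.segment[OF W(2)]) (use W(3) False b(2) in auto)
    then have "anchored S (x # p) (x # b # L'')" using W(1) by simp
    then show ?thesis
      by (intro exI[of _ "x # b # L''"]) (use False b L(3,4) p card in auto)
  qed
qed

lemma accepts_complete:
  assumes "sym A" "A \<subseteq> {..<n} \<times> {..<n}" "block_closed A S" "finite S"
    and p: "p \<noteq> []" "distinct p" "set p = {..<n}" "walk_in A p" "extending \<pi> p"
    and cyc: "cyc \<longrightarrow> (hd p, last p) \<in> A"
  shows "\<exists>L. set L \<subseteq> {..<n} \<and> length L \<le> 3 * card S + 2 \<and> accepts n A \<pi> cyc S L"
proof -
  obtain L where L: "anchored S p L" "hd L = hd p" "set L \<subseteq> set p"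
      "length L \<le> 3 * card (S \<inter> set p) + 2"
    using anchored_exists[OF p(1,2), of S] by (auto split: if_splits)
  have "card (S \<inter> set p) \<le> card S" using assms(4) by (intro card_mono) auto
  then have len: "length L \<le> 3 * card S + 2" using L(4) by simp
  have order: "available n \<pi> ({} \<union> set us) y" if "p = us @ y # vs" for us y vs
    unfolding available_def
  proof (intro allI impI)
    fix z assume z: "z < n" "(z, y) \<in> \<pi>" "z \<noteq> y"
    have "z \<in> set p" using z(1) p(3) by auto
    then obtain i where i: "i < length p" "p ! i = z" by (auto simp: in_set_conv_nth)
    have y: "p ! length us = y" "length us < length p" using that by auto
    have "i \<le> length us" using p(5) i y z(2) unfolding extending_def by blast
    moreover have "i \<noteq> length us" using i y z(3) by auto
    ultimately have "i < length us" by simp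
    then have "us ! i = z" using i that by (simp add: nth_append)
    then show "z \<in> {} \<union> set us" using \<open>i < length us\<close> by auto
  qed
  obtain p' where hd: "p = hd p # p'" using p(1) by (cases p) auto
  have start: "available n \<pi> {} (hd p)" using order[of "[]" "hd p" p'] hd by simp
  have "hd p \<in> set p" using p(1) by simp
  then have "hd p < n" using p(3) by simp
  obtain L' where L': "L = hd p # L'" using L(1,2) by cases auto
  have "set p \<union> {} \<subseteq> set (fold (greedy_segment n A \<pi> S L) (tl L) [hd L]) \<and>
    hd (fold (greedy_segment n A \<pi> S L) (tl L) [hd L]) = last p"
    by (rule greedy_path_covers[OF L(1) assms(1-3) p(4,2)])
      (use order start \<open>hd p < n\<close> L(2) in auto)
  then have "accepts n A \<pi> cyc S L"
    using start L' L(2) p(3) cyc unfolding accepts_def greedy_path_def by auto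
  then show ?thesis using L(3) len p(3) by blast
qed

lemma accepts_sound:
  assumes "accepts n A \<pi> cyc S L" "set L \<subseteq> {..<n}"
  shows "\<exists>p. p \<noteq> [] \<and> distinct p \<and> set p = {..<n} \<and> walk_in A p \<and> extending \<pi> p \<and>
    (cyc \<longrightarrow> (hd p, last p) \<in> A)"
proof -
  let ?q = "greedy_path n A \<pi> S L"
  have L: "L \<noteq> []" "available n \<pi> {} (hd L)" "{..<n} \<subseteq> set ?q" "cyc \<longrightarrow> (hd L, hd ?q) \<in> A"
    using assms(1) unfolding accepts_def by auto
  have "hd L < n" using assms(2) L(1) hd_in_set by blast
  then have q: "partial_path n A \<pi> ?q" "last ?q = hd L"
    using partial_path_greedy_path L(2) by auto
  have "rev ?q \<noteq> []" using partial_path_ne[OF q(1)] by simp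
  moreover have "distinct (rev ?q)" "set (rev ?q) = {..<n}"
    using partial_path_subset[OF q(1)] L(3) by auto
  moreover have "cyc \<longrightarrow> (hd (rev ?q), last (rev ?q)) \<in> A"
    using L(4) q(2) \<open>rev ?q \<noteq> []\<close> by (simp add: hd_rev last_rev)
  ultimately show ?thesis
    using partial_path_walk[OF q(1)] partial_path_extending[OF q(1)] by blast
qed

section \<open>Block graphs\<close>

text \<open>A shortest walk is simple, because the part between two occurrences of a vertex could be
  cut out.\<close>

lemma reach_distinct_walk:
  assumes "reach A X u v"
  shows "\<exists>p. p \<noteq> [] \<and> hd p = u \<and> last p = v \<and> walk_in A p \<and> set p \<inter> X = {} \<and> distinct p"
proof -
  let ?W = "\<lambda>p. p \<noteq> [] \<and> hd p = u \<and> last p = v \<and> walk_in A p \<and> set p \<inter> X = {}"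
  have "(u, v) \<in> {(x, y) \<in> A. x \<notin> X \<and> y \<notin> X}\<^sup>*" "u \<notin> X" using assms unfolding reach_def by auto
  then have "\<exists>p. p \<noteq> [] \<and> hd p = u \<and> last p = v \<and> walk_in A p \<and> set p \<inter> X = {}"
  proof (induction rule: rtrancl_induct)
    case base
    then show ?case by (intro exI[of _ "[u]"]) auto
  next
    case (step y z)
    then obtain p where p: "p \<noteq> []" "hd p = u" "last p = y" "walk_in A p" "set p \<inter> X = {}"
      by blast
    show ?case
      by (rule exI[of _ "p @ [z]"]) (use p step.hyps(2) in \<open>auto simp: successively_append_iff\<close>)
  qed
  then have "\<exists>p. ?W p \<and> (\<forall>p'. ?W p' \<longrightarrow> length p \<le> length p')"
    by (elim exE) (rule ex_has_least_nat)
  then obtain p where "?W p \<and> (\<forall>p'. ?W p' \<longrightarrow> length p \<le> length p')" ..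
  then have p: "?W p" and least: "\<forall>p'. ?W p' \<longrightarrow> length p \<le> length p'" by (rule conjunct1, rule conjunct2)
  have "distinct p"
  proof (rule ccontr)
    assume "\<not> distinct p"
    then obtain xs y ys zs where *: "p = xs @ [y] @ ys @ [y] @ zs"
      using not_distinct_decomp by blast
    have "walk_in A (xs @ [y] @ zs)"
      using p unfolding * by (simp add: successively_append_iff successively_Cons)
    moreover have "hd (xs @ [y] @ zs) = u" using p unfolding * by (cases xs) simp_all
    moreover have "last (xs @ [y] @ zs) = v" using p unfolding * by (cases zs) simp_all
    moreover have "set (xs @ [y] @ zs) \<inter> X = {}" using p unfolding * by (auto simp del: last_appendR)
    moreover have "xs @ [y] @ zs \<noteq> []" by simp
    ultimately have "?W (xs @ [y] @ zs)" by (intro conjI)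
    from least[THEN spec, THEN mp, OF this] show False unfolding * by simp
  qed
  then show ?thesis using p by (intro exI[of _ p]) simp
qed

lemma reachable_if_reach:
  assumes "reach A (- verts K) u v"
    "\<And>x y. (x, y) \<in> A \<Longrightarrow> x \<in> verts K \<Longrightarrow> y \<in> verts K \<Longrightarrow> (x, y) \<in> arcs_ends K"
  shows "u \<rightarrow>\<^sup>*\<^bsub>K\<^esub> v"
proof -
  have "(u, v) \<in> {(x, y) \<in> A. x \<notin> - verts K \<and> y \<notin> - verts K}\<^sup>*" "u \<in> verts K"
    using assms(1) unfolding reach_def by auto
  then show ?thesis
  proof (induction rule: rtrancl_induct)
    case base
    then show ?case unfolding reachable_def by (rule rtrancl_on_refl)
  next
    case (step y z)
    then have "(u, y) \<in> rtrancl_on (verts K) (arcs_ends K)" "(y, z) \<in> arcs_ends K" "z \<in> verts K"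
      using assms(2) unfolding reachable_def by auto
    then show ?case unfolding reachable_def by (rule rtrancl_on_into_rtrancl_on)
  qed
qed

text \<open>Cut vertices are defined by counting components, so for connected graphs the count has
  to be determined, including the empty graph left by deleting a single vertex.\<close>

lemma sccs_verts_connected:
  assumes "\<And>u v. u \<in> verts K \<Longrightarrow> v \<in> verts K \<Longrightarrow> u \<rightarrow>\<^sup>*\<^bsub>K\<^esub> v"
  shows "pre_digraph.sccs_verts K = (if verts K = {} then {} else {verts K})"
proof -
  have in_verts: "u \<in> verts K \<and> v \<in> verts K" if "u \<rightarrow>\<^sup>*\<^bsub>K\<^esub> v" for u v
    using in_rtrancl_on_in_F[OF that[unfolded reachable_def]] by (rule conjI)
  have all: "T = verts K" if T: "T \<in> pre_digraph.sccs_verts K" for T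
  proof
    note T = T[unfolded pre_digraph.sccs_verts_def, THEN CollectD]
    note T1 = T[THEN conjunct1] and T2 = T[THEN conjunct2, THEN conjunct1]
      and T3 = T[THEN conjunct2, THEN conjunct2]
    show sub: "T \<subseteq> verts K"
    proof
      fix u assume "u \<in> T"
      then have "u \<rightarrow>\<^sup>*\<^bsub>K\<^esub> u" using T2[THEN bspec, THEN bspec] by simp
      then show "u \<in> verts K" using in_verts by simp
    qed
    from T1 obtain u where u: "u \<in> T" by blast
    show "verts K \<subseteq> T"
    proof (rule subsetI, rule ccontr)
      fix w assume w: "w \<in> verts K" "w \<notin> T"
      have "u \<in> verts K" using u sub by (rule rev_subsetD)
      then have "u \<rightarrow>\<^sup>*\<^bsub>K\<^esub> w" "w \<rightarrow>\<^sup>*\<^bsub>K\<^esub> u" using w(1) assms by simp_all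
      then show False using T3[THEN bspec, OF u, THEN spec, THEN mp, OF w(2)] by simp
    qed
  qed
  have ne: "{} \<notin> pre_digraph.sccs_verts K" unfolding pre_digraph.sccs_verts_def by simp
  have in_sccs: "verts K \<in> pre_digraph.sccs_verts K" if "verts K \<noteq> {}"
    unfolding pre_digraph.sccs_verts_def
  proof (intro CollectI conjI ballI allI impI)
    fix u v assume "u \<in> verts K" "v \<notin> verts K"
    then show "\<not> u \<rightarrow>\<^sup>*\<^bsub>K\<^esub> v \<or> \<not> v \<rightarrow>\<^sup>*\<^bsub>K\<^esub> u" using in_verts by blast
  next
    fix u v assume "u \<in> verts K" "v \<in> verts K"
    then show "u \<rightarrow>\<^sup>*\<^bsub>K\<^esub> v" by (rule assms)
  qed (rule that)
  show ?thesis
  proof (cases "verts K = {}")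
    case True
    then have "T \<notin> pre_digraph.sccs_verts K" for T using all[of T] ne by metis
    then have "pre_digraph.sccs_verts K = {}" by (intro equals0I) (erule notE[rotated])
    then show ?thesis using True by simp
  next
    case False
    have "pre_digraph.sccs_verts K \<subseteq> {verts K}"
    proof
      fix T assume "T \<in> pre_digraph.sccs_verts K"
      then have "T = verts K" by (rule all)
      then show "T \<in> {verts K}" by (simp only: singletonI)
    qed
    moreover have "{verts K} \<subseteq> pre_digraph.sccs_verts K"
      using in_sccs[OF False] by (simp only: insert_subset empty_subsetI simp_thms)
    ultimately show ?thesis using False by (simp only: if_False subset_antisym)
  qed
qed

text \<open>Deleting a vertex of a cycle leaves a walk through all the others, so no vertex is a cut
  vertex. Chords in \<open>K\<close> do no harm, since only the presence of the cycle edges is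
  used.\<close>

lemma two_connected_cycle:
  assumes "sym A" "walk_in A (u # p)" "(last p, u) \<in> A" "distinct (u # p)" "p \<noteq> []"
    and K: "wf_digraph K" "verts K = set (u # p)"
      "\<And>x y. (x, y) \<in> A \<Longrightarrow> x \<in> verts K \<Longrightarrow> y \<in> verts K \<Longrightarrow> (x, y) \<in> arcs_ends K"
  shows "two_connected K"
proof -
  have conn: "x \<rightarrow>\<^sup>*\<^bsub>K\<^esub> y" if "x \<in> verts K" "y \<in> verts K" for x y
  proof (rule reachable_if_reach[OF _ K(3)])
    show "reach A (- verts K) x y"
      using reach_walk[OF assms(1,2), of "- verts K" x y] that K(2) by simp
  qed
  have "connected K"
    unfolding connected_def strongly_connected_def
    using wf_digraph.reachable_mk_symmetricI[OF K(1)] conn K(2) by (auto simp: mk_symmetric_def)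
  moreover have "\<not> cut_vertex K v" for v
  proof (cases "v \<in> verts K")
    case True
    let ?K = "pre_digraph.del_vert K v"
    have V: "verts ?K = verts K - {v}" by (simp add: pre_digraph.del_vert_def)
    have arcs: "(x, y) \<in> arcs_ends ?K" if "(x, y) \<in> A" "x \<in> verts ?K" "y \<in> verts ?K" for x y
      using K(3)[OF that(1)] that(2,3) unfolding V arcs_ends_def arc_to_ends_def
      by (auto simp: pre_digraph.del_vert_def)
    obtain c where c: "walk_in A c" "set c = verts ?K"
    proof (cases "v = u")
      case True
      show thesis
        by (rule that[of p]) (use assms(2,4) True V K(2) in \<open>auto simp: successively_Cons\<close>)
    next
      case False
      then obtain l r where p: "p = l @ v # r" using True K(2) by (auto dest: split_list)
      have "walk_in A ((u # l) @ v # r)" using assms(2) p by simp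
      then have "walk_in A (u # l)" "walk_in A r"
        by (simp_all only: successively_append_iff) (auto simp: successively_Cons)
      moreover have "r \<noteq> [] \<Longrightarrow> (last r, u) \<in> A" using assms(3) p by simp
      \<comment> \<open>The closing edge of the cycle joins the part behind the deleted vertex to
        the part in front of it.\<close>
      ultimately have "walk_in A (r @ u # l)" by (auto simp: successively_append_iff)
      then show thesis
        by (rule that[of "r @ u # l"]) (use p assms(4) V K(2) in auto)
    qed
    have "x \<rightarrow>\<^sup>*\<^bsub>?K\<^esub> y" if "x \<in> verts ?K" "y \<in> verts ?K" for x y
    proof (rule reachable_if_reach[OF _ arcs])
      show "reach A (- verts ?K) x y"
        using reach_walk[OF assms(1) c(1), of "- verts ?K" x y] that c(2) by simp
    qed
    from sccs_verts_connected[of ?K, OF this] sccs_verts_connected[of K, OF conn]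
    show ?thesis using K(2) unfolding cut_vertex_def by auto
  qed (simp add: cut_vertex_def)
  ultimately show ?thesis unfolding two_connected_def by blast
qed

lemma block_of_superset:
  assumes "finite (verts G)" "induced_subgraph K G" "two_connected K"
  shows "\<exists>B. block_of B G \<and> verts K \<subseteq> verts B"
proof -
  let ?P = "\<lambda>B. induced_subgraph B G \<and> two_connected B \<and> verts K \<subseteq> verts B"
  have sub: "verts B \<subseteq> verts G" if "induced_subgraph B G" for B
    using that by (auto simp: induced_subgraph_def subgraph_def)
  have "?P K" using assms by blast
  moreover have "\<forall>B. ?P B \<longrightarrow> card (verts B) < Suc (card (verts G))"
  proof (intro allI impI)
    fix B assume "?P B"
    then have "verts B \<subseteq> verts G" using sub by simp
    then show "card (verts B) < Suc (card (verts G))"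
      using assms(1) by (simp add: card_mono less_Suc_eq_le)
  qed
  ultimately have "\<exists>B. ?P B \<and> (\<forall>B'. ?P B' \<longrightarrow> card (verts B') \<le> card (verts B))"
    by (rule ex_has_greatest_nat)
  then obtain B where "?P B \<and> (\<forall>B'. ?P B' \<longrightarrow> card (verts B') \<le> card (verts B))" ..
  then have B: "?P B" and greatest: "\<And>B'. ?P B' \<Longrightarrow> card (verts B') \<le> card (verts B)"
    by simp_all
  have "\<not> verts B \<subset> verts B'" if "induced_subgraph B' G" "two_connected B'" for B'
  proof
    assume *: "verts B \<subset> verts B'"
    then have "card (verts B) < card (verts B')"
      using sub[OF that(1)] assms(1) by (intro psubset_card_mono) (auto dest: finite_subset)
    moreover have "card (verts B') \<le> card (verts B)"
      by (rule greatest) (use that * B in simp, blast)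
    ultimately show False by simp
  qed
  then have "block_of B G" using B unfolding block_of_def by simp
  then show ?thesis using B by (intro exI[of _ B]) simp
qed

text \<open>The vertex \<open>u\<close> together with a simple walk from \<open>x\<close> to
  \<open>y\<close> avoiding \<open>u\<close> forms a cycle in \<open>G - S\<close>. A cycle is
  2-connected and so lies in a block, and blocks are cliques.\<close>

lemma block_closed_if_block_graph:
  fixes G :: "nat pair_pre_digraph"
  assumes G: "pair_graph G" and S: "block_graph (with_proj G \<restriction> (pverts G - S))"
  shows "block_closed (parcs G) S"
  unfolding block_closed_def
proof (intro allI impI)
  interpret pair_graph G by (rule G)
  let ?A = "parcs G" and ?H = "with_proj G \<restriction> (pverts G - S)"
  have symA: "sym ?A" using pair_sym_arcs by (simp add: symmetric_def)
  fix u x y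
  assume u: "u \<notin> S" "(u, x) \<in> ?A" "(u, y) \<in> ?A" "x \<noteq> y" "reach ?A (insert u S) x y"
  obtain p where p: "p \<noteq> []" "hd p = x" "last p = y" "walk_in ?A p" "set p \<inter> insert u S = {}" "distinct p"
    using reach_distinct_walk[OF u(5)] by blast
  have "walk_in ?A (u # p)" using p u(2) by (simp add: successively_Cons)
  have "set p \<subseteq> pverts G"
  proof
    fix z assume z: "z \<in> set p"
    from reach_walk[OF symA p(4,5) this, of x] p(1,2) have "reach ?A (insert u S) z x" by auto
    then have "(z, x) \<in> {(x, y) \<in> ?A. x \<notin> insert u S \<and> y \<notin> insert u S}\<^sup>*" unfolding reach_def by blast
    then show "z \<in> pverts G" using u(2) in_arcsD1 in_arcsD2 by (cases rule: converse_rtranclE) auto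
  qed
  then have C: "set (u # p) \<subseteq> pverts G - S" using p(5) u(1) in_arcsD1[OF u(2)] by auto
  let ?K = "?H \<restriction> set (u # p)"
  have wfH: "wf_digraph ?H" by (rule wellformed_induce_subgraph)
  have ind: "induced_subgraph ?K ?H" by (rule wf_digraph.induced_induce[OF wfH]) (use C in simp)
  have "two_connected ?K"
  proof (rule two_connected_cycle[OF symA \<open>walk_in ?A (u # p)\<close>])
    show "(last p, u) \<in> ?A" using u(3) p(3) symA by (auto dest: symD)
    show "distinct (u # p)" "p \<noteq> []" using p by auto
    show "wf_digraph ?K" by (rule wf_digraph.wellformed_induce_subgraph[OF wfH])
    show "(v, w) \<in> arcs_ends ?K" if "(v, w) \<in> ?A" "v \<in> verts ?K" "w \<in> verts ?K" for v w
      using that C unfolding arcs_ends_def arc_to_ends_def by (force simp: image_iff)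
  qed simp
  then obtain B where B: "block_of B ?H" "set (u # p) \<subseteq> verts B"
    using block_of_superset[OF _ ind] pair_finite_verts by auto
  then have "clique B" using S unfolding block_graph_def by blast
  moreover have "x \<in> verts B" "y \<in> verts B" using B(2) p(1-3) by auto
  ultimately have "(x, y) \<in> arcs_ends B" using u(4) unfolding clique_def by blast
  then show "(x, y) \<in> ?A"
    using B(1) unfolding block_of_def induced_subgraph_def subgraph_def compatible_def
      arcs_ends_def arc_to_ends_def by auto
qed

lemma distance_to_block_attained:
  fixes G :: "nat pair_pre_digraph"
  assumes "pair_graph G"
  shows "\<exists>S \<subseteq> pverts G. card S = distance_to_block (with_proj G) \<and> block_closed (parcs G) S"
proof -
  \<comment> \<open>Deleting all vertices leaves the empty graph, so the least number is taken over
    a nonempty set.\<close>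
  have "block_graph (with_proj G \<restriction> (verts (with_proj G) - pverts G))"
    unfolding block_graph_def block_of_def clique_def induced_subgraph_def subgraph_def by auto
  then have "\<exists>k. \<exists>S \<subseteq> verts (with_proj G). card S = k \<and> block_graph (with_proj G \<restriction> (verts (with_proj G) - S))"
    by auto
  from LeastI_ex[OF this, folded distance_to_block_def] obtain S where
    "S \<subseteq> pverts G" "card S = distance_to_block (with_proj G)"
    "block_graph (with_proj G \<restriction> (pverts G - S))" by auto
  then show ?thesis using block_closed_if_block_graph[OF assms] by blast
qed

section \<open>The algorithm as a loop expression\<close>

text \<open>Value and loop bound are derived together, because the length of a loop often follows
  only from knowing the value of its list.\<close>

definition computes :: "nat \<Rightarrow> loop_expr \<Rightarrow> tree list \<Rightarrow> tree \<Rightarrow> bool" where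
  "computes B e env x \<longleftrightarrow> loops_bounded B e env \<and> loop_val e env = x"

lemma computes_Var: "entry env i = x \<Longrightarrow> computes B (LVar i) env x"
  unfolding computes_def by simp

lemma computes_Leaf: "computes B LLeaf env Leaf"
  unfolding computes_def by simp

lemma computes_Node: "computes B a env x \<Longrightarrow> computes B b env y \<Longrightarrow> computes B (LNode a b) env (Node x y)"
  unfolding computes_def by simp

lemma computes_Left': "computes B a env t \<Longrightarrow> left t = x \<Longrightarrow> computes B (LLeft a) env x"
  unfolding computes_def by simp

lemma computes_Right': "computes B a env t \<Longrightarrow> right t = x \<Longrightarrow> computes B (LRight a) env x"
  unfolding computes_def by simp

lemma computes_If: "computes B a env t \<Longrightarrow> (t \<noteq> Leaf \<Longrightarrow> computes B b env x) \<Longrightarrow>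
    (t = Leaf \<Longrightarrow> computes B c env x) \<Longrightarrow> computes B (LIf a b c) env x"
  unfolding computes_def by auto

lemma computes_Let: "computes B a env y \<Longrightarrow> computes B b (y # env) x \<Longrightarrow> computes B (LLet a b) env x"
  unfolding computes_def by simp

lemma bool_tree_Leaf [simp]: "bool_tree b = Leaf \<longleftrightarrow> \<not> b"
  by (simp add: bool_tree_def)

text \<open>The invariant \<open>I\<close> carries what the body needs about its accumulator,
  typically a bound on its length.\<close>

lemma computes_Fold:
  assumes "computes B l env (list_tree (map enc ys))" "length ys \<le> B" "computes B i env (enc' s)" "I s"
    and step: "\<And>y s. y \<in> set ys \<Longrightarrow> I s \<Longrightarrow> computes B b (enc y # enc' s # env) (enc' (f y s)) \<and> I (f y s)"
  shows "computes B (LFold l i b) env (enc' (fold f ys s))"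
proof -
  let ?f = "\<lambda>x acc. loop_val b (x # acc # env)" and ?Q = "\<lambda>x acc. loops_bounded B b (x # acc # env)"
  have "set zs \<subseteq> set ys \<Longrightarrow> I s \<Longrightarrow>
      fold_all ?Q ?f (map enc zs) (enc' s) \<and> fold ?f (map enc zs) (enc' s) = enc' (fold f zs s)" for zs s
    by (induction zs arbitrary: s) (use step in \<open>auto simp: computes_def\<close>)
  from this[of ys s] assms(1-4) show ?thesis unfolding computes_def by simp
qed

lemma fold_invariant: "I s \<Longrightarrow> (\<And>y s. y \<in> set ys \<Longrightarrow> I s \<Longrightarrow> I (f y s)) \<Longrightarrow> I (fold f ys s)"
  by (induction ys arbitrary: s) auto

section \<open>Boolean connectives, bounded quantifiers and filters\<close>

definition TrueE :: loop_expr where "TrueE = LNode LLeaf LLeaf"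
definition NotE :: "loop_expr \<Rightarrow> loop_expr" where "NotE a = LIf a LLeaf TrueE"
definition AndE :: "loop_expr \<Rightarrow> loop_expr \<Rightarrow> loop_expr" where "AndE a b = LIf a b LLeaf"
definition OrE :: "loop_expr \<Rightarrow> loop_expr \<Rightarrow> loop_expr" where "OrE a b = LIf a TrueE b"
definition ExE :: "loop_expr \<Rightarrow> loop_expr \<Rightarrow> loop_expr" where
  "ExE l b = LFold l LLeaf (OrE (LVar 1) b)"
definition FilterE :: "loop_expr \<Rightarrow> loop_expr \<Rightarrow> loop_expr" where
  "FilterE l b = LFold l LLeaf (LIf b (LNode (LVar 0) (LVar 1)) (LVar 1))"

lemma computes_True: "computes B TrueE env (bool_tree True)"
  unfolding TrueE_def bool_tree_def by (simp add: computes_Node computes_Leaf)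

lemma computes_Not: "computes B a env (bool_tree p) \<Longrightarrow> computes B (NotE a) env (bool_tree (\<not> p))"
  unfolding NotE_def
  by (erule computes_If) (use computes_True computes_Leaf in \<open>auto simp: bool_tree_def\<close>)

lemma computes_And: "computes B a env (bool_tree p) \<Longrightarrow> (p \<Longrightarrow> computes B b env (bool_tree q)) \<Longrightarrow>
    computes B (AndE a b) env (bool_tree (p \<and> q))"
  unfolding AndE_def
  by (erule computes_If) (use computes_Leaf in \<open>auto simp: bool_tree_def split: if_splits\<close>)

lemma computes_Or: "computes B a env (bool_tree p) \<Longrightarrow> (\<not> p \<Longrightarrow> computes B b env (bool_tree q)) \<Longrightarrow>
    computes B (OrE a b) env (bool_tree (p \<or> q))"
  unfolding OrE_def
  by (erule computes_If) (use computes_True in \<open>auto simp: bool_tree_def split: if_splits\<close>)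

lemma computes_Ex:
  assumes "computes B l env (list_tree (map enc ys))" "length ys \<le> B"
    and "\<And>y s. y \<in> set ys \<Longrightarrow> computes B b (enc y # s # env) (bool_tree (Q y))"
  shows "computes B (ExE l b) env (bool_tree (\<exists>y\<in>set ys. Q y))"
proof -
  have "computes B (ExE l b) env (bool_tree (fold (\<lambda>y s. s \<or> Q y) ys False))"
    unfolding ExE_def
  proof (rule computes_Fold[where I = "\<lambda>_. True", OF assms(1,2)])
    show "computes B LLeaf env (bool_tree False)" by (simp add: bool_tree_def computes_Leaf)
  qed (auto intro!: computes_Or computes_Var assms(3))
  moreover have "fold (\<lambda>y s. s \<or> Q y) ys s \<longleftrightarrow> s \<or> (\<exists>y\<in>set ys. Q y)" for s
    by (induction ys arbitrary: s) auto
  ultimately show ?thesis by simp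
qed

lemma computes_Filter:
  assumes "computes B l env (list_tree (map enc ys))" "length ys \<le> B"
    and "\<And>y s. y \<in> set ys \<Longrightarrow> computes B b (enc y # s # env) (bool_tree (Q y))"
  shows "computes B (FilterE l b) env (list_tree (map enc (rev (filter Q ys))))"
proof -
  have "computes B (FilterE l b) env (list_tree (map enc (fold (\<lambda>y s. if Q y then y # s else s) ys [])))"
    unfolding FilterE_def
  proof (rule computes_Fold[where I = "\<lambda>_. True" and enc' = "\<lambda>s. list_tree (map enc s)", OF assms(1,2)])
    show "computes B LLeaf env (list_tree (map enc []))" by (simp add: list_tree_def computes_Leaf)
    show "computes B (LIf b (LNode (LVar 0) (LVar 1)) (LVar 1)) (enc y # list_tree (map enc s) # env)
        (list_tree (map enc (if Q y then y # s else s))) \<and> True" if "y \<in> set ys" for y s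
      by (rule conjI, rule computes_If[OF assms(3)[OF that]])
        (auto simp: list_tree_def intro!: computes_Node computes_Var)
  qed simp
  moreover have "fold (\<lambda>y s. if Q y then y # s else s) ys s = rev (filter Q ys) @ s" for s
    by (induction ys arbitrary: s) auto
  ultimately show ?thesis by simp
qed

lemma list_tree_simps [simp]:
  "list_tree [] = Leaf" "list_tree (x # xs) = Node x (list_tree xs)"
  "list_tree xs = Leaf \<longleftrightarrow> xs = []"
  by (auto simp: list_tree_def) (cases xs; simp)

text \<open>Unary numbers suffice, since only vertices are represented, and a number can directly
  control a loop.\<close>

definition nat_tree :: "nat \<Rightarrow> tree" where
  "nat_tree m = list_tree (replicate m Leaf)"

definition nats_tree :: "nat list \<Rightarrow> tree" where
  "nats_tree xs = list_tree (map nat_tree xs)"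

lemma nat_tree_simps [simp]: "nat_tree 0 = Leaf" "nat_tree (Suc m) = Node Leaf (nat_tree m)"
  by (auto simp: nat_tree_def)

lemma nats_tree_simps [simp]:
  "nats_tree [] = Leaf" "nats_tree (x # xs) = Node (nat_tree x) (nats_tree xs)"
  "nats_tree xs = Leaf \<longleftrightarrow> xs = []"
  by (auto simp: nats_tree_def)

text \<open>This one operation yields both table lookup and comparison. It is safe beyond the end of
  a list because \<open>right Leaf = Leaf\<close>.\<close>

definition DropE :: "loop_expr \<Rightarrow> loop_expr \<Rightarrow> loop_expr" where
  "DropE a x = LFold x a (LRight (LVar 1))"

lemma computes_Drop:
  assumes "computes B a env (list_tree zs)" "computes B x env (nat_tree m)" "m \<le> B"
  shows "computes B (DropE a x) env (list_tree (drop m zs))"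
proof -
  have "computes B (DropE a x) env (list_tree (fold (\<lambda>_. tl) (replicate m ()) zs))"
    unfolding DropE_def
  proof (rule computes_Fold[where I = "\<lambda>_. True" and enc = "\<lambda>_. Leaf"])
    show "computes B x env (list_tree (map (\<lambda>_. Leaf) (replicate m ())))"
      using assms(2) by (simp add: nat_tree_def)
    show "computes B (LRight (LVar 1)) (Leaf # list_tree s # env) (list_tree (tl s)) \<and> True" for s
      by (cases s) (auto intro!: computes_Right' computes_Var)
  qed (use assms in auto)
  moreover have "fold (\<lambda>_. tl) (replicate m ()) zs = drop m zs"
    by (induction m arbitrary: zs) (auto simp: drop_Suc)
  ultimately show ?thesis by simp
qed

text \<open>For unary numbers, dropping \<open>b\<close> from \<open>a\<close> leaves a leaf iff
  \<open>a \<le> b\<close>; equality is this test in both directions.\<close>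

definition EqE :: "loop_expr \<Rightarrow> loop_expr \<Rightarrow> loop_expr" where
  "EqE x y = AndE (NotE (DropE x y)) (NotE (DropE y x))"

lemma computes_Not_Drop:
  assumes "computes B x env (nat_tree a)" "computes B y env (nat_tree b)" "b \<le> B"
  shows "computes B (NotE (DropE x y)) env (bool_tree (a \<le> b))"
  unfolding NotE_def
  by (rule computes_If[OF computes_Drop[OF assms(1)[unfolded nat_tree_def] assms(2,3)]])
    (use computes_True computes_Leaf in \<open>auto simp: bool_tree_def\<close>)

lemma computes_Eq:
  assumes "computes B x env (nat_tree a)" "computes B y env (nat_tree b)" "a \<le> B" "b \<le> B"
  shows "computes B (EqE x y) env (bool_tree (a = b))"
  using computes_And[OF computes_Not_Drop[OF assms(1,2,4)] computes_Not_Drop[OF assms(2,1,3)]]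
  unfolding EqE_def by (simp add: eq_iff)

definition LookE :: "loop_expr \<Rightarrow> nat \<Rightarrow> nat \<Rightarrow> loop_expr" where
  "LookE M x y = LLeft (DropE (LLeft (DropE M (LVar x))) (LVar y))"

lemma computes_nth:
  assumes "computes B a env (list_tree zs)" "computes B x env (nat_tree m)" "m \<le> B" "m < length zs"
  shows "computes B (LLeft (DropE a x)) env (zs ! m)"
  using computes_Drop[OF assms(1-3)] assms(4)
  by (auto intro!: computes_Left' simp: Cons_nth_drop_Suc[symmetric])

lemma computes_Look:
  assumes "computes B M env (matrix_tree n R)" "entry env x = nat_tree a" "entry env y = nat_tree b"
    "a < n" "b < n" "n \<le> B"
  shows "computes B (LookE M x y) env (bool_tree ((a, b) \<in> R))"
proof -
  let ?row = "\<lambda>i. map (\<lambda>j. bool_tree ((i, j) \<in> R)) [0..<n]"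
  have "computes B (LLeft (DropE M (LVar x))) env (map (\<lambda>i. list_tree (?row i)) [0..<n] ! a)"
    by (rule computes_nth) (use assms in \<open>auto simp: matrix_tree_def intro!: computes_Var\<close>)
  then have "computes B (LLeft (DropE M (LVar x))) env (list_tree (?row a))" using assms(4) by simp
  then have "computes B (LookE M x y) env (?row a ! b)"
    unfolding LookE_def by (rule computes_nth) (use assms in \<open>auto intro!: computes_Var\<close>)
  then show ?thesis using assms(5) by simp
qed

definition MemE :: "nat \<Rightarrow> loop_expr \<Rightarrow> loop_expr" where
  "MemE x l = ExE l (EqE (LVar 0) (LVar (Suc (Suc x))))"

lemma computes_Mem:
  assumes "computes B l env (nats_tree ys)" "length ys \<le> B" "set ys \<subseteq> {..<n}"
    "entry env x = nat_tree a" "a < n" "n \<le> B"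
  shows "computes B (MemE x l) env (bool_tree (a \<in> set ys))"
proof -
  have "computes B (MemE x l) env (bool_tree (\<exists>y\<in>set ys. y = a))"
    unfolding MemE_def
    by (rule computes_Ex[OF assms(1)[unfolded nats_tree_def] assms(2)])
      (use assms in \<open>auto intro!: computes_Eq computes_Var\<close>)
  then show ?thesis by simp
qed

lemma entry_numeral [simp]: "entry (x # xs) (numeral k) = entry xs (pred_numeral k)"
  by (simp add: numeral_eq_Suc)

text \<open>The instance sits in the environment from index \<open>d\<close> on; bound variables are referred to by
  their index, so all indices are shifted under a binder.\<close>

locale instance_env =
  fixes n :: nat and A \<pi> :: "nat rel" and B :: nat
  assumes bound: "A \<subseteq> {..<n} \<times> {..<n}" and symA: "sym A" and nB: "n < B"
begin

definition ctx :: "tree list \<Rightarrow> nat \<Rightarrow> bool" where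
  "ctx env d \<longleftrightarrow> entry env d = matrix_tree n A \<and> entry env (Suc d) = matrix_tree n \<pi> \<and>
     entry env (Suc (Suc d)) = nats_tree (rev [0..<n])"

definition vertex :: "tree list \<Rightarrow> nat \<Rightarrow> nat \<Rightarrow> bool" where
  "vertex env x a \<longleftrightarrow> entry env x = nat_tree a \<and> a < n"

definition vertices :: "tree list \<Rightarrow> nat \<Rightarrow> nat list \<Rightarrow> bool" where
  "vertices env l ys \<longleftrightarrow> entry env l = nats_tree ys \<and> length ys < B \<and> set ys \<subseteq> {..<n}"

lemmas env_defs = ctx_def vertex_def vertices_def

lemma computes_adj:
  "ctx env d \<Longrightarrow> vertex env x a \<Longrightarrow> vertex env y b \<Longrightarrow>
   computes B (LookE (LVar d) x y) env (bool_tree ((a, b) \<in> A))"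
  using nB by (intro computes_Look computes_Var) (auto simp: env_defs)

lemma computes_prec:
  "ctx env d \<Longrightarrow> vertex env x a \<Longrightarrow> vertex env y b \<Longrightarrow>
   computes B (LookE (LVar (Suc d)) x y) env (bool_tree ((a, b) \<in> \<pi>))"
  using nB by (intro computes_Look computes_Var) (auto simp: env_defs)

lemma computes_Ex_vertex:
  assumes "ctx env d" "\<And>y s. y < n \<Longrightarrow> computes B b (nat_tree y # s # env) (bool_tree (Q y))"
  shows "computes B (ExE (LVar (Suc (Suc d))) b) env (bool_tree (\<exists>y<n. Q y))"
proof -
  have "computes B (ExE (LVar (Suc (Suc d))) b) env (bool_tree (\<exists>y\<in>set (rev [0..<n]). Q y))"
    by (rule computes_Ex[where enc = nat_tree])
      (use assms nB in \<open>auto simp: ctx_def nats_tree_def rev_map intro!: computes_Var\<close>)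
  then show ?thesis by (simp add: Bex_def)
qed

lemma computes_mem:
  "vertices env l ys \<Longrightarrow> vertex env x a \<Longrightarrow> computes B (MemE x (LVar l)) env (bool_tree (a \<in> set ys))"
  using nB by (intro computes_Mem[of B _ env ys n x a] computes_Var) (auto simp: env_defs)

lemma computes_eq:
  "vertex env x a \<Longrightarrow> vertex env y b \<Longrightarrow> computes B (EqE (LVar x) (LVar y)) env (bool_tree (a = b))"
  using nB by (intro computes_Eq computes_Var) (auto simp: env_defs)

end

text \<open>One round of breadth-first search that keeps the vertices already found. The outer
  \<open>rev\<close> matches the order that \<open>FilterE\<close> produces.\<close>

definition reach_layer :: "nat \<Rightarrow> nat rel \<Rightarrow> nat set \<Rightarrow> nat list \<Rightarrow> nat list" where
  "reach_layer n A X T = rev (filter (\<lambda>w. w \<notin> X \<and> (w \<in> set T \<or> (\<exists>z\<in>set T. (z, w) \<in> A))) (rev [0..<n]))"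

definition reach_list :: "nat \<Rightarrow> nat rel \<Rightarrow> nat set \<Rightarrow> nat \<Rightarrow> nat list" where
  "reach_list n A X x = fold (\<lambda>_. reach_layer n A X) (rev [0..<n]) (if x \<in> X then [] else [x])"

lemma set_reach_layer:
  "set (reach_layer n A X T) = {w. w < n \<and> w \<notin> X \<and> (w \<in> set T \<or> (\<exists>z\<in>set T. (z, w) \<in> A))}"
  unfolding reach_layer_def by auto

text \<open>After \<open>m\<close> rounds, the ends of all walks with at most \<open>Suc m\<close>
  vertices have been found. A simple walk has at most \<open>n\<close> vertices, so \<open>n\<close>
  rounds suffice.\<close>

lemma reach_list_iff:
  assumes "x < n" "A \<subseteq> {..<n} \<times> {..<n}"
  shows "y \<in> set (reach_list n A X x) \<longleftrightarrow> reach A X x y"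
proof (cases "x \<in> X")
  case True
  have "set ((reach_layer n A X ^^ m) []) = {}" for m
    by (induction m) (auto simp: set_reach_layer simp del: set_empty)
  then show ?thesis using True unfolding reach_list_def fold_const reach_def by simp
next
  case False
  let ?T = "\<lambda>m. set ((reach_layer n A X ^^ m) [x])"
  have sound: "z \<in> ?T m \<Longrightarrow> reach A X x z" for m z
  proof (induction m arbitrary: z)
    case 0
    then show ?case using False by (simp add: reach_refl)
  next
    case (Suc m)
    then consider "z \<in> ?T m" | z' where "z' \<in> ?T m" "(z', z) \<in> A" "z \<notin> X"
      by (auto simp: set_reach_layer)
    then show ?case
    proof cases
      case 2
      then have r: "reach A X x z'" using Suc.IH by blast
      moreover have "reach A X z' z" using 2 reach_notin[OF r] by (intro reach_step) auto
      ultimately show ?thesis by (rule reach_trans)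
    qed (rule Suc.IH)
  qed
  have complete: "p \<noteq> [] \<Longrightarrow> hd p = x \<Longrightarrow> walk_in A p \<Longrightarrow> set p \<inter> X = {} \<Longrightarrow>
      length p \<le> Suc m \<Longrightarrow> last p \<in> ?T m" for p m
  proof (induction m arbitrary: p)
    case 0
    then show ?case by (cases p) auto
  next
    case (Suc m)
    show ?case
    proof (cases "length p = 1")
      case True
      then have "p = [x]" using Suc.prems(1,2) by (cases p) auto
      then show ?thesis using Suc.IH[of "[x]"] False assms(1) by (auto simp: set_reach_layer)
    next
      case len: False
      obtain q z where p: "p = q @ [z]" using Suc.prems(1) by (cases p rule: rev_cases) auto
      then have q: "q \<noteq> []" using len by auto
      then have "last q \<in> ?T m"
        using Suc.IH[of q] Suc.prems p by (auto simp: successively_append_iff)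
      moreover have "(last q, z) \<in> A" using Suc.prems(3) p q by (simp add: successively_append_iff)
      ultimately show ?thesis using Suc.prems(4) p assms(2) by (auto simp: set_reach_layer)
    qed
  qed
  have "y \<in> ?T n" if r: "reach A X x y"
  proof -
    obtain p where p: "p \<noteq> []" "hd p = x" "last p = y" "walk_in A p" "set p \<inter> X = {}" "distinct p"
      using reach_distinct_walk[OF r] by auto
    have "z < n" if z: "z \<in> set p" for z
    proof -
      obtain p1 p2 where s: "p = p1 @ z # p2" using z by (auto dest: split_list)
      show "z < n"
      proof (cases "p1 = []")
        case True
        then show ?thesis using s p(2) assms(1) by simp
      next
        case False
        then have "(last p1, z) \<in> A" using p(4) s by (simp add: successively_append_iff)
        then show ?thesis using assms(2) by auto
      qed
    qed
    then have "card (set p) \<le> card {..<n}" by (intro card_mono) auto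
    then have "length p \<le> n" using p(6) by (simp add: distinct_card)
    then show ?thesis using complete[OF p(1,2,4,5), of n] p(3) by simp
  qed
  then show ?thesis using sound[of y n] False unfolding reach_list_def fold_const by auto
qed

context instance_env
begin

text \<open>Every fold puts its element and its accumulator in front of the environment. Thus in the
  filter test 0 is the tested vertex \<open>w\<close> and 3 the current layer; in the innermost body
  0 is \<open>z\<close>, 2 is \<open>w\<close>, and the instance is shifted by 6.\<close>

definition ReachE :: "nat \<Rightarrow> nat \<Rightarrow> nat \<Rightarrow> nat \<Rightarrow> loop_expr" where
  "ReachE d X x y = MemE y (LFold (LVar (Suc (Suc d)))
     (LIf (MemE x (LVar X)) LLeaf (LNode (LVar x) LLeaf))
     (FilterE (LVar (Suc (Suc (Suc (Suc d)))))
       (AndE (NotE (MemE 0 (LVar (Suc (Suc (Suc (Suc X)))))))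
         (OrE (MemE 0 (LVar 3)) (ExE (LVar 3) (LookE (LVar (Suc (Suc (Suc (Suc (Suc (Suc d))))))) 0 2))))))"

lemma computes_reach:
  assumes "ctx env d" "vertices env X xs" "vertex env x a" "vertex env y b"
  shows "computes B (ReachE d X x y) env (bool_tree (reach A (set xs) a b))"
proof -
  \<comment> \<open>Layers without repetitions have at most \<open>n\<close> elements, which bounds
    the loops over them.\<close>
  let ?I = "\<lambda>T. distinct T \<and> set T \<subseteq> {..<n}"
  have len: "length T < B" if "?I T" for T
    using that nB card_mono[of "{..<n}" "set T"] by (simp add: distinct_card)
  have a: "a < n" using assms(3) by (simp add: vertex_def)
  have "?I (reach_list n A (set xs) a)"
    unfolding reach_list_def by (rule fold_invariant) (use a in \<open>auto simp: reach_layer_def\<close>)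
  then have I: "?I (reach_list n A (set xs) a)" "length (reach_list n A (set xs) a) \<le> B"
    using len[of "reach_list n A (set xs) a"] by auto
  have "computes B (ReachE d X x y) env (bool_tree (b \<in> set (reach_list n A (set xs) a)))"
    unfolding ReachE_def
  proof (rule computes_Mem[where n = n, OF _ I(2)])
    show "computes B (LFold (LVar (Suc (Suc d)))
     (LIf (MemE x (LVar X)) LLeaf (LNode (LVar x) LLeaf))
     (FilterE (LVar (Suc (Suc (Suc (Suc d)))))
       (AndE (NotE (MemE 0 (LVar (Suc (Suc (Suc (Suc X)))))))
         (OrE (MemE 0 (LVar 3)) (ExE (LVar 3) (LookE (LVar (Suc (Suc (Suc (Suc (Suc (Suc d))))))) 0 2)))))) env
      (nats_tree (reach_list n A (set xs) a))"
      unfolding reach_list_def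
    proof (rule computes_Fold[where I = ?I and enc = nat_tree])
      show "computes B (LVar (Suc (Suc d))) env (list_tree (map nat_tree (rev [0..<n])))"
        using assms(1) by (intro computes_Var) (simp add: env_defs nats_tree_def)
      show "computes B (LIf (MemE x (LVar X)) LLeaf (LNode (LVar x) LLeaf)) env
          (nats_tree (if a \<in> set xs then [] else [a]))"
        by (rule computes_If[OF computes_mem[OF assms(2,3)]])
          (use assms(3) in \<open>auto intro!: computes_Leaf computes_Node computes_Var simp: env_defs\<close>)
      fix v T assume T: "?I T"
      let ?env = "nat_tree v # nats_tree T # env"
      let ?Q = "\<lambda>w. w \<notin> set xs \<and> (w \<in> set T \<or> (\<exists>z\<in>set T. (z, w) \<in> A))"
      have "computes B (FilterE (LVar (Suc (Suc (Suc (Suc d)))))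
         (AndE (NotE (MemE 0 (LVar (Suc (Suc (Suc (Suc X)))))))
           (OrE (MemE 0 (LVar 3)) (ExE (LVar 3) (LookE (LVar (Suc (Suc (Suc (Suc (Suc (Suc d))))))) 0 2))))) ?env
         (list_tree (map nat_tree (rev (filter ?Q (rev [0..<n])))))"
      proof (rule computes_Filter)
        show "computes B (LVar (Suc (Suc (Suc (Suc d))))) ?env (list_tree (map nat_tree (rev [0..<n])))"
          using assms(1) by (intro computes_Var) (simp add: env_defs nats_tree_def)
        fix w s assume w: "w \<in> set (rev [0..<n])"
        let ?env' = "nat_tree w # s # ?env"
        have "computes B (ExE (LVar 3) (LookE (LVar (Suc (Suc (Suc (Suc (Suc (Suc d))))))) 0 2)) ?env'
            (bool_tree (\<exists>z\<in>set T. (z, w) \<in> A))"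
        proof (rule computes_Ex)
          show "computes B (LVar 3) ?env' (list_tree (map nat_tree T))"
            by (intro computes_Var) (simp add: nats_tree_def)
          show "computes B (LookE (LVar (Suc (Suc (Suc (Suc (Suc (Suc d))))))) 0 2) (nat_tree z # s # ?env')
              (bool_tree ((z, w) \<in> A))" if "z \<in> set T" for z s
            by (rule computes_adj) (use assms(1) T w that in \<open>auto simp: env_defs\<close>)
        qed (use len[OF T] in simp)
        then show "computes B (AndE (NotE (MemE 0 (LVar (Suc (Suc (Suc (Suc X)))))))
           (OrE (MemE 0 (LVar 3)) (ExE (LVar 3) (LookE (LVar (Suc (Suc (Suc (Suc (Suc (Suc d))))))) 0 2)))) ?env'
           (bool_tree (?Q w))"
          by (intro computes_And computes_Not computes_Or computes_mem)
            (use assms(2) T len[OF T] w in \<open>auto simp: env_defs\<close>)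
      qed (use nB in simp)
      then show "computes B (FilterE (LVar (Suc (Suc (Suc (Suc d)))))
         (AndE (NotE (MemE 0 (LVar (Suc (Suc (Suc (Suc X)))))))
           (OrE (MemE 0 (LVar 3)) (ExE (LVar 3) (LookE (LVar (Suc (Suc (Suc (Suc (Suc (Suc d))))))) 0 2))))) ?env
         (nats_tree (reach_layer n A (set xs) T)) \<and> ?I (reach_layer n A (set xs) T)"
        unfolding reach_layer_def nats_tree_def by auto
    qed (use nB a in auto)
  qed (use assms I nB in \<open>auto simp: env_defs\<close>)
  then show ?thesis using reach_list_iff[OF a bound] by simp
qed

definition SeparatesE :: "nat \<Rightarrow> nat \<Rightarrow> nat \<Rightarrow> nat \<Rightarrow> nat \<Rightarrow> loop_expr" where
  "SeparatesE d S a b w = OrE (EqE (LVar w) (LVar a)) (OrE (EqE (LVar w) (LVar b))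
     (AndE (ReachE d S a b)
       (NotE (LLet (LNode (LVar w) (LVar S)) (ReachE (Suc d) 0 (Suc a) (Suc b))))))"

text \<open>Inserting \<open>w\<close> into \<open>S\<close> is consing it onto the list;
  \<open>length xs + 1 < B\<close> leaves room for it.\<close>

lemma computes_separates:
  assumes "ctx env d" "vertices env S xs" "length xs + 1 < B" "vertex env a a'" "vertex env b b'" "vertex env w w'"
  shows "computes B (SeparatesE d S a b w) env (bool_tree (separates A (set xs) a' b' w'))"
proof -
  have "computes B (LLet (LNode (LVar w) (LVar S)) (ReachE (Suc d) 0 (Suc a) (Suc b))) env
      (bool_tree (reach A (set (w' # xs)) a' b'))"
  proof (rule computes_Let)
    show "computes B (LNode (LVar w) (LVar S)) env (nats_tree (w' # xs))"
      using assms by (auto simp: env_defs intro!: computes_Node computes_Var)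
  qed (rule computes_reach, use assms in \<open>auto simp: env_defs\<close>)
  then show ?thesis
    unfolding SeparatesE_def separates_def using assms
    by (intro computes_Or computes_And computes_Not computes_eq computes_reach) auto
qed

definition AllowedE :: "nat \<Rightarrow> nat \<Rightarrow> nat \<Rightarrow> nat \<Rightarrow> nat \<Rightarrow> loop_expr" where
  "AllowedE d S b u w = AndE (LookE (LVar d) u w) (OrE (EqE (LVar w) (LVar b))
     (AndE (NotE (MemE u (LVar S))) (LLet (LNode (LVar u) (LVar S)) (ReachE (Suc d) 0 (Suc w) (Suc b)))))"

lemma computes_allowed:
  assumes "ctx env d" "vertices env S xs" "length xs + 1 < B" "vertex env b b'" "vertex env u u'" "vertex env w w'"
  shows "computes B (AllowedE d S b u w) env (bool_tree (allowed A (set xs) b' u' w'))"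
proof -
  have "computes B (LLet (LNode (LVar u) (LVar S)) (ReachE (Suc d) 0 (Suc w) (Suc b))) env
      (bool_tree (reach A (set (u' # xs)) w' b'))"
  proof (rule computes_Let)
    show "computes B (LNode (LVar u) (LVar S)) env (nats_tree (u' # xs))"
      using assms by (auto simp: env_defs intro!: computes_Node computes_Var)
  qed (rule computes_reach, use assms in \<open>auto simp: env_defs\<close>)
  then show ?thesis
    unfolding AllowedE_def allowed_def using assms
    by (intro computes_Or computes_And computes_Not computes_eq computes_adj computes_mem) auto
qed

definition AvailableE :: "nat \<Rightarrow> nat \<Rightarrow> nat \<Rightarrow> loop_expr" where
  "AvailableE d Q w = NotE (ExE (LVar (Suc (Suc d)))
     (AndE (LookE (LVar (Suc (Suc (Suc d)))) 0 (Suc (Suc w)))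
       (AndE (NotE (EqE (LVar 0) (LVar (Suc (Suc w))))) (NotE (MemE 0 (LVar (Suc (Suc Q))))))))"

lemma computes_available:
  assumes "ctx env d" "vertices env Q q" "vertex env w w'"
  shows "computes B (AvailableE d Q w) env (bool_tree (available n \<pi> (set q) w'))"
proof -
  have "computes B (AvailableE d Q w) env (bool_tree (\<not> (\<exists>z<n. (z, w') \<in> \<pi> \<and> z \<noteq> w' \<and> z \<notin> set q)))"
    unfolding AvailableE_def using assms
    by (intro computes_Not computes_Ex_vertex computes_And computes_prec computes_eq computes_mem)
      (auto simp: env_defs)
  moreover have "(\<not> (\<exists>z<n. (z, w') \<in> \<pi> \<and> z \<noteq> w' \<and> z \<notin> set q)) = available n \<pi> (set q) w'"
    unfolding available_def by auto
  ultimately show ?thesis by simp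
qed

text \<open>The accumulator is the pair of the previous anchor and the answer so far, since the
  condition concerns consecutive anchors.\<close>

definition ReservedE :: "nat \<Rightarrow> nat \<Rightarrow> nat \<Rightarrow> nat \<Rightarrow> loop_expr" where
  "ReservedE d S L w = LRight (LFold (LRight (LVar L))
     (LNode (LLeft (LVar L)) (EqE (LVar w) (LLeft (LVar L))))
     (LLet (LLeft (LVar 1)) (LNode (LVar 1) (OrE (LRight (LVar 2))
       (SeparatesE (Suc (Suc (Suc d))) (Suc (Suc (Suc S))) 0 1 (Suc (Suc (Suc w))))))))"

lemma computes_reserved:
  assumes "ctx env d" "vertices env S xs" "length xs + 1 < B" "vertices env L (l # ls)" "vertex env w w'"
  shows "computes B (ReservedE d S L w) env (bool_tree (reserved A (set xs) (l # ls) w'))"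
proof -
  let ?f = "\<lambda>b (a, r). (b, r \<or> separates A (set xs) a b w')"
  let ?enc = "\<lambda>(a, r). Node (nat_tree a) (bool_tree r)"
  have L: "entry env L = Node (nat_tree l) (nats_tree ls)" "l < n" "set ls \<subseteq> {..<n}" "length ls \<le> B"
    using assms(4) by (auto simp: env_defs)
  have "computes B (LFold (LRight (LVar L))
     (LNode (LLeft (LVar L)) (EqE (LVar w) (LLeft (LVar L))))
     (LLet (LLeft (LVar 1)) (LNode (LVar 1) (OrE (LRight (LVar 2))
       (SeparatesE (Suc (Suc (Suc d))) (Suc (Suc (Suc S))) 0 1 (Suc (Suc (Suc w)))))))) env
     (?enc (fold ?f ls (l, w' = l)))"
  proof (rule computes_Fold[where I = "\<lambda>(a, r). a < n" and enc = nat_tree])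
    show "computes B (LRight (LVar L)) env (list_tree (map nat_tree ls))"
      using L(1) by (intro computes_Right'[OF computes_Var]) (auto simp: nats_tree_def)
    show "computes B (LNode (LLeft (LVar L)) (EqE (LVar w) (LLeft (LVar L)))) env (?enc (l, w' = l))"
      using L assms(5) nB
      by (auto intro!: computes_Node computes_Eq computes_Left'[OF computes_Var] computes_Var simp: env_defs)
    fix b and s :: "nat \<times> bool" assume b: "b \<in> set ls" and s: "case s of (a, r) \<Rightarrow> a < n"
    obtain a r where ar: "s = (a, r)" by (cases s)
    let ?env = "nat_tree a # nat_tree b # ?enc s # env"
    have "computes B (SeparatesE (Suc (Suc (Suc d))) (Suc (Suc (Suc S))) 0 1 (Suc (Suc (Suc w)))) ?env
        (bool_tree (separates A (set xs) a b w'))"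
      by (rule computes_separates) (use assms L b s ar in \<open>auto simp: env_defs\<close>)
    moreover have "computes B (LRight (LVar 2)) ?env (bool_tree r)"
      unfolding ar by (rule computes_Right'[OF computes_Var]) auto
    ultimately have "computes B (LNode (LVar 1) (OrE (LRight (LVar 2))
       (SeparatesE (Suc (Suc (Suc d))) (Suc (Suc (Suc S))) 0 1 (Suc (Suc (Suc w)))))) ?env
       (?enc (?f b s))"
      unfolding ar by (auto intro!: computes_Node computes_Or computes_Var)
    moreover have "computes B (LLeft (LVar 1)) (nat_tree b # ?enc s # env) (nat_tree a)"
      unfolding ar by (rule computes_Left'[OF computes_Var]) auto
    ultimately show "computes B (LLet (LLeft (LVar 1)) (LNode (LVar 1) (OrE (LRight (LVar 2))
       (SeparatesE (Suc (Suc (Suc d))) (Suc (Suc (Suc S))) 0 1 (Suc (Suc (Suc w)))))))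
       (nat_tree b # ?enc s # env) (?enc (?f b s)) \<and> (case ?f b s of (a, r) \<Rightarrow> a < n)"
      using L(3) b unfolding ar by (auto intro: computes_Let)
  qed (use L in auto)
  \<comment> \<open>A lone anchor counts only through the start value \<open>r\<close>; the last
    anchor of a longer list is covered as an end of its pair.\<close>
  moreover have "snd (fold ?f ls (a, r)) \<longleftrightarrow> r \<or> (ls \<noteq> [] \<and> reserved A (set xs) (a # ls) w')" for a r
  proof (induction ls arbitrary: a r)
    case (Cons b ls)
    have "reserved A (set xs) [b] w' \<Longrightarrow> separates A (set xs) a b w'" by (simp add: separates_def)
    then show ?case using Cons.IH[of b "r \<or> separates A (set xs) a b w'"] by (cases ls) auto
  qed simp
  then have "snd (fold ?f ls (l, w' = l)) \<longleftrightarrow> reserved A (set xs) (l # ls) w'"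
    using reserved_hd[of A "set xs" l ls] by (cases ls) auto
  ultimately show ?thesis unfolding ReservedE_def
    by (auto intro!: computes_Right' split: prod.splits)
qed

definition CandidateE :: "nat \<Rightarrow> nat \<Rightarrow> nat \<Rightarrow> nat \<Rightarrow> nat \<Rightarrow> loop_expr" where
  "CandidateE d S b q w = AndE (NotE (MemE w (LVar q))) (AndE (AvailableE d q w)
     (LLet (LLeft (LVar q)) (AllowedE (Suc d) (Suc S) (Suc b) 0 (Suc w))))"

lemma computes_candidate:
  assumes "ctx env d" "vertices env S xs" "length xs + 1 < B" "vertex env b b'" "vertices env q qs" "qs \<noteq> []"
    "vertex env w w'"
  shows "computes B (CandidateE d S b q w) env (bool_tree (candidate n A \<pi> (set xs) b' qs w'))"
proof -
  have hd: "hd qs \<in> {..<n}" using assms(5,6) hd_in_set[of qs] unfolding vertices_def by blast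
  have "computes B (LLet (LLeft (LVar q)) (AllowedE (Suc d) (Suc S) (Suc b) 0 (Suc w))) env
      (bool_tree (allowed A (set xs) b' (hd qs) w'))"
    by (rule computes_Let[where y = "nat_tree (hd qs)"],
        rule computes_Left'[OF computes_Var[OF refl]], use assms in \<open>cases qs; simp add: env_defs\<close>,
        rule computes_allowed)
      (use assms hd in \<open>auto simp: env_defs\<close>)
  then show ?thesis unfolding CandidateE_def candidate_def
    using assms by (intro computes_And computes_Not computes_mem computes_available) auto
qed

text \<open>The index \<open>d'\<close> has two meanings: outside the loop body it is the position
  of the vertex list, inside it is the position of the shifted instance.\<close>

definition StepE :: "nat \<Rightarrow> nat \<Rightarrow> nat \<Rightarrow> nat \<Rightarrow> nat \<Rightarrow> nat \<Rightarrow> loop_expr" where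
  "StepE d S L a b q = (let
      S' = Suc (Suc S); d' = Suc (Suc d); L' = Suc (Suc L); a' = Suc (Suc a); b' = Suc (Suc b); q' = Suc (Suc q);
      extend = (\<lambda>c init. LFold (LVar d') init
        (LIf (AndE (CandidateE d' S' b' q' 0) c) (LNode (LVar 0) (LVar q')) (LVar 1)))
    in extend (NotE (ReservedE d' S' L' 0)) (extend (SeparatesE d' S' a' b' 0) (LVar q)))"

lemma computes_extend:
  assumes "ctx env d" "entry env q = nats_tree qs" "computes B init env (nats_tree r)"
    "\<And>w s. w < n \<Longrightarrow> computes B c (nat_tree w # s # env) (bool_tree (Q w))"
  shows "computes B (LFold (LVar (Suc (Suc d))) init (LIf c (LNode (LVar 0) (LVar (Suc (Suc q)))) (LVar 1))) env
      (nats_tree (extend_by n Q qs r))"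
  unfolding extend_by_def
proof (rule computes_Fold[where I = "\<lambda>_. True" and enc = nat_tree])
  show "computes B (LVar (Suc (Suc d))) env (list_tree (map nat_tree (rev [0..<n])))"
    using assms(1) by (intro computes_Var) (simp add: env_defs nats_tree_def)
  show "computes B (LIf c (LNode (LVar 0) (LVar (Suc (Suc q)))) (LVar 1)) (nat_tree w # nats_tree s # env)
     (nats_tree (if Q w then w # qs else s)) \<and> True" if "w \<in> set (rev [0..<n])" for w s
    by (rule conjI, rule computes_If[OF assms(4)])
      (use that assms(2) in \<open>auto intro!: computes_Node computes_Var\<close>)
qed (use nB assms(3) in auto)

lemma computes_step:
  assumes "ctx env d" "vertices env S xs" "length xs + 1 < B" "vertices env L (l # ls)"
    "vertex env a a'" "vertex env b b'" "vertices env q qs" "qs \<noteq> []"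
  shows "computes B (StepE d S L a b q) env (nats_tree (greedy_step n A \<pi> (set xs) (l # ls) a' b' qs))"
  unfolding StepE_def Let_def greedy_step_def
  using assms
  by (intro computes_extend computes_And computes_candidate computes_Not computes_reserved
      computes_separates computes_Var) (auto simp: env_defs)

end

text \<open>The part of \<open>partial_path\<close> that survives for every guess, even if its first
  vertex is not minimal in the order. It bounds the lengths of all paths that occur.\<close>

definition proper :: "nat \<Rightarrow> nat list \<Rightarrow> bool" where
  "proper n q \<longleftrightarrow> q \<noteq> [] \<and> distinct q \<and> set q \<subseteq> {..<n}"

lemma proper_length: "proper n q \<Longrightarrow> length q \<le> n"
  using card_mono[of "{..<n}" "set q"] unfolding proper_def by (simp add: distinct_card)

lemma proper_greedy_step: "proper n q \<Longrightarrow> proper n (greedy_step n A \<pi> S L a b q)"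
  by (cases rule: greedy_step_cases[of n A \<pi> S L a b q]) (auto simp: proper_def candidate_def)

lemma proper_greedy_segment: "proper n q \<Longrightarrow> proper n (greedy_segment n A \<pi> S L b q)"
  unfolding greedy_segment_def by (rule fold_invariant) (auto intro: proper_greedy_step)

lemma proper_greedy_path: "hd L < n \<Longrightarrow> proper n (greedy_path n A \<pi> S L)"
  unfolding greedy_path_def
  by (rule fold_invariant[where I = "proper n"], simp add: proper_def, rule proper_greedy_segment)

context instance_env
begin

lemma vertices_proper: "proper n q \<Longrightarrow> entry env i = nats_tree q \<Longrightarrow> vertices env i q"
  using proper_length[of n q] nB unfolding proper_def vertices_def by simp

definition SegmentE :: "nat \<Rightarrow> nat \<Rightarrow> nat \<Rightarrow> nat \<Rightarrow> nat \<Rightarrow> loop_expr" where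
  "SegmentE d S L b q = LLet (LLeft (LVar q)) (LFold (LVar (Suc (Suc (Suc d)))) (LVar (Suc q))
     (StepE (Suc (Suc (Suc d))) (Suc (Suc (Suc S))) (Suc (Suc (Suc L))) 2 (Suc (Suc (Suc b))) 1))"

lemma computes_segment:
  assumes "ctx env d" "vertices env S xs" "length xs + 1 < B" "vertices env L (l # ls)"
    "vertex env b b'" "entry env q = nats_tree qs" "proper n qs"
  shows "computes B (SegmentE d S L b q) env (nats_tree (greedy_segment n A \<pi> (set xs) (l # ls) b' qs))"
  unfolding SegmentE_def greedy_segment_def
proof (rule computes_Let)
  obtain a qs' where qs: "qs = a # qs'" using assms(7) by (cases qs) (auto simp: proper_def)
  have a: "a < n" using assms(7) qs by (auto simp: proper_def)
  show "computes B (LLeft (LVar q)) env (nat_tree (hd qs))"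
    by (rule computes_Left'[OF computes_Var[OF refl]]) (use assms qs in simp)
  show "computes B (LFold (LVar (Suc (Suc (Suc d)))) (LVar (Suc q))
     (StepE (Suc (Suc (Suc d))) (Suc (Suc (Suc S))) (Suc (Suc (Suc L))) 2 (Suc (Suc (Suc b))) 1))
     (nat_tree (hd qs) # env)
     (nats_tree (fold (\<lambda>_. greedy_step n A \<pi> (set xs) (l # ls) (hd qs) b') (rev [0..<n]) qs))"
  proof (rule computes_Fold[where I = "proper n" and enc = nat_tree])
    show "computes B (LVar (Suc (Suc (Suc d)))) (nat_tree (hd qs) # env) (list_tree (map nat_tree (rev [0..<n])))"
      using assms(1) by (intro computes_Var) (simp add: env_defs nats_tree_def)
    show "computes B (LVar (Suc q)) (nat_tree (hd qs) # env) (nats_tree qs)"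
      using assms by (intro computes_Var) simp
    show "computes B (StepE (Suc (Suc (Suc d))) (Suc (Suc (Suc S))) (Suc (Suc (Suc L))) 2 (Suc (Suc (Suc b))) 1)
        (nat_tree y # nats_tree s # nat_tree (hd qs) # env)
        (nats_tree (greedy_step n A \<pi> (set xs) (l # ls) (hd qs) b' s)) \<and>
      proper n (greedy_step n A \<pi> (set xs) (l # ls) (hd qs) b' s)"
      if "proper n s" for y s
    proof
      show "computes B (StepE (Suc (Suc (Suc d))) (Suc (Suc (Suc S))) (Suc (Suc (Suc L))) 2 (Suc (Suc (Suc b))) 1)
        (nat_tree y # nats_tree s # nat_tree (hd qs) # env)
        (nats_tree (greedy_step n A \<pi> (set xs) (l # ls) (hd qs) b' s))"
      proof (rule computes_step)
        show "vertices (nat_tree y # nats_tree s # nat_tree (hd qs) # env) 1 s"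
          by (rule vertices_proper[OF that]) simp
        show "s \<noteq> []" using that by (simp add: proper_def)
      qed (use assms(1-5) a qs in \<open>auto simp: env_defs\<close>)
    qed (rule proper_greedy_step[OF that])
  qed (use nB assms(7) in auto)
qed

definition PathE :: "nat \<Rightarrow> nat \<Rightarrow> nat \<Rightarrow> loop_expr" where
  "PathE d S L = LFold (LRight (LVar L)) (LNode (LLeft (LVar L)) LLeaf)
     (SegmentE (Suc (Suc d)) (Suc (Suc S)) (Suc (Suc L)) 0 1)"

lemma computes_path:
  assumes "ctx env d" "vertices env S xs" "length xs + 1 < B" "vertices env L (l # ls)"
  shows "computes B (PathE d S L) env (nats_tree (greedy_path n A \<pi> (set xs) (l # ls)))"
proof -
  have L: "entry env L = Node (nat_tree l) (nats_tree ls)" "l < n" "set ls \<subseteq> {..<n}" "length ls \<le> B"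
    using assms(4) by (auto simp: env_defs)
  have "computes B (PathE d S L) env
     (nats_tree (fold (greedy_segment n A \<pi> (set xs) (l # ls)) ls [l]))"
    unfolding PathE_def
  proof (rule computes_Fold[where I = "proper n" and enc = nat_tree])
    show "computes B (LRight (LVar L)) env (list_tree (map nat_tree ls))"
      using L(1) by (intro computes_Right'[OF computes_Var]) (auto simp: nats_tree_def)
    show "computes B (LNode (LLeft (LVar L)) LLeaf) env (nats_tree [l])"
      using L(1) by (auto intro!: computes_Node computes_Leaf computes_Left'[OF computes_Var])
    show "computes B (SegmentE (Suc (Suc d)) (Suc (Suc S)) (Suc (Suc L)) 0 1) (nat_tree b # nats_tree q # env)
        (nats_tree (greedy_segment n A \<pi> (set xs) (l # ls) b q)) \<and>
        proper n (greedy_segment n A \<pi> (set xs) (l # ls) b q)"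
      if "b \<in> set ls" "proper n q" for b q
      by (rule conjI[OF computes_segment proper_greedy_segment])
        (use assms L(3) that in \<open>auto simp: env_defs\<close>)
  qed (use L in \<open>auto simp: proper_def\<close>)
  then show ?thesis by (simp add: greedy_path_def)
qed

text \<open>Using the list of anchors as a condition tests that it is nonempty. The binding of
  \<open>LLeaf\<close> provides the empty set of visited vertices for the first vertex.\<close>

definition AcceptsE :: "bool \<Rightarrow> nat \<Rightarrow> nat \<Rightarrow> nat \<Rightarrow> loop_expr" where
  "AcceptsE cyc d S L = AndE (LVar L) (LLet (LLeft (LVar L))
     (AndE (LLet LLeaf (AvailableE (Suc (Suc d)) 0 1))
       (LLet (PathE (Suc d) (Suc S) (Suc L))
         (AndE (NotE (ExE (LVar (Suc (Suc (Suc (Suc d))))) (NotE (MemE 0 (LVar 2)))))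
           (if cyc then LLet (LLeft (LVar 0)) (LookE (LVar (Suc (Suc (Suc d)))) 2 0) else TrueE)))))"

lemma computes_accepts:
  assumes "ctx env d" "vertices env S xs" "length xs + 1 < B" "vertices env L ls"
  shows "computes B (AcceptsE cyc d S L) env (bool_tree (accepts n A \<pi> cyc (set xs) ls))"
proof (cases ls)
  case Nil
  then have "entry env L = Leaf" using assms(4) by (simp add: env_defs)
  then show ?thesis unfolding AcceptsE_def AndE_def
    using Nil by (intro computes_If[OF computes_Var]) (auto simp: accepts_def bool_tree_def intro: computes_Leaf)
next
  case (Cons l ls')
  let ?q = "greedy_path n A \<pi> (set xs) ls"
  let ?env = "nat_tree l # env" and ?env' = "nats_tree ?q # nat_tree l # env"
  have L: "entry env L = Node (nat_tree l) (nats_tree ls')" "l < n"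
    using assms(4) Cons by (auto simp: env_defs)
  have q: "proper n ?q" using proper_greedy_path[of ls n] Cons L(2) by simp
  obtain h q' where hq: "?q = h # q'" using q by (cases ?q) (auto simp: proper_def)
  have h: "h < n" using q hq by (auto simp: proper_def)
  have vq: "vertices (x # y # ?env') 2 ?q" for x y by (rule vertices_proper[OF q]) simp
  have "computes B (LLet (LLeft (LVar 0)) (LookE (LVar (Suc (Suc (Suc d)))) 2 0)) ?env'
      (bool_tree ((l, h) \<in> A))"
  proof (rule computes_Let)
    show "computes B (LLeft (LVar 0)) ?env' (nat_tree h)"
      by (rule computes_Left'[OF computes_Var[OF refl]]) (simp add: hq)
    show "computes B (LookE (LVar (Suc (Suc (Suc d)))) 2 0) (nat_tree h # ?env') (bool_tree ((l, h) \<in> A))"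
      by (rule computes_adj) (use assms(1) L h in \<open>auto simp: env_defs\<close>)
  qed
  then have cyc: "computes B (if cyc then LLet (LLeft (LVar 0)) (LookE (LVar (Suc (Suc (Suc d)))) 2 0) else TrueE) ?env'
      (bool_tree (cyc \<longrightarrow> (hd ls, hd ?q) \<in> A))"
    using computes_True Cons hq by simp
  have "computes B (NotE (ExE (LVar (Suc (Suc (Suc (Suc d))))) (NotE (MemE 0 (LVar 2))))) ?env'
      (bool_tree (\<not> (\<exists>z<n. z \<notin> set ?q)))"
    by (intro computes_Not computes_Ex_vertex computes_mem vq) (use assms(1) in \<open>auto simp: env_defs\<close>)
  moreover have "(\<not> (\<exists>z<n. z \<notin> set ?q)) \<longleftrightarrow> {..<n} \<subseteq> set ?q" by auto
  ultimately have ham: "computes B (NotE (ExE (LVar (Suc (Suc (Suc (Suc d))))) (NotE (MemE 0 (LVar 2))))) ?env'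
      (bool_tree ({..<n} \<subseteq> set ?q))" by simp
  have path: "computes B (PathE (Suc d) (Suc S) (Suc L)) ?env (nats_tree ?q)"
    unfolding Cons by (rule computes_path) (use assms Cons in \<open>auto simp: env_defs\<close>)
  have "computes B (LLet LLeaf (AvailableE (Suc (Suc d)) 0 1)) ?env (bool_tree (available n \<pi> (set []) l))"
  proof (rule computes_Let[OF computes_Leaf])
    show "computes B (AvailableE (Suc (Suc d)) 0 1) (Leaf # ?env) (bool_tree (available n \<pi> (set []) l))"
      by (rule computes_available) (use assms(1) L nB in \<open>auto simp: env_defs\<close>)
  qed
  then have "computes B (AndE (LLet LLeaf (AvailableE (Suc (Suc d)) 0 1))
       (LLet (PathE (Suc d) (Suc S) (Suc L))
         (AndE (NotE (ExE (LVar (Suc (Suc (Suc (Suc d))))) (NotE (MemE 0 (LVar 2)))))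
           (if cyc then LLet (LLeft (LVar 0)) (LookE (LVar (Suc (Suc (Suc d)))) 2 0) else TrueE)))) ?env
       (bool_tree (available n \<pi> (set []) l \<and> {..<n} \<subseteq> set ?q \<and> (cyc \<longrightarrow> (hd ls, hd ?q) \<in> A)))"
    by (intro computes_And computes_Let[OF path] ham cyc)
  moreover have "(available n \<pi> (set []) l \<and> {..<n} \<subseteq> set ?q \<and> (cyc \<longrightarrow> (hd ls, hd ?q) \<in> A)) =
      accepts n A \<pi> cyc (set xs) ls"
    unfolding accepts_def using Cons by simp
  ultimately show ?thesis unfolding AcceptsE_def AndE_def[of "LVar L"]
    by (intro computes_If[OF computes_Var[OF L(1)]] computes_Let[OF computes_Left'[OF computes_Var[OF L(1)]]]) auto
qed

definition ClosedE :: "nat \<Rightarrow> nat \<Rightarrow> loop_expr" where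
  "ClosedE d S = NotE (ExE (LVar (Suc (Suc d))) (AndE (NotE (MemE 0 (LVar (Suc (Suc S)))))
     (ExE (LVar (Suc (Suc (Suc (Suc d))))) (AndE (LookE (LVar (Suc (Suc (Suc (Suc d))))) 2 0)
       (ExE (LVar (Suc (Suc (Suc (Suc (Suc (Suc d)))))))
         (AndE (LookE (LVar (Suc (Suc (Suc (Suc (Suc (Suc d))))))) 4 0)
         (AndE (NotE (EqE (LVar 2) (LVar 0)))
         (AndE (LLet (LNode (LVar 4) (LVar (Suc (Suc (Suc (Suc (Suc (Suc S))))))))
             (ReachE (Suc (Suc (Suc (Suc (Suc (Suc (Suc d))))))) 0 3 1))
           (NotE (LookE (LVar (Suc (Suc (Suc (Suc (Suc (Suc d))))))) 2 0))))))))))"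

lemma computes_closed:
  assumes "ctx env d" "vertices env S xs" "length xs + 1 < B"
  shows "computes B (ClosedE d S) env (bool_tree (block_closed A (set xs)))"
proof -
  have reach: "computes B (LLet (LNode (LVar 4) (LVar (Suc (Suc (Suc (Suc (Suc (Suc S))))))))
             (ReachE (Suc (Suc (Suc (Suc (Suc (Suc (Suc d))))))) 0 3 1))
       (nat_tree y # s # nat_tree x # s' # nat_tree u # s'' # env)
       (bool_tree (reach A (set (u # xs)) x y))" if "u < n" "x < n" "y < n" for u x y s s' s''
  proof (rule computes_Let)
    show "computes B (LNode (LVar 4) (LVar (Suc (Suc (Suc (Suc (Suc (Suc S))))))))
      (nat_tree y # s # nat_tree x # s' # nat_tree u # s'' # env) (nats_tree (u # xs))"
      using assms by (auto simp: env_defs intro!: computes_Node computes_Var)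
  qed (rule computes_reach, use assms that in \<open>auto simp: env_defs\<close>)
  have "computes B (ClosedE d S) env (bool_tree (\<not> (\<exists>u<n. u \<notin> set xs \<and> (\<exists>x<n. (u, x) \<in> A \<and>
      (\<exists>y<n. (u, y) \<in> A \<and> x \<noteq> y \<and> reach A (set (u # xs)) x y \<and> (x, y) \<notin> A)))))"
    unfolding ClosedE_def
    by (intro computes_Not computes_Ex_vertex computes_And computes_mem computes_adj computes_eq reach)
      (use assms in \<open>auto simp: env_defs\<close>)
  moreover have "(\<not> (\<exists>u<n. u \<notin> set xs \<and> (\<exists>x<n. (u, x) \<in> A \<and>
      (\<exists>y<n. (u, y) \<in> A \<and> x \<noteq> y \<and> reach A (set (u # xs)) x y \<and> (x, y) \<notin> A)))) \<longleftrightarrow>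
    block_closed A (set xs)"
    using bound unfolding block_closed_def by auto
  ultimately show ?thesis by simp
qed

end

section \<open>Enumeration of deletion sets and anchor sequences\<close>

definition extend_lists :: "nat \<Rightarrow> nat list list \<Rightarrow> nat list list" where
  "extend_lists n Ls = fold (\<lambda>L acc. fold (\<lambda>v acc. (v # L) # acc) (rev [0..<n]) acc) Ls Ls"

definition lists_upto :: "nat \<Rightarrow> nat \<Rightarrow> nat list list" where
  "lists_upto n m = (extend_lists n ^^ m) [[]]"

lemma fold_Cons_map: "fold (\<lambda>v acc. f v # acc) xs acc = rev (map f xs) @ acc"
  by (induction xs arbitrary: acc) auto

lemma set_length_extend_lists:
  "set (extend_lists n Ls) = set Ls \<union> {v # L |v L. v < n \<and> L \<in> set Ls} \<and>
   length (extend_lists n Ls) = length Ls * Suc n"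
proof -
  have "set (fold (\<lambda>L acc. fold (\<lambda>v acc. (v # L) # acc) (rev [0..<n]) acc) Ks acc) =
      set acc \<union> {v # L |v L. v < n \<and> L \<in> set Ks} \<and>
    length (fold (\<lambda>L acc. fold (\<lambda>v acc. (v # L) # acc) (rev [0..<n]) acc) Ks acc) =
      length acc + length Ks * n" for Ks acc
    unfolding fold_Cons_map by (induction Ks arbitrary: acc) auto
  then show ?thesis unfolding extend_lists_def by simp
qed

lemma set_lists_upto: "set (lists_upto n m) = {L. set L \<subseteq> {..<n} \<and> length L \<le> m}"
proof (induction m)
  case 0
  then show ?case by (auto simp: lists_upto_def)
next
  case (Suc m)
  have "L \<in> set (lists_upto n (Suc m)) \<longleftrightarrow> set L \<subseteq> {..<n} \<and> length L \<le> Suc m" for L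
    using Suc set_length_extend_lists[of n "lists_upto n m"]
    by (cases L) (auto simp: lists_upto_def)
  then show ?case by blast
qed

lemma length_lists_upto: "length (lists_upto n m) = Suc n ^ m"
  by (induction m) (auto simp: lists_upto_def set_length_extend_lists)

definition lists_tree :: "nat list list \<Rightarrow> tree" where
  "lists_tree Ls = list_tree (map nats_tree Ls)"

context instance_env
begin

definition ExtendListsE :: "nat \<Rightarrow> nat \<Rightarrow> loop_expr" where
  "ExtendListsE d l = LFold (LVar l) (LVar l)
     (LFold (LVar (Suc (Suc (Suc (Suc d))))) (LVar 1) (LNode (LNode (LVar 0) (LVar 2)) (LVar 1)))"

lemma computes_extend_lists:
  assumes "ctx env d" "entry env l = lists_tree Ls" "length Ls \<le> B"
  shows "computes B (ExtendListsE d l) env (lists_tree (extend_lists n Ls))"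
  unfolding ExtendListsE_def extend_lists_def
proof (rule computes_Fold[where I = "\<lambda>_. True" and enc = nats_tree])
  show "computes B (LVar l) env (list_tree (map nats_tree Ls))"
    using assms(2) by (intro computes_Var) (simp add: lists_tree_def)
  show "computes B (LVar l) env (lists_tree Ls)" using assms(2) by (rule computes_Var)
  fix L acc
  have "computes B (LFold (LVar (Suc (Suc (Suc (Suc d))))) (LVar 1) (LNode (LNode (LVar 0) (LVar 2)) (LVar 1)))
      (nats_tree L # lists_tree acc # env)
      (lists_tree (fold (\<lambda>v acc. (v # L) # acc) (rev [0..<n]) acc))"
  proof (rule computes_Fold[where I = "\<lambda>_. True" and enc = nat_tree])
    show "computes B (LVar (Suc (Suc (Suc (Suc d))))) (nats_tree L # lists_tree acc # env)
        (list_tree (map nat_tree (rev [0..<n])))"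
      using assms(1) by (intro computes_Var) (simp add: env_defs nats_tree_def)
    show "computes B (LNode (LNode (LVar 0) (LVar 2)) (LVar 1))
        (nat_tree v # lists_tree acc' # nats_tree L # lists_tree acc # env) (lists_tree ((v # L) # acc')) \<and> True"
      for v acc'
      by (auto simp: lists_tree_def intro!: computes_Node computes_Var)
  qed (use nB in \<open>auto intro: computes_Var\<close>)
  then show "computes B (LFold (LVar (Suc (Suc (Suc (Suc d))))) (LVar 1) (LNode (LNode (LVar 0) (LVar 2)) (LVar 1)))
      (nats_tree L # lists_tree acc # env)
      (lists_tree (fold (\<lambda>v acc. (v # L) # acc) (rev [0..<n]) acc)) \<and> True" by simp
qed (use assms in auto)

text \<open>After \<open>t\<close> unsuccessful rounds the state holds all lists of length at most
  \<open>t\<close> as deletion sets and all of length at most \<open>3 * t + 2\<close> as anchors,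
  hence three extensions of the latter per round. Once one deletion set passes the test, all listed
  sets are tried; the others are harmless because acceptance is always sound.\<close>

fun search_step :: "bool \<Rightarrow> bool option \<times> nat list list \<times> nat list list \<Rightarrow>
    bool option \<times> nat list list \<times> nat list list" where
  "search_step cyc (Some r, Ss, Ls) = (Some r, Ss, Ls)"
| "search_step cyc (None, Ss, Ls) = (if \<exists>S\<in>set Ss. block_closed A (set S)
     then (Some (\<exists>S\<in>set Ss. \<exists>L\<in>set Ls. accepts n A \<pi> cyc (set S) L), Ss, Ls)
     else (None, extend_lists n Ss, extend_lists n (extend_lists n (extend_lists n Ls))))"

fun search_tree :: "bool option \<times> nat list list \<times> nat list list \<Rightarrow> tree" where
  "search_tree (r, Ss, Ls) =
     Node (case r of None \<Rightarrow> Leaf | Some b \<Rightarrow> Node (bool_tree b) Leaf) (Node (lists_tree Ss) (lists_tree Ls))"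

definition SearchStepE :: "bool \<Rightarrow> loop_expr" where
  "SearchStepE cyc = LIf (LLeft (LVar 1)) (LVar 1)
     (LLet (LLeft (LRight (LVar 1))) (LLet (LRight (LRight (LVar 2)))
       (LIf (ExE (LVar 1) (ClosedE 6 0))
         (LNode (LNode (ExE (LVar 1) (ExE (LVar 2) (AcceptsE cyc 8 2 0))) LLeaf) (LNode (LVar 1) (LVar 0)))
         (LNode LLeaf (LNode (ExtendListsE 4 1)
           (LLet (ExtendListsE 4 0) (LLet (ExtendListsE 5 0) (ExtendListsE 6 0))))))))"

lemma ctx_shift:
  "ctx env 0 \<Longrightarrow> ctx (x # y # x1 # x2 # env) 4"
  "ctx env 0 \<Longrightarrow> ctx (x3 # x # y # x1 # x2 # env) 5"
  "ctx env 0 \<Longrightarrow> ctx (x4 # x3 # x # y # x1 # x2 # env) 6"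
  "ctx env 0 \<Longrightarrow> ctx (x6 # x5 # x4 # x3 # x # y # x1 # x2 # env) 8"
  by (simp_all add: env_defs numeral_eq_Suc)

text \<open>The third extension loops over a list already extended twice, hence the factor
  \<open>Suc n * Suc n\<close>. If the search stops in this round, no list is extended and the
  weaker bound suffices.\<close>

lemma computes_search_step:
  assumes ctx: "ctx env 0"
    and Ss: "length Ss \<le> B" "\<forall>S\<in>set Ss. set S \<subseteq> {..<n} \<and> length S + 1 < B"
    and Ls: "length Ls * Suc n * Suc n \<le> B \<or> (\<exists>S\<in>set Ss. block_closed A (set S)) \<and> length Ls \<le> B"
      "\<forall>L\<in>set Ls. set L \<subseteq> {..<n} \<and> length L < B"
  shows "computes B (SearchStepE cyc) (x # search_tree (r, Ss, Ls) # env)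
    (search_tree (search_step cyc (r, Ss, Ls)))"
proof (cases r)
  case (Some b)
  have "computes B (LLeft (LVar 1)) (x # search_tree (r, Ss, Ls) # env) (Node (bool_tree b) Leaf)"
    by (rule computes_Left'[OF computes_Var[OF refl]]) (simp add: Some)
  then show ?thesis unfolding SearchStepE_def
    by (rule computes_If) (auto simp: Some intro: computes_Var)
next
  case None
  have LsB: "length Ls \<le> B" using Ls(1) by auto
  let ?st = "search_tree (r, Ss, Ls)"
  let ?env = "lists_tree Ls # lists_tree Ss # x # ?st # env"
  have null: "computes B (LLeft (LVar 1)) (x # ?st # env) Leaf"
    by (rule computes_Left'[OF computes_Var[OF refl]]) (simp add: None)
  have v1: "computes B (LLeft (LRight (LVar 1))) (x # ?st # env) (lists_tree Ss)"
    by (rule computes_Left'[OF computes_Right'[OF computes_Var[OF refl] refl]]) simp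
  have v2: "computes B (LRight (LRight (LVar 2))) (lists_tree Ss # x # ?st # env) (lists_tree Ls)"
    by (rule computes_Right'[OF computes_Right'[OF computes_Var[OF refl] refl]]) simp
  have test: "computes B (ExE (LVar 1) (ClosedE 6 0)) ?env (bool_tree (\<exists>S\<in>set Ss. block_closed A (set S)))"
  proof (rule computes_Ex[where enc = nats_tree, OF _ Ss(1)])
    show "computes B (LVar 1) ?env (list_tree (map nats_tree Ss))"
      by (intro computes_Var) (simp add: lists_tree_def)
    show "computes B (ClosedE 6 0) (nats_tree S # s # ?env) (bool_tree (block_closed A (set S)))"
      if "S \<in> set Ss" for S s
      by (rule computes_closed[OF ctx_shift(3)[OF ctx]]) (use Ss(2) that in \<open>auto simp: env_defs\<close>)
  qed
  have "computes B (ExE (LVar 1) (ExE (LVar 2) (AcceptsE cyc 8 2 0))) ?env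
     (bool_tree (\<exists>S\<in>set Ss. \<exists>L\<in>set Ls. accepts n A \<pi> cyc (set S) L))"
  proof (rule computes_Ex[where enc = nats_tree, OF _ Ss(1)])
    show "computes B (LVar 1) ?env (list_tree (map nats_tree Ss))"
      by (intro computes_Var) (simp add: lists_tree_def)
    fix S s assume S: "S \<in> set Ss"
    show "computes B (ExE (LVar 2) (AcceptsE cyc 8 2 0)) (nats_tree S # s # ?env)
        (bool_tree (\<exists>L\<in>set Ls. accepts n A \<pi> cyc (set S) L))"
    proof (rule computes_Ex[where enc = nats_tree, OF _ LsB])
      show "computes B (LVar 2) (nats_tree S # s # ?env) (list_tree (map nats_tree Ls))"
        by (intro computes_Var) (simp add: lists_tree_def)
      show "computes B (AcceptsE cyc 8 2 0) (nats_tree L # s' # nats_tree S # s # ?env)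
          (bool_tree (accepts n A \<pi> cyc (set S) L))" if "L \<in> set Ls" for L s'
        by (rule computes_accepts[OF ctx_shift(4)[OF ctx]])
          (use Ss(2) Ls(2) S that in \<open>auto simp: env_defs\<close>)
    qed
  qed
  then have found: "computes B (LNode (LNode (ExE (LVar 1) (ExE (LVar 2) (AcceptsE cyc 8 2 0))) LLeaf) (LNode (LVar 1) (LVar 0)))
      ?env (search_tree (search_step cyc (r, Ss, Ls)))" if "\<exists>S\<in>set Ss. block_closed A (set S)"
    using that None by (auto intro!: computes_Node computes_Leaf computes_Var)
  have continue: "computes B (LNode LLeaf (LNode (ExtendListsE 4 1)
           (LLet (ExtendListsE 4 0) (LLet (ExtendListsE 5 0) (ExtendListsE 6 0)))))
      ?env (search_tree (search_step cyc (r, Ss, Ls)))" if nc: "\<not> (\<exists>S\<in>set Ss. block_closed A (set S))"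
  proof -
    let ?e = "extend_lists n"
    have len: "length (?e (?e Ls)) \<le> B" using Ls(1) nc by (auto simp: set_length_extend_lists)
    have "length (?e Ls) \<le> length (?e (?e Ls))" by (simp add: set_length_extend_lists)
    then have len': "length (?e Ls) \<le> B" using len by simp
    have "computes B (LLet (ExtendListsE 4 0) (LLet (ExtendListsE 5 0) (ExtendListsE 6 0))) ?env
        (lists_tree (?e (?e (?e Ls))))"
      by (rule computes_Let[OF computes_extend_lists[OF ctx_shift(1)[OF ctx] _ LsB]], simp,
          rule computes_Let[OF computes_extend_lists[OF ctx_shift(2)[OF ctx] _ len']], simp,
          rule computes_extend_lists[OF ctx_shift(3)[OF ctx] _ len]) simp
    moreover have "computes B (ExtendListsE 4 1) ?env (lists_tree (?e Ss))"
      by (intro computes_extend_lists ctx_shift ctx Ss(1)) simp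
    moreover have "search_step cyc (r, Ss, Ls) = (None, ?e Ss, ?e (?e (?e Ls)))" using nc None by simp
    ultimately show ?thesis by (auto intro!: computes_Node computes_Leaf)
  qed
  show ?thesis unfolding SearchStepE_def
    by (rule computes_If[OF null], simp, rule computes_Let[OF v1], rule computes_Let[OF v2],
        rule computes_If[OF test]) (use found continue in auto)
qed

text \<open>The leaf added to the vertex list gives \<open>n + 1\<close> rounds, one for each of the
  sizes 0 to \<open>n\<close>. \<open>TrueE\<close> doubles as the code of the list containing only
  the empty list; extending it twice gives the anchors for size 0.\<close>

definition SearchE :: "bool \<Rightarrow> loop_expr" where
  "SearchE cyc = LLeft (LLeft (LFold (LNode LLeaf (LVar 2))
     (LNode LLeaf (LNode TrueE (LLet TrueE (LLet (ExtendListsE 1 0) (ExtendListsE 2 0)))))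
     (SearchStepE cyc)))"

lemma computes_search:
  assumes ctx: "ctx env 0" and j: "j \<le> n" "Suc n ^ (3 * j + 2) \<le> B" "3 * j + 3 < B"
    and S: "set S \<subseteq> {..<n}" "length S = j" "block_closed A (set S)"
    and least: "\<And>S. set S \<subseteq> {..<n} \<Longrightarrow> length S < j \<Longrightarrow> \<not> block_closed A (set S)"
  shows "computes B (SearchE cyc) env
    (bool_tree (\<exists>S\<in>set (lists_upto n j). \<exists>L\<in>set (lists_upto n (3 * j + 2)). accepts n A \<pi> cyc (set S) L))"
proof -
  let ?r = "\<exists>S\<in>set (lists_upto n j). \<exists>L\<in>set (lists_upto n (3 * j + 2)). accepts n A \<pi> cyc (set S) L"
  \<comment> \<open>Closed form of the state after \<open>t\<close> rounds: the search succeeds in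
    the round that starts at \<open>t = j\<close>, and from then on the state is frozen.\<close>
  define st where "st t = (if t \<le> j then (None, lists_upto n t, lists_upto n (3 * t + 2))
    else (Some ?r, lists_upto n j, lists_upto n (3 * j + 2)))" for t
  have found: "(\<exists>S\<in>set (lists_upto n t). block_closed A (set S)) \<longleftrightarrow> t = j" if "t \<le> j" for t
    using that S least by (auto simp: set_lists_upto) (meson le_less_trans linorder_neqE_nat not_le)
  have step: "search_step cyc (st t) = st (Suc t)" for t
  proof (cases "t \<le> j")
    case True
    show ?thesis
    proof (cases "t = j")
      case True
      then show ?thesis using found[of j] by (simp add: st_def)
    next
      case False
      then have "\<not> (\<exists>S\<in>set (lists_upto n t). block_closed A (set S))" "Suc t \<le> j"
        using found[of t] \<open>t \<le> j\<close> by auto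
      then show ?thesis by (simp add: st_def lists_upto_def numeral_eq_Suc)
    qed
  qed (simp add: st_def)
  have run: "fold (\<lambda>_. search_step cyc) xs (st 0) = st (length xs)" for xs :: "tree list"
    by (induction xs rule: rev_induct) (auto simp: step)
  have computes_step: "computes B (SearchStepE cyc) (x # search_tree (st t) # env)
      (search_tree (search_step cyc (st t)))" for x t
  proof -
    obtain m r where m: "st t = (r, lists_upto n m, lists_upto n (3 * m + 2))" "m \<le> j"
      unfolding st_def by (metis le_refl)
    have pow: "Suc n ^ i \<le> B" if "i \<le> 3 * j + 2" for i
      using power_increasing[of i "3 * j + 2" "Suc n"] that j(2) by simp
    show ?thesis unfolding m(1)
    proof (rule computes_search_step[OF ctx])
      show "length (lists_upto n m) \<le> B" unfolding length_lists_upto by (rule pow) (use m in simp)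
      show "\<forall>S\<in>set (lists_upto n m). set S \<subseteq> {..<n} \<and> length S + 1 < B"
        using m(2) j(3) by (auto simp: set_lists_upto)
      show "\<forall>L\<in>set (lists_upto n (3 * m + 2)). set L \<subseteq> {..<n} \<and> length L < B"
        using m(2) j(3) by (auto simp: set_lists_upto)
      show "length (lists_upto n (3 * m + 2)) * Suc n * Suc n \<le> B \<or>
        (\<exists>S\<in>set (lists_upto n m). block_closed A (set S)) \<and> length (lists_upto n (3 * m + 2)) \<le> B"
      proof (cases "m = j")
        case True
        then show ?thesis using found[of j] pow[of "3 * j + 2"] by (simp add: length_lists_upto)
      next
        case False
        have "length (lists_upto n (3 * m + 2)) * Suc n * Suc n = Suc n ^ (3 * m + 4)"
          unfolding length_lists_upto by (simp add: power_add power2_eq_square numeral_eq_Suc)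
        also have "\<dots> \<le> B" by (rule pow) (use m(2) False in simp)
        finally show ?thesis by blast
      qed
    qed
  qed
  have "computes B (LFold (LNode LLeaf (LVar 2))
     (LNode LLeaf (LNode TrueE (LLet TrueE (LLet (ExtendListsE 1 0) (ExtendListsE 2 0)))))
     (SearchStepE cyc)) env (search_tree (fold (\<lambda>_. search_step cyc) (Leaf # map nat_tree (rev [0..<n])) (st 0)))"
  proof (rule computes_Fold[where enc = id and I = "\<lambda>s. \<exists>t. s = st t"])
    show "computes B (LNode LLeaf (LVar 2)) env (list_tree (map id (Leaf # map nat_tree (rev [0..<n]))))"
      using ctx by (auto simp: env_defs nats_tree_def numeral_2_eq_2 intro!: computes_Node computes_Leaf computes_Var)
    have one: "computes B TrueE env (lists_tree [[]])" for env
      using computes_True by (simp add: lists_tree_def bool_tree_def)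
    have ctx1: "ctx (x # env) 1" "ctx (y # x # env) 2" for x y
      using ctx by (simp_all add: env_defs numeral_2_eq_2)
    have "Suc n \<le> Suc n ^ (3 * j + 2)" by (rule self_le_power) auto
    then have "length (extend_lists n [[]]) \<le> B" using j(2) by (simp add: set_length_extend_lists)
    then have "computes B (LLet TrueE (LLet (ExtendListsE 1 0) (ExtendListsE 2 0))) env
        (lists_tree (extend_lists n (extend_lists n [[]])))"
      using nB by (intro computes_Let[OF one] computes_Let[OF computes_extend_lists[OF ctx1(1)]]
          computes_extend_lists[OF ctx1(2)]) auto
    then show "computes B (LNode LLeaf (LNode TrueE (LLet TrueE (LLet (ExtendListsE 1 0) (ExtendListsE 2 0))))) env
        (search_tree (st 0))"
      using one by (auto simp: st_def lists_upto_def numeral_2_eq_2 intro!: computes_Node computes_Leaf)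
    show "computes B (SearchStepE cyc) (id y # search_tree s # env) (search_tree (search_step cyc s)) \<and>
        (\<exists>t. search_step cyc s = st t)" if "\<exists>t. s = st t" for y s
      using that computes_step step by auto
  qed (use nB in auto)
  moreover have "search_tree (fold (\<lambda>_. search_step cyc) (Leaf # map nat_tree (rev [0..<n])) (st 0)) =
      Node (Node (bool_tree ?r) Leaf) (Node (lists_tree (lists_upto n j)) (lists_tree (lists_upto n (3 * j + 2))))"
    unfolding run using j(1) by (simp add: st_def)
  ultimately show ?thesis unfolding SearchE_def by (auto intro!: computes_Left')
qed

end

text \<open>The rows of the adjacency matrix provide \<open>n\<close> in unary, from which the
  vertex list is built. \<open>SearchE\<close> mentions none of the locale parameters, so this is
  one expression for all instances.\<close>

definition MainE :: "bool \<Rightarrow> loop_expr" where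
  "MainE cyc = LLet (LFold (LLeft (LVar 0)) LLeaf
       (LNode (LIf (LVar 1) (LNode LLeaf (LLeft (LVar 1))) LLeaf) (LVar 1)))
     (LLet (LRight (LVar 1)) (LLet (LLeft (LVar 2)) (instance_env.SearchE cyc)))"

lemma computes_vertex_list:
  assumes "computes B l env (matrix_tree n R)" "n \<le> B"
  shows "computes B (LFold l LLeaf (LNode (LIf (LVar 1) (LNode LLeaf (LLeft (LVar 1))) LLeaf) (LVar 1))) env
    (nats_tree (rev [0..<n]))"
proof -
  let ?f = "\<lambda>_ V. (if V = [] then 0 else Suc (hd V)) # V"
  let ?row = "\<lambda>i. list_tree (map (\<lambda>j. bool_tree ((i, j) \<in> R)) [0..<n])"
  have "computes B (LFold l LLeaf (LNode (LIf (LVar 1) (LNode LLeaf (LLeft (LVar 1))) LLeaf) (LVar 1))) env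
    (nats_tree (fold ?f [0..<n] []))"
  proof (rule computes_Fold[where I = "\<lambda>_. True" and enc = ?row])
    show "computes B l env (list_tree (map ?row [0..<n]))" using assms(1) by (simp add: matrix_tree_def)
    show "computes B (LNode (LIf (LVar 1) (LNode LLeaf (LLeft (LVar 1))) LLeaf) (LVar 1))
        (?row i # nats_tree V # env) (nats_tree (?f i V)) \<and> True" for i V
      by (cases V) (auto intro!: computes_Node computes_Leaf computes_Left'[OF computes_Var]
          computes_If[OF computes_Var[OF refl]] computes_Var)
  qed (use assms(2) in \<open>auto intro: computes_Leaf\<close>)
  moreover have "fold ?f [0..<m] [] = rev [0..<m]" for m
    by (induction m) (auto simp: hd_rev)
  ultimately show ?thesis by simp
qed

lemma computes_Main:
  fixes G :: "nat pair_pre_digraph"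
  assumes G: "pair_graph G" "pverts G = {..<n}" and k: "distance_to_block (with_proj G) = k"
    and B: "Suc n ^ (3 * k + 2) \<le> B" "3 * k + 3 < B" "n < B"
  shows "computes B (MainE cyc) [instance_tree (with_proj G) \<pi>]
    (bool_tree (\<exists>p. p \<noteq> [] \<and> distinct p \<and> set p = {..<n} \<and> walk_in (parcs G) p \<and> extending \<pi> p \<and>
      (cyc \<longrightarrow> (hd p, last p) \<in> parcs G)))"
proof -
  interpret pair_graph G by (rule G)
  let ?A = "parcs G"
  have bound: "?A \<subseteq> {..<n} \<times> {..<n}" using in_arcsD1 in_arcsD2 G(2) by auto
  have symA: "sym ?A" using pair_sym_arcs by (simp add: symmetric_def)
  interpret instance_env n ?A \<pi> B using bound symA B(3) by unfold_locales
  let ?P = "\<lambda>j. \<exists>S. set S \<subseteq> {..<n} \<and> length S = j \<and> block_closed ?A (set S)"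
  obtain S0 where S0: "S0 \<subseteq> {..<n}" "card S0 = k" "block_closed ?A S0"
    using distance_to_block_attained[OF G(1)] G(2) k by auto
  then obtain xs where "set xs = S0" "distinct xs"
    using finite_distinct_list[of S0] finite_subset[of S0 "{..<n}"] by auto
  then have "?P k" using S0 distinct_card[of xs] by (intro exI[of _ xs]) auto
  \<comment> \<open>The search stops at the least size whose lists include one that passes the test.
    A deletion set realising the distance shows \<open>j \<le> k\<close>, which makes the bound in
    terms of \<open>k\<close> applicable.\<close>
  define j where "j = (LEAST j. ?P j)"
  have "?P j" unfolding j_def using \<open>?P k\<close> by (rule LeastI)
  then obtain S where S: "set S \<subseteq> {..<n}" "length S = j" "block_closed ?A (set S)" by blast
  have least: "\<not> block_closed ?A (set S)" if "set S \<subseteq> {..<n}" "length S < j" for S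
    using not_less_Least[of "length S" ?P] that unfolding j_def by blast
  have "j \<le> k" unfolding j_def using \<open>?P k\<close> by (rule Least_le)
  moreover have "k \<le> n" using S0(1,2) card_mono[of "{..<n}" S0] by simp
  moreover have "Suc n ^ (3 * j + 2) \<le> Suc n ^ (3 * k + 2)"
    using \<open>j \<le> k\<close> by (intro power_increasing) auto
  ultimately have j: "j \<le> n" "Suc n ^ (3 * j + 2) \<le> B" "3 * j + 3 < B" using B(1,2) by auto
  let ?sol = "\<lambda>p. p \<noteq> [] \<and> distinct p \<and> set p = {..<n} \<and> walk_in ?A p \<and> extending \<pi> p \<and>
      (cyc \<longrightarrow> (hd p, last p) \<in> ?A)"
  have "(\<exists>S\<in>set (lists_upto n j). \<exists>L\<in>set (lists_upto n (3 * j + 2)). accepts n ?A \<pi> cyc (set S) L) \<longleftrightarrow>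
    (\<exists>p. ?sol p)"
  proof
    assume "\<exists>S\<in>set (lists_upto n j). \<exists>L\<in>set (lists_upto n (3 * j + 2)). accepts n ?A \<pi> cyc (set S) L"
    then obtain S L where "L \<in> set (lists_upto n (3 * j + 2))" "accepts n ?A \<pi> cyc (set S) L" by blast
    then show "\<exists>p. ?sol p" using accepts_sound[of n ?A \<pi> cyc "set S" L] by (simp add: set_lists_upto)
  next
    assume "\<exists>p. ?sol p"
    then obtain p where p: "?sol p" ..
    then obtain L where L: "set L \<subseteq> {..<n}" "length L \<le> 3 * card (set S) + 2" "accepts n ?A \<pi> cyc (set S) L"
      using accepts_complete[OF symA bound S(3), of p \<pi> cyc] by auto
    moreover have "card (set S) \<le> j" using card_length[of S] S(2) by simp
    ultimately have "L \<in> set (lists_upto n (3 * j + 2))" by (simp add: set_lists_upto)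
    moreover have "S \<in> set (lists_upto n j)" using S by (simp add: set_lists_upto)
    ultimately show "\<exists>S\<in>set (lists_upto n j). \<exists>L\<in>set (lists_upto n (3 * j + 2)). accepts n ?A \<pi> cyc (set S) L"
      using L(3) by blast
  qed
  moreover
  let ?x = "instance_tree (with_proj G) \<pi>"
  let ?V = "nats_tree (rev [0..<n])"
  have x: "?x = Node (matrix_tree n ?A) (matrix_tree n \<pi>)"
    using G(2) by (simp add: instance_tree_def)
  have "ctx [matrix_tree n ?A, matrix_tree n \<pi>, ?V, ?x] 0" by (simp add: env_defs)
  from computes_search[OF this j S least, of cyc]
  have "computes B (SearchE cyc) [matrix_tree n ?A, matrix_tree n \<pi>, ?V, ?x]
    (bool_tree (\<exists>S\<in>set (lists_upto n j). \<exists>L\<in>set (lists_upto n (3 * j + 2)). accepts n ?A \<pi> cyc (set S) L))" .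
  then have "computes B (MainE cyc) [?x]
    (bool_tree (\<exists>S\<in>set (lists_upto n j). \<exists>L\<in>set (lists_upto n (3 * j + 2)). accepts n ?A \<pi> cyc (set S) L))"
    unfolding MainE_def
    by (intro computes_Let[OF computes_vertex_list[where R = ?A and n = n]]
          computes_Let[where y = "matrix_tree n \<pi>"] computes_Let[where y = "matrix_tree n ?A"]
          computes_Left'[OF computes_Var] computes_Right'[OF computes_Var])
      (use B(3) x in \<open>auto simp: numeral_2_eq_2\<close>)
  ultimately show ?thesis by simp
qed

text \<open>The exponent is brought to the form \<open>e * max 1 k\<close> by
  \<open>3 * k + 4 \<le> 7 * max 1 k\<close>. Then \<open>n + 2 \<le> n * n\<close> doubles it if
  \<open>n \<ge> 2\<close>. For smaller \<open>n\<close> the assumption gives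
  \<open>max 1 k = 1\<close>, so the additive constant \<open>3 ^ e\<close> covers
  everything.\<close>

lemma power_bound:
  fixes n k C d :: nat
  assumes "k \<le> n"
  defines "e \<equiv> C + 7 * d"
  shows "C * Suc ((n + 2) ^ (3 * k + 3)) ^ d \<le> n ^ ((2 * e + 3 ^ e) * max 1 k) + (2 * e + 3 ^ e)"
proof -
  have "Suc ((n + 2) ^ (3 * k + 3)) \<le> 2 * (n + 2) ^ (3 * k + 3)" by (simp add: Suc_le_eq)
  also have "\<dots> \<le> (n + 2) * (n + 2) ^ (3 * k + 3)" by (intro mult_le_mono1) simp
  also have "\<dots> = (n + 2) ^ (3 * k + 4)" by (simp add: numeral_eq_Suc)
  finally have "Suc ((n + 2) ^ (3 * k + 3)) ^ d \<le> (n + 2) ^ ((3 * k + 4) * d)"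
    unfolding power_mult by (rule power_mono) simp
  moreover have "C \<le> (n + 2) ^ C"
    using less_exp[of C] power_mono[of 2 "n + 2" C] by linarith
  ultimately have "C * Suc ((n + 2) ^ (3 * k + 3)) ^ d \<le> (n + 2) ^ C * (n + 2) ^ ((3 * k + 4) * d)"
    by (intro mult_le_mono)
  also have "\<dots> = (n + 2) ^ (C + (3 * k + 4) * d)" by (simp add: power_add)
  also have "\<dots> \<le> (n + 2) ^ (e * max 1 k)"
  proof (rule power_increasing)
    have "C \<le> C * max 1 k" by (simp add: max_def)
    moreover have "(3 * k + 4) * d \<le> 7 * max 1 k * d" by (intro mult_le_mono1) simp
    moreover have "e * max 1 k = C * max 1 k + 7 * max 1 k * d"
      unfolding e_def by (simp add: algebra_simps)
    ultimately show "C + (3 * k + 4) * d \<le> e * max 1 k" by linarith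
  qed simp
  also have "\<dots> \<le> n ^ ((2 * e + 3 ^ e) * max 1 k) + (2 * e + 3 ^ e)"
  proof (cases "n \<ge> 2")
    case True
    then have "n + 2 \<le> n * n" using mult_le_mono1[OF True, of n] by linarith
    then have "(n + 2) ^ (e * max 1 k) \<le> (n ^ 2) ^ (e * max 1 k)"
      by (intro power_mono) (auto simp: power2_eq_square)
    also have "\<dots> = n ^ (2 * e * max 1 k)" by (simp only: power_mult[symmetric] mult.assoc)
    also have "\<dots> \<le> n ^ ((2 * e + 3 ^ e) * max 1 k)"
      using True by (intro power_increasing mult_le_mono1) auto
    finally show ?thesis by simp
  next
    case False
    then have "max 1 k = 1" using assms(1) by auto
    then have "(n + 2) ^ (e * max 1 k) \<le> 3 ^ e" using False by (simp add: power_mono)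
    then show ?thesis by simp
  qed
  finally show ?thesis .
qed

section \<open>Both problems as instances of one search\<close>

lemma walk_in_vwalk_arcs: "walk_in A p \<longleftrightarrow> set (vwalk_arcs p) \<subseteq> A"
  by (induction p rule: vwalk_arcs.induct) auto

lemma hamiltonian_path_iff:
  "pverts G = {..<n} \<Longrightarrow> hamiltonian_path (with_proj G) p \<longleftrightarrow>
     p \<noteq> [] \<and> distinct p \<and> set p = {..<n} \<and> walk_in (parcs G) p"
  unfolding hamiltonian_path_def vpath_def vwalk_def walk_in_vwalk_arcs by auto

lemma decides_if_cyc:
  assumes "\<And>G \<pi> n. pair_graph G \<Longrightarrow> pverts G = {..<n} \<Longrightarrow> Q (with_proj G) \<pi> \<longleftrightarrow>
    (\<exists>p. p \<noteq> [] \<and> distinct p \<and> set p = {..<n} \<and> walk_in (parcs G) p \<and> extending \<pi> p \<and>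
      (cyc \<longrightarrow> (hd p, last p) \<in> parcs G))"
  shows "\<exists>P. decides_in_n_to_O_k P Q distance_to_block"
proof -
  obtain C d P where P: "\<And>B x. loops_bounded B (MainE cyc) [x] \<Longrightarrow>
      \<exists>t \<le> C * Suc B ^ d. runs P x t (loop_val (MainE cyc) [x])"
    using loop_expr_program[of "MainE cyc"] by auto
  define e where "e = C + 7 * d"
  have "\<exists>t \<le> n ^ ((2 * e + 3 ^ e) * max 1 k) + (2 * e + 3 ^ e).
      runs P (instance_tree (with_proj G) \<pi>) t (bool_tree (Q (with_proj G) \<pi>))"
    if G: "pair_graph G" "pverts G = {..<n}" and k: "distance_to_block (with_proj G) = k" for G \<pi> n k
  proof -
    \<comment> \<open>With base \<open>n + 2\<close> the powers exceed \<open>3 * k + 3\<close> even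
      for \<open>n = 0\<close>, so a single bound covers the enumerations, the lengths of the
      guesses and the vertex loops.\<close>
    let ?B = "(n + 2) ^ (3 * k + 3)"
    obtain S where "S \<subseteq> {..<n}" "card S = k"
      using distance_to_block_attained[OF G(1)] G(2) k by auto
    then have "k \<le> n" using card_mono[of "{..<n}" S] by simp
    have "Suc n ^ (3 * k + 2) \<le> (n + 2) ^ (3 * k + 2)" by (rule power_mono) auto
    also have "\<dots> \<le> ?B" by (rule power_increasing) auto
    finally have 1: "Suc n ^ (3 * k + 2) \<le> ?B" .
    have 2: "3 * k + 3 < ?B"
      using less_exp[of "3 * k + 3"] power_mono[of 2 "n + 2" "3 * k + 3"] by linarith
    have "n + 2 \<le> ?B" by (rule self_le_power) auto
    then have 3: "n < ?B" by simp
    have "computes ?B (MainE cyc) [instance_tree (with_proj G) \<pi>] (bool_tree (Q (with_proj G) \<pi>))"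
      using computes_Main[OF G k 1 2 3, of cyc \<pi>] assms[OF G, of \<pi>] by simp
    then obtain t where t: "t \<le> C * Suc ?B ^ d"
        "runs P (instance_tree (with_proj G) \<pi>) t (bool_tree (Q (with_proj G) \<pi>))"
      using P[of ?B "instance_tree (with_proj G) \<pi>"] unfolding computes_def by auto
    then show ?thesis
      using power_bound[OF \<open>k \<le> n\<close>, of C d, folded e_def] order_trans by blast
  qed
  then show ?thesis unfolding decides_in_n_to_O_k_def by blast
qed

theorem theorem4p6:
  shows "(\<exists>P. decides_in_n_to_O_k P POHPP distance_to_block) \<and>
    (\<exists>P. decides_in_n_to_O_k P POHCP distance_to_block)"
proof
  show "\<exists>P. decides_in_n_to_O_k P POHPP distance_to_block"
    by (rule decides_if_cyc[of _ False]) (auto simp: POHPP_def hamiltonian_path_iff)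
  show "\<exists>P. decides_in_n_to_O_k P POHCP distance_to_block"
    by (rule decides_if_cyc[of _ True]) (auto simp: POHCP_def hamiltonian_path_iff)
qed

end
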